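(* Let $A\ge 2$ be an integer, $\gamma\in\Delta_{A-1}$, $\beta>1$, and let $F_i(k)=k^\beta$ for all $i\in\{1,\dots,A\}$. Then there is $r_c'>0$ such that for all $r\in[0,1]$ with $r<r_c'$ and every initial condition $X(0)\in[1,\infty)^A$, the limit $\chi(\infty)=\lim_{n\to\infty}\chi(n)$ of the shares of the generalized Pólya urn process with labor share $r$, wage vector $\gamma$ and feedback functions $F_1,\dots,F_A$ satisfies $$\mathbb{P}\big(\exists!\,i\in\{1,\dots,A\}:\ \chi_i(\infty)>\gamma_i\big)=1$$ and, for all $i\in\{1,\dots,A\}$, $$\mathbb{P}\big(\chi_i(\infty)>\gamma_i\big)>0 .$$
   Context: Let $\Delta_{A-1}=\{x\in[0,1]^A:\sum_{i=1}^A x_i=1\}$ and let $e^{(i)}$ be the $i$-th standard unit vector of $\mathbb{R}^A$. Process: given $r\in[0,1]$, $\gamma\in\Delta_{A-1}$, feedback functions $F_i:(0,\infty)\to(0,\infty)$ and $X(0)\in[1,\infty)^A$, $X(n)=(X_1(n),\dots,X_A(n))$, $n\in\mathbb{N}_0$, is the time-homogeneous Markov chain on $[1,\infty)^A$ with transition probabilities $$\mathbb{P}\big(X(n+1)-X(n)=v^{(i)}\mid X(n)\big)=\frac{F_i(X_i(n))}{F_1(X_1(n))+\dots+F_A(X_A(n))},\qquad v^{(i)}=(1-r)e^{(i)}+r\gamma,\quad i=1,\dots,A$$ (for each step an index $i$ is drawn with this probability and $v^{(i)}$ is added). With $N=X_1(0)+\dots+X_A(0)$, the shares are $\chi(n)=\frac{1}{N+n}X(n)\in\Delta_{A-1}$,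 and $\chi(\infty)$ denotes the almost sure limit of $\chi(n)$ as $n\to\infty$, which exists for feedback functions of the form $F_i(k)=\alpha_i k^\beta$, $\alpha_i>0$.
   Formalization: The formal statement additionally assumes γ_i < 1 for all i (γ is not a vertex of the simplex); at γ = e^(i) the claim P(χ_i(∞) > γ_i) > 0 is false, because shares never exceed 1. *)

theory Defs
  imports "HOL-Probability.Probability"
begin

definition prob_simplex :: "(real ^ 'a) set" where
  "prob_simplex = {x. (\<forall>i. 0 \<le> x $ i \<and> x $ i \<le> 1) \<and> (\<Sum>i\<in>UNIV. x $ i) = 1}"

text \<open>The theorem also requires \<open>\<gamma> $ i < 1\<close> for all \<open>i\<close>, i.e. that \<open>\<gamma>\<close> is not a vertex of the
  simplex: shares never exceed 1, so \<open>\<gamma> $ i = 1\<close> would make the event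
  \<open>limit_share X \<omega> $ i > \<gamma> $ i\<close> null.\<close>

definition urn_increment :: "real \<Rightarrow> real ^ 'a \<Rightarrow> 'a \<Rightarrow> real ^ 'a" where
  "urn_increment r \<gamma> i = (1 - r) *\<^sub>R axis i 1 + r *\<^sub>R \<gamma>"

definition urn_draw :: "('a \<Rightarrow> real \<Rightarrow> real) \<Rightarrow> real ^ 'a \<Rightarrow> 'a::finite pmf" where
  "urn_draw F x = embed_pmf (\<lambda>i. F i (x $ i) / (\<Sum>j\<in>UNIV. F j (x $ j)))"

lemma pmf_urn_draw:
  assumes "\<And>i k. 0 < k \<Longrightarrow> 0 < F i k" and "\<And>i. 0 < x $ i"
  shows "pmf (urn_draw F x) i = F i (x $ i) / (\<Sum>j\<in>UNIV. F j (x $ j))"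
proof -
  have pos: "0 < F j (x $ j)" for j using assms by blast
  then have S: "0 < (\<Sum>j\<in>UNIV. F j (x $ j))" by (simp add: sum_pos)
  have nn: "0 \<le> F j (x $ j) / (\<Sum>j\<in>UNIV. F j (x $ j))" for j
    using pos[of j] S by simp
  have "(\<Sum>j\<in>UNIV. F j (x $ j) / (\<Sum>j\<in>UNIV. F j (x $ j))) = 1"
    using S by (simp flip: sum_divide_distrib)
  then have "(\<integral>\<^sup>+ j. ennreal (F j (x $ j) / (\<Sum>j\<in>UNIV. F j (x $ j))) \<partial>count_space UNIV) = 1"
    using nn by (simp add: nn_integral_count_space_finite sum_ennreal)
  then show ?thesis
    unfolding urn_draw_def using nn by (intro pmf_embed_pmf) auto
qed

text \<open>The one-step transition law out of state \<open>x\<close>. Pushing the drawn index forward adds up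
  the probabilities of indices with equal increments, which matters only for \<open>r = 1\<close>.\<close>

definition urn_kernel ::
    "real \<Rightarrow> real ^ 'a \<Rightarrow> ('a \<Rightarrow> real \<Rightarrow> real) \<Rightarrow> real ^ 'a \<Rightarrow> (real ^ 'a::finite) pmf" where
  "urn_kernel r \<gamma> F x = map_pmf (\<lambda>i. x + urn_increment r \<gamma> i) (urn_draw F x)"

text \<open>The sub-\<open>\<sigma>\<close>-algebra generated by \<open>X 0, \<dots>, X n\<close>.\<close>

definition history :: "'w measure \<Rightarrow> (nat \<Rightarrow> 'w \<Rightarrow> 'b::topological_space) \<Rightarrow> nat \<Rightarrow> 'w measure" where
  "history M X n =
     vimage_algebra (space M) (\<lambda>\<omega>. \<lambda>k\<in>{..n}. X k \<omega>) (\<Pi>\<^sub>M k\<in>{..n}. borel)"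

lemma subalgebra_history:
  assumes "\<And>n. X n \<in> borel_measurable M"
  shows "subalgebra M (history M X n)"
proof -
  have "(\<lambda>\<omega>. \<lambda>k\<in>{..n}. X k \<omega>) \<in> measurable M (\<Pi>\<^sub>M k\<in>{..n}. borel)"
    using assms by (intro measurable_restrict) auto
  then show ?thesis
    unfolding subalgebra_def history_def
    by (auto simp: measurable_def sets_vimage_algebra2)
qed

text \<open>A generalized Polya urn process with deterministic initial condition \<open>x0\<close>: the assumption
  \<open>markov\<close> combines the Markov property, time-homogeneity and the transition probabilities.\<close>

locale polya_urn = prob_space M
  for M :: "'w measure" +
  fixes r :: real
    and \<gamma> :: "real ^ 'a::finite"
    and F :: "'a \<Rightarrow> real \<Rightarrow> real"
    and x0 :: "real ^ 'a"
    and X :: "nat \<Rightarrow> 'w \<Rightarrow> real ^ 'a"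
  assumes r: "0 \<le> r" "r \<le> 1"
    and \<gamma>: "\<gamma> \<in> prob_simplex"
    and F_pos: "\<And>i k. 0 < k \<Longrightarrow> 0 < F i k"
    and x0: "\<And>i. 1 \<le> x0 $ i"
    and X_measurable: "\<And>n. X n \<in> borel_measurable M"
    and init: "AE \<omega> in M. X 0 \<omega> = x0"
    and markov: "\<And>n B. B \<in> sets borel \<Longrightarrow>
      AE \<omega> in M. real_cond_exp M (history M X n) (\<lambda>\<omega>'. indicator B (X (Suc n) \<omega>')) \<omega>
                  = measure_pmf.prob (urn_kernel r \<gamma> F (X n \<omega>)) B"

definition share :: "(nat \<Rightarrow> 'w \<Rightarrow> real ^ 'a::finite) \<Rightarrow> nat \<Rightarrow> 'w \<Rightarrow> real ^ 'a" where
  "share X n \<omega> = (1 / ((\<Sum>i\<in>UNIV. X 0 \<omega> $ i) + real n)) *\<^sub>R X n \<omega>"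

text \<open>Meaningful only where the shares converge; \<^const>\<open>lim\<close> is an unspecified value elsewhere.\<close>

definition limit_share :: "(nat \<Rightarrow> 'w \<Rightarrow> real ^ 'a::finite) \<Rightarrow> 'w \<Rightarrow> real ^ 'a" where
  "limit_share X \<omega> = lim (\<lambda>n. share X n \<omega>)"

end

theory Submission
  imports Defs
begin

text \<open>The shares \<open>x\<close> perform a stochastic approximation: with \<open>m = N + n\<close>, one step replaces \<open>x\<close> by
\<open>x + (v - x) / (m + 1)\<close>, where the mean of \<open>v - x\<close> is the mean field \<open>G x = (1 - r) p x + r \<gamma> - x\<close> and
\<open>p\<close> is the vector of drawing probabilities. No comparison with an ordinary differential equation is
made. The behaviour near a fixed point comes from an explicit function \<open>f\<^sub>n\<close> of the state whose one-step
average contracts by a factor \<open>1 - c / (m + 1)\<close> as long as the path stays in some region. Since the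
harmonic series diverges, such a function tends to 0 on almost every path that stays
(\<open>decay_while_staying\<close>).

Convergence to the fixed points. For \<open>x\<^sub>i > 0\<close> the function
\<open>L x = (1 - r) / \<beta> * ln (\<Sum>\<^sub>i x\<^sub>i\<^sup>\<beta>) + r \<Sum>\<^sub>i \<gamma>\<^sub>i ln x\<^sub>i\<close> has partial derivatives \<open>1 + G\<^sub>i / x\<^sub>i\<close>. Hence \<open>L\<close> grows on average by at
least \<open>\<bar>G x\<bar>\<^sup>2 / (m + 1)\<close> up to a summable error, and as \<open>L\<close> is bounded along the path, \<open>G\<close> tends to 0
(\<open>AE_drift_vanishes\<close>). The zeros of \<open>p x - x\<close> are the uniform distributions on nonempty sets
\<open>S\<close> of agents, so for small \<open>r\<close> the path ends up near one of them; as the steps tend to 0, it ends up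
near a single one.

For \<open>x\<close> and \<open>y\<close> near the uniform distribution on \<open>S\<close>, the difference \<open>p x - p y\<close> is close, relative to
\<open>\<bar>x - y\<bar>\<close>, to \<open>\<beta>\<close> times the projection of \<open>x - y\<close> that removes the mean over \<open>S\<close> and everything outside \<open>S\<close>
(\<open>draw_prob_strict_derivative\<close>). If \<open>S\<close> has one element, this projection vanishes: the mean increment
\<open>(1 - r) p x + r \<gamma>\<close> is a contraction near the vertex, has a unique fixed point \<open>q\<close> there, and the path
converges to \<open>q\<close> if it stays. The coordinate of \<open>q\<close> that exceeds its wage is the one of the vertex, and only
this one, because a small positive share is drawn with an even smaller probability
(\<open>vertex_fixed_point\<close>).

If \<open>S\<close> has at least two elements, let \<open>q\<close> be a fixed point near it and let \<open>V\<close> be the squared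
fluctuation of \<open>x - q\<close> inside \<open>S\<close> minus its squared norm outside \<open>S\<close>. The form \<open>V\<close> is
expanded by the drift, and a draw inside \<open>S\<close> adds noise to its positive part. The algebra
is exact: \<open>m V\<close> changes in one step by a quantity with mean at least \<open>\<rho> \<bar>x - q\<bar>\<^sup>2 + c / (m + 1)\<close> and absolute value at
most a constant times \<open>\<bar>x - q\<bar> + 1 / (m + 1)\<close>. Therefore \<open>exp (- \<epsilon> m V)\<close> decays, which forces \<open>m V\<close> to
infinity on the paths that stay; but once \<open>m V\<close> is large, \<open>1 / V\<close> decays too, although \<open>V\<close> is bounded.
So almost no path stays near such a point (\<open>repelled\<close>), and all of them converge near a vertex.

Finally each agent wins with positive probability: it may be drawn in all of the first \<open>n\<close> steps, which puts the
shares near the corresponding vertex, and by the maximal inequality a path that starts there so late stays with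
positive probability.\<close>

section \<open>The feedback map on the simplex\<close>

definition weight :: "real \<Rightarrow> real ^ 'a::finite \<Rightarrow> real" where
  "weight \<beta> x = (\<Sum>i\<in>UNIV. x $ i powr \<beta>)"

definition draw_prob :: "real \<Rightarrow> real ^ 'a::finite \<Rightarrow> real ^ 'a" where
  "draw_prob \<beta> x = (\<chi> i. x $ i powr \<beta> / weight \<beta> x)"

text \<open>The expected increment of the urn at shares \<open>x\<close>; its fixed points are the equilibria of the shares.\<close>

definition mean_increment :: "real \<Rightarrow> real \<Rightarrow> real ^ 'a::finite \<Rightarrow> real ^ 'a \<Rightarrow> real ^ 'a" where
  "mean_increment \<beta> r \<gamma> x = (1 - r) *\<^sub>R draw_prob \<beta> x + r *\<^sub>R \<gamma>"

definition uniform_on :: "'a set \<Rightarrow> real ^ 'a::finite" where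
  "uniform_on S = (\<chi> i. if i \<in> S then 1 / card S else 0)"

text \<open>The derivative of \<^const>\<open>draw_prob\<close> at the uniform distribution on \<open>S\<close>.\<close>

definition spread :: "real \<Rightarrow> 'a set \<Rightarrow> real ^ 'a::finite \<Rightarrow> real ^ 'a" where
  "spread \<beta> S d = (\<chi> i. if i \<in> S then \<beta> * (d $ i - (\<Sum>j\<in>S. d $ j) / card S) else 0)"

lemma draw_prob_nth: "draw_prob \<beta> x $ i = x $ i powr \<beta> / weight \<beta> x"
  by (simp add: draw_prob_def)

lemma mean_increment_nth:
  "mean_increment \<beta> r \<gamma> x $ i = (1 - r) * draw_prob \<beta> x $ i + r * \<gamma> $ i"
  by (simp add: mean_increment_def)

lemma simplex_nonneg: "x \<in> prob_simplex \<Longrightarrow> 0 \<le> x $ i"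
  and simplex_le_1: "x \<in> prob_simplex \<Longrightarrow> x $ i \<le> 1"
  and simplex_sum: "x \<in> prob_simplex \<Longrightarrow> (\<Sum>i\<in>UNIV. x $ i) = 1"
  by (auto simp: prob_simplex_def)

lemma simplexI:
  assumes "\<And>i. 0 \<le> x $ i" "(\<Sum>i\<in>UNIV. x $ i) = 1"
  shows "x \<in> prob_simplex"
proof -
  have "x $ i \<le> 1" for i
    using member_le_sum[of i UNIV "\<lambda>i. x $ i"] assms by auto
  then show ?thesis
    using assms by (auto simp: prob_simplex_def)
qed

lemma weight_lower:
  fixes x :: "real ^ 'a::finite"
  assumes "x \<in> prob_simplex" "\<beta> > 0"
  shows "(1 / CARD('a)) powr \<beta> \<le> weight \<beta> x"
proof -
  have "\<exists>i. 1 / CARD('a) \<le> x $ i"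
  proof (rule ccontr)
    assume "\<not> ?thesis"
    then have "x $ i < 1 / CARD('a)" for i by (auto simp: not_le)
    then have "(\<Sum>i\<in>UNIV. x $ i) < (\<Sum>i\<in>(UNIV::'a set). 1 / CARD('a))"
      by (intro sum_strict_mono) auto
    then show False using simplex_sum[OF assms(1)] by simp
  qed
  then obtain i where i: "1 / CARD('a) \<le> x $ i" ..
  have "(1 / CARD('a)) powr \<beta> \<le> x $ i powr \<beta>"
    using i assms by (intro powr_mono2) auto
  also have "\<dots> \<le> weight \<beta> x"
    unfolding weight_def by (rule member_le_sum) auto
  finally show ?thesis .
qed

lemma weight_pos:
  fixes x :: "real ^ 'a::finite"
  assumes "x \<in> prob_simplex" "\<beta> > 0"
  shows "0 < weight \<beta> x"
proof -
  have "0 < (1 / CARD('a)) powr \<beta>" by simp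
  then show ?thesis using weight_lower[OF assms] by linarith
qed

lemma draw_prob_simplex:
  assumes "0 < weight \<beta> x"
  shows "draw_prob \<beta> x \<in> prob_simplex"
proof (rule simplexI)
  show "0 \<le> draw_prob \<beta> x $ i" for i
    using assms by (simp add: draw_prob_nth)
  show "(\<Sum>i\<in>UNIV. draw_prob \<beta> x $ i) = 1"
    using assms by (simp add: draw_prob_nth flip: sum_divide_distrib weight_def)
qed

lemma simplex_mix:
  assumes "x \<in> prob_simplex" "y \<in> prob_simplex" "0 \<le> r" "r \<le> 1"
  shows "(1 - r) *\<^sub>R x + r *\<^sub>R y \<in> prob_simplex"
proof (rule simplexI)
  show "0 \<le> ((1 - r) *\<^sub>R x + r *\<^sub>R y) $ i" for i
    using assms by (auto intro!: add_nonneg_nonneg mult_nonneg_nonneg simplex_nonneg)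
  show "(\<Sum>i\<in>UNIV. ((1 - r) *\<^sub>R x + r *\<^sub>R y) $ i) = 1"
    using assms by (simp add: sum.distrib simplex_sum flip: sum_distrib_left)
qed

lemma uniform_on_simplex:
  assumes "S \<noteq> {}"
  shows "uniform_on S \<in> prob_simplex"
proof (rule simplexI)
  have "(\<Sum>i\<in>UNIV. uniform_on S $ i) = (\<Sum>i\<in>UNIV \<inter> S. 1 / real (card S))"
    unfolding uniform_on_def by (subst sum.inter_restrict) auto
  then show "(\<Sum>i\<in>UNIV. uniform_on S $ i) = 1"
    using assms by (simp add: card_gt_0_iff)
qed (simp add: uniform_on_def)

lemma axis_simplex: "axis i 1 \<in> prob_simplex"
  by (rule simplexI) (simp_all add: axis_def)

lemma norm_le_of_components:
  fixes x :: "real ^ 'a::finite" and c :: real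
  assumes "\<And>i. \<bar>x $ i\<bar> \<le> c"
  shows "norm x \<le> CARD('a) * c"
  using norm_le_l1_cart[of x] sum_mono[of UNIV "\<lambda>i. \<bar>x $ i\<bar>" "\<lambda>i. c"] assms by simp

lemma norm_simplex_le_1:
  assumes "x \<in> prob_simplex"
  shows "norm x \<le> 1"
proof -
  have "norm x \<le> (\<Sum>i\<in>UNIV. \<bar>x $ i\<bar>)" by (rule norm_le_l1_cart)
  also have "\<dots> = 1" using assms by (simp add: simplex_nonneg simplex_sum)
  finally show ?thesis .
qed

lemma norm_simplex_diff_le_2:
  assumes "x \<in> prob_simplex" "y \<in> prob_simplex"
  shows "norm (x - y) \<le> 2"
  using norm_triangle_ineq4[of x y] norm_simplex_le_1[OF assms(1)] norm_simplex_le_1[OF assms(2)]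
  by linarith

text \<open>For \<open>\<beta> > 1\<close> the mean value theorem for \<open>t powr \<beta>\<close> holds up to the endpoint 0, at which the derivative
  vanishes. The boundary of the simplex therefore causes no singularity.\<close>

lemma powr_mean_value:
  fixes s t :: real
  assumes "0 \<le> s" "0 \<le> t" "\<beta> > 1"
  obtains z where "min s t \<le> z" "z \<le> max s t"
    "t powr \<beta> - s powr \<beta> = \<beta> * z powr (\<beta> - 1) * (t - s)"
proof -
  have *: "\<exists>z\<ge>a. z \<le> b \<and> b powr \<beta> - a powr \<beta> = \<beta> * z powr (\<beta> - 1) * (b - a)"
    if "0 \<le> a" "a < b" for a b :: real
  proof -
    have "\<exists>z. a < z \<and> z < b \<and> b powr \<beta> - a powr \<beta> = (\<lambda>h. h * (\<beta> * z powr (\<beta> - 1))) (b - a)"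
    proof (rule mvt[of a b "\<lambda>x. x powr \<beta>" "\<lambda>z h. h * (\<beta> * z powr (\<beta> - 1))", OF that(2)])
      show "continuous_on {a..b} (\<lambda>x. x powr \<beta>)"
        using that assms by (intro continuous_on_powr' continuous_intros) auto
      show "((\<lambda>x. x powr \<beta>) has_derivative (\<lambda>h. h * (\<beta> * x powr (\<beta> - 1)))) (at x)"
        if "a < x" "x < b" for x
        using has_real_derivative_powr[of x \<beta>] that \<open>0 \<le> a\<close>
        by (simp add: has_field_derivative_def mult.commute[of _ "\<beta> * _"])
    qed blast
    then obtain z where "a < z" "z < b" "b powr \<beta> - a powr \<beta> = (b - a) * (\<beta> * z powr (\<beta> - 1))"
      by blast
    then show ?thesis by (intro exI[of _ z]) (simp add: mult.commute)
  qed
  show ?thesis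
  proof (cases s t rule: linorder_cases)
    case less
    then show ?thesis using *[of s t] assms that by (auto simp: min_def max_def)
  next
    case equal
    then show ?thesis using that[of s] by simp
  next
    case greater
    then obtain z where "z \<ge> t" "z \<le> s" "s powr \<beta> - t powr \<beta> = \<beta> * z powr (\<beta> - 1) * (s - t)"
      using *[of t s] assms by auto
    then show ?thesis using that[of z] greater
      by (simp add: min_def max_def algebra_simps)
  qed
qed

lemma powr_strict_derivative:
  fixes c :: real
  assumes "0 \<le> c" "\<beta> > 1" "e > 0"
  obtains \<delta> where "\<delta> > 0"
    "\<And>s t. 0 \<le> s \<Longrightarrow> 0 \<le> t \<Longrightarrow> \<bar>s - c\<bar> < \<delta> \<Longrightarrow> \<bar>t - c\<bar> < \<delta> \<Longrightarrow>
       \<bar>t powr \<beta> - s powr \<beta> - \<beta> * c powr (\<beta> - 1) * (t - s)\<bar> \<le> e * \<bar>t - s\<bar>"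
proof -
  have "continuous_on {0..} (\<lambda>z::real. \<beta> * z powr (\<beta> - 1))"
    using assms by (intro continuous_on_powr' continuous_intros) auto
  then obtain \<delta> where \<delta>: "\<delta> > 0"
    "\<And>z. 0 \<le> z \<Longrightarrow> \<bar>z - c\<bar> < \<delta> \<Longrightarrow> \<bar>\<beta> * z powr (\<beta> - 1) - \<beta> * c powr (\<beta> - 1)\<bar> < e"
    using assms unfolding continuous_on_iff dist_real_def by (metis atLeast_iff)
  show ?thesis
  proof (rule that[OF \<delta>(1)])
    fix s t :: real
    assume st: "0 \<le> s" "0 \<le> t" "\<bar>s - c\<bar> < \<delta>" "\<bar>t - c\<bar> < \<delta>"
    obtain z where z: "min s t \<le> z" "z \<le> max s t"
      "t powr \<beta> - s powr \<beta> = \<beta> * z powr (\<beta> - 1) * (t - s)"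
      using powr_mean_value[OF st(1,2) assms(2)] .
    have "0 \<le> z" "\<bar>z - c\<bar> < \<delta>" using z(1,2) st by (auto simp: min_def max_def split: if_splits)
    then have "\<bar>\<beta> * z powr (\<beta> - 1) - \<beta> * c powr (\<beta> - 1)\<bar> \<le> e" using \<delta>(2) by fastforce
    then have "\<bar>\<beta> * z powr (\<beta> - 1) - \<beta> * c powr (\<beta> - 1)\<bar> * \<bar>t - s\<bar> \<le> e * \<bar>t - s\<bar>"
      by (rule mult_right_mono) simp
    then show "\<bar>t powr \<beta> - s powr \<beta> - \<beta> * c powr (\<beta> - 1) * (t - s)\<bar> \<le> e * \<bar>t - s\<bar>"
      unfolding z(3) by (simp add: left_diff_distrib flip: abs_mult)
  qed
qed

text \<open>This form of the difference of two quotients makes both the Lipschitz bound and the strict derivative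
  visible, since the increments of the powers enter linearly.\<close>

lemma draw_prob_diff:
  assumes "weight \<beta> x \<noteq> 0" "weight \<beta> y \<noteq> 0"
  shows "draw_prob \<beta> x $ i - draw_prob \<beta> y $ i
    = ((x $ i powr \<beta> - y $ i powr \<beta>) - draw_prob \<beta> y $ i * (weight \<beta> x - weight \<beta> y)) / weight \<beta> x"
  using assms by (simp add: draw_prob_nth field_simps)

lemma continuous_on_weight:
  "\<beta> > 0 \<Longrightarrow> continuous_on prob_simplex (weight \<beta>)"
  unfolding weight_def by (intro continuous_on_powr' continuous_intros) (auto simp: simplex_nonneg)

lemma continuous_on_draw_prob:
  assumes "\<beta> > 0"
  shows "continuous_on prob_simplex (draw_prob \<beta> :: real ^ 'a::finite \<Rightarrow> _)"
proof -
  show ?thesis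
    unfolding draw_prob_def
    using assms continuous_on_weight[OF assms] by (intro continuous_on_vec_lambda continuous_on_divide continuous_on_powr' continuous_intros)
      (auto simp: simplex_nonneg dest: weight_pos[of _ \<beta>])
qed

lemma powr_lipschitz:
  fixes s t :: real
  assumes "0 \<le> s" "0 \<le> t" "s \<le> 1" "t \<le> 1" "\<beta> > 1"
  shows "\<bar>t powr \<beta> - s powr \<beta>\<bar> \<le> \<beta> * \<bar>t - s\<bar>"
proof -
  obtain z where z: "min s t \<le> z" "z \<le> max s t"
    "t powr \<beta> - s powr \<beta> = \<beta> * z powr (\<beta> - 1) * (t - s)"
    using powr_mean_value[OF assms(1,2,5)] .
  have "z powr (\<beta> - 1) \<le> 1" "0 \<le> z powr (\<beta> - 1)"
    using z assms by (auto intro!: powr_le1 simp: min_def max_def split: if_splits)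
  then have "\<bar>\<beta> * z powr (\<beta> - 1)\<bar> \<le> \<beta>" using assms by (simp add: mult_left_le abs_mult)
  then show ?thesis unfolding z(3) abs_mult[of _ "t - s"] by (rule mult_right_mono) simp
qed

lemma draw_prob_lipschitz:
  assumes "\<beta> > 1"
  obtains C where "C \<ge> 0" "\<And>x y :: real ^ 'a::finite. x \<in> prob_simplex \<Longrightarrow> y \<in> prob_simplex \<Longrightarrow>
    norm (draw_prob \<beta> x - draw_prob \<beta> y) \<le> C * norm (x - y)"
proof -
  let ?n = "real CARD('a)"
  define w where "w = (1 / ?n) powr \<beta>"
  have w: "w > 0" by (simp add: w_def)
  define C where "C = ?n * ((\<beta> + ?n * \<beta>) / w)"
  show ?thesis
  proof (rule that[of C])
    show "C \<ge> 0" using w assms by (simp add: C_def)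
    fix x y :: "real ^ 'a" assume xy: "x \<in> prob_simplex" "y \<in> prob_simplex"
    have D: "\<bar>x $ i powr \<beta> - y $ i powr \<beta>\<bar> \<le> \<beta> * norm (x - y)" for i
    proof -
      have "\<bar>x $ i powr \<beta> - y $ i powr \<beta>\<bar> \<le> \<beta> * \<bar>x $ i - y $ i\<bar>"
        using xy assms by (intro powr_lipschitz) (auto simp: simplex_nonneg simplex_le_1)
      also have "\<dots> \<le> \<beta> * norm (x - y)"
        using component_le_norm_cart[of "x - y" i] assms by (intro mult_left_mono) auto
      finally show ?thesis .
    qed
    have W: "\<bar>weight \<beta> x - weight \<beta> y\<bar> \<le> ?n * (\<beta> * norm (x - y))"
    proof -
      have "\<bar>weight \<beta> x - weight \<beta> y\<bar> = \<bar>\<Sum>i\<in>UNIV. x $ i powr \<beta> - y $ i powr \<beta>\<bar>"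
        by (simp add: weight_def sum_subtractf)
      also have "\<dots> \<le> (\<Sum>i\<in>UNIV. \<bar>x $ i powr \<beta> - y $ i powr \<beta>\<bar>)" by (rule sum_abs)
      also have "\<dots> \<le> (\<Sum>i\<in>(UNIV::'a set). \<beta> * norm (x - y))" by (rule sum_mono) (rule D)
      finally show ?thesis by simp
    qed
    have wx: "w \<le> weight \<beta> x" "w \<le> weight \<beta> y"
      using weight_lower[of _ \<beta>] xy assms unfolding w_def by auto
    have "\<bar>(draw_prob \<beta> x - draw_prob \<beta> y) $ i\<bar> \<le> (\<beta> + ?n * \<beta>) / w * norm (x - y)" for i
    proof -
      have p: "0 \<le> draw_prob \<beta> y $ i" "draw_prob \<beta> y $ i \<le> 1"
        using draw_prob_simplex[of \<beta> y] wx w by (auto simp: simplex_nonneg simplex_le_1)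
      have "\<bar>draw_prob \<beta> y $ i * (weight \<beta> x - weight \<beta> y)\<bar> \<le> ?n * (\<beta> * norm (x - y))"
        unfolding abs_mult using W p mult_left_le_one_le[of "\<bar>weight \<beta> x - weight \<beta> y\<bar>" "\<bar>draw_prob \<beta> y $ i\<bar>"] by simp
      then have "\<bar>(x $ i powr \<beta> - y $ i powr \<beta>) - draw_prob \<beta> y $ i * (weight \<beta> x - weight \<beta> y)\<bar>
        \<le> (\<beta> + ?n * \<beta>) * norm (x - y)"
        using D[of i] by (simp add: algebra_simps)
      then have "\<bar>draw_prob \<beta> x $ i - draw_prob \<beta> y $ i\<bar> \<le> (\<beta> + ?n * \<beta>) * norm (x - y) / w"
        using wx w assms by (subst draw_prob_diff) (auto simp: abs_divide intro!: frac_le)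
      then show ?thesis by simp
    qed
    from norm_le_of_components[OF this]
    show "norm (draw_prob \<beta> x - draw_prob \<beta> y) \<le> C * norm (x - y)"
      by (simp add: C_def)
  qed
qed

lemma weight_uniform_on:
  assumes "S \<noteq> {}" "\<beta> > 0"
  shows "weight \<beta> (uniform_on S) = (1 / card S) powr (\<beta> - 1)"
proof -
  have s: "real (card S) > 0" using assms by (simp add: card_gt_0_iff)
  have "weight \<beta> (uniform_on S) = (\<Sum>i\<in>UNIV \<inter> S. (1 / real (card S)) powr \<beta>)"
    unfolding weight_def uniform_on_def using assms
    by (intro sum.mono_neutral_cong_right) auto
  also have "\<dots> = (1 / card S) powr (\<beta> - 1)"
    using s by (simp add: powr_diff)
  finally show ?thesis .
qed

lemma draw_prob_uniform_on:
  assumes "S \<noteq> {}" "\<beta> > 0"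
  shows "draw_prob \<beta> (uniform_on S) = uniform_on S"
proof -
  have s: "real (card S) > 0" using assms by (simp add: card_gt_0_iff)
  have "(1 / real (card S)) powr \<beta> / (1 / real (card S)) powr (\<beta> - 1) = 1 / card S"
    using assms(1) s by (simp add: powr_diff)
  then show ?thesis
    using assms by (simp add: vec_eq_iff draw_prob_nth weight_uniform_on) (simp add: uniform_on_def)
qed

text \<open>Two points near the uniform distribution on \<open>S\<close> are compared with each other, not with the
  uniform distribution itself. This is what the small perturbation \<open>r\<close> requires, because it moves the fixed
  points away from the uniform distributions.\<close>

lemma draw_prob_strict_derivative:
  fixes S :: "'a::finite set"
  assumes "S \<noteq> {}" "\<beta> > 1" "\<eta> > 0"
  obtains \<delta> where "\<delta> > 0"
    "\<And>x y. x \<in> prob_simplex \<Longrightarrow> y \<in> prob_simplex \<Longrightarrow>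
       dist x (uniform_on S) < \<delta> \<Longrightarrow> dist y (uniform_on S) < \<delta> \<Longrightarrow>
       norm (draw_prob \<beta> x - draw_prob \<beta> y - spread \<beta> S (x - y)) \<le> \<eta> * norm (x - y)"
proof -
  let ?n = "real CARD('a)"
  let ?u = "uniform_on S :: real ^ 'a"
  let ?s = "real (card S)"
  have s: "?s > 0" using assms by (simp add: card_gt_0_iff)
  define w where "w = (1 / ?n) powr \<beta>"
  have w: "w > 0" by (simp add: w_def)
  define h where "h j = \<beta> * (?u $ j) powr (\<beta> - 1)" for j
  define \<theta> where "\<theta> x y i j = ((if i = j then 1 else 0) - draw_prob \<beta> y $ i) / weight \<beta> x"
    for x y :: "real ^ 'a" and i j
  have u: "?u \<in> prob_simplex" by (rule uniform_on_simplex) fact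
  have h: "0 \<le> h j" "h j \<le> \<beta>" for j
    using u assms by (auto simp: h_def simplex_nonneg simplex_le_1 intro!: mult_left_le powr_le1)
  have \<theta>_bound: "\<bar>\<theta> x y i j\<bar> \<le> 1 / w" if "x \<in> prob_simplex" "y \<in> prob_simplex" for x y i j
  proof -
    have "draw_prob \<beta> y \<in> prob_simplex"
      using that weight_pos[of y \<beta>] assms by (intro draw_prob_simplex) auto
    then have "\<bar>(if i = j then 1 else 0) - draw_prob \<beta> y $ i\<bar> \<le> 1"
      by (auto simp: simplex_nonneg simplex_le_1)
    moreover have "w \<le> weight \<beta> x" using weight_lower[of x \<beta>] that assms by (simp add: w_def)
    ultimately show ?thesis using w by (auto simp: \<theta>_def abs_divide intro!: frac_le)
  qed
  \<comment> \<open>A difference of values of \<^const>\<open>draw_prob\<close> is a linear combination of the increments of the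
    powers, with coefficients \<open>\<theta>\<close> that are continuous in both points. Their limit gives \<^const>\<open>spread\<close>.\<close>
  have spread_eq: "spread \<beta> S d $ i = (\<Sum>j\<in>UNIV. \<theta> ?u ?u i j * (h j * d $ j))" for d i
  proof -
    have wt2: "weight \<beta> ?u = (1 / ?s) powr (\<beta> - 1)" using assms by (simp add: weight_uniform_on)
    have wp: "0 < (1 / ?s) powr (\<beta> - 1)" using assms(1) by simp
    have un: "?u $ j = (if j \<in> S then 1 / ?s else 0)" for j by (simp add: uniform_on_def)
    have hj: "h j = (if j \<in> S then \<beta> * weight \<beta> ?u else 0)" for j
      unfolding wt2 h_def un using assms(2) by simp
    have pj: "draw_prob \<beta> ?u $ i = (if i \<in> S then 1 / ?s else 0)"
      using assms by (simp add: draw_prob_uniform_on un)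
    have hj2: "h j / weight \<beta> ?u = (if j \<in> S then \<beta> else 0)" for j
      using hj[of j] wt2 wp by simp
    have "(\<Sum>j\<in>UNIV. \<theta> ?u ?u i j * (h j * d $ j))
       = (\<Sum>j\<in>UNIV. (if i = j then (h j / weight \<beta> ?u) * d $ j else 0)
                 - draw_prob \<beta> ?u $ i * ((h j / weight \<beta> ?u) * d $ j))"
      unfolding \<theta>_def by (intro sum.cong) (auto simp: diff_divide_distrib algebra_simps)
    also have "\<dots> = (h i / weight \<beta> ?u) * d $ i
        - draw_prob \<beta> ?u $ i * (\<Sum>j\<in>UNIV. (h j / weight \<beta> ?u) * d $ j)"
      by (simp add: sum_subtractf sum_distrib_left)
    also have "(\<Sum>j\<in>UNIV. (h j / weight \<beta> ?u) * d $ j) = \<beta> * (\<Sum>j\<in>S. d $ j)"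
      unfolding hj2 by (simp add: if_distrib[of "\<lambda>t. t * _"] sum.If_cases sum_distrib_left)
    finally have eq: "(\<Sum>j\<in>UNIV. \<theta> ?u ?u i j * (h j * d $ j))
      = (if i \<in> S then \<beta> else 0) * d $ i - (if i \<in> S then 1 / ?s else 0) * (\<beta> * (\<Sum>j\<in>S. d $ j))"
      unfolding hj2 pj .
    show ?thesis
      unfolding eq by (simp add: spread_def right_diff_distrib)
  qed
  define e where "e = min 1 (\<eta> / (?n * (?n * (1 / w + \<beta>))))"
  have A: "?n * (1 / w + \<beta>) > 0" using w assms by (simp add: add_pos_pos)
  have e: "e > 0" "?n * (?n * ((1 / w + \<beta>) * e)) \<le> \<eta>"
  proof -
    have n: "?n * (?n * (1 / w + \<beta>)) > 0" using A by simp
    show "e > 0" using n assms by (simp add: e_def)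
    have "e \<le> \<eta> / (?n * (?n * (1 / w + \<beta>)))" by (simp add: e_def)
    then show "?n * (?n * ((1 / w + \<beta>) * e)) \<le> \<eta>"
      using n by (simp add: pos_le_divide_eq algebra_simps)
  qed
  have "\<forall>j. \<exists>d. d > 0 \<and> (\<forall>s t. 0 \<le> s \<longrightarrow> 0 \<le> t \<longrightarrow> \<bar>s - ?u $ j\<bar> < d \<longrightarrow> \<bar>t - ?u $ j\<bar> < d \<longrightarrow>
       \<bar>t powr \<beta> - s powr \<beta> - h j * (t - s)\<bar> \<le> e * \<bar>t - s\<bar>)"
  proof
    fix j
    obtain d where "d > 0" "\<And>s t. 0 \<le> s \<Longrightarrow> 0 \<le> t \<Longrightarrow> \<bar>s - ?u $ j\<bar> < d \<Longrightarrow> \<bar>t - ?u $ j\<bar> < d \<Longrightarrow>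
       \<bar>t powr \<beta> - s powr \<beta> - \<beta> * (?u $ j) powr (\<beta> - 1) * (t - s)\<bar> \<le> e * \<bar>t - s\<bar>"
      using powr_strict_derivative[OF simplex_nonneg[OF u, of j] assms(2) e(1)] by blast
    then show "\<exists>d. d > 0 \<and> (\<forall>s t. 0 \<le> s \<longrightarrow> 0 \<le> t \<longrightarrow> \<bar>s - ?u $ j\<bar> < d \<longrightarrow> \<bar>t - ?u $ j\<bar> < d \<longrightarrow>
       \<bar>t powr \<beta> - s powr \<beta> - h j * (t - s)\<bar> \<le> e * \<bar>t - s\<bar>)"
      unfolding h_def by (intro exI[of _ d]) simp
  qed
  from choice[OF this] obtain d1 where "\<forall>j. d1 j > 0 \<and> (\<forall>s t. 0 \<le> s \<longrightarrow> 0 \<le> t \<longrightarrow> \<bar>s - ?u $ j\<bar> < d1 j \<longrightarrow> \<bar>t - ?u $ j\<bar> < d1 j \<longrightarrow>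
       \<bar>t powr \<beta> - s powr \<beta> - h j * (t - s)\<bar> \<le> e * \<bar>t - s\<bar>)" ..
  then have d1: "\<And>j. d1 j > 0"
    "\<And>j s t. 0 \<le> s \<Longrightarrow> 0 \<le> t \<Longrightarrow> \<bar>s - ?u $ j\<bar> < d1 j \<Longrightarrow> \<bar>t - ?u $ j\<bar> < d1 j \<Longrightarrow>
       \<bar>t powr \<beta> - s powr \<beta> - h j * (t - s)\<bar> \<le> e * \<bar>t - s\<bar>"
    by auto
  have cont: "continuous_on (prob_simplex \<times> prob_simplex) (\<lambda>(x, y). \<theta> x y i j)" for i j
  proof -
    have W: "continuous_on prob_simplex (weight \<beta> :: real ^ 'a \<Rightarrow> real)"
      using assms by (intro continuous_on_weight) simp
    have P: "continuous_on prob_simplex (\<lambda>x :: real ^ 'a. draw_prob \<beta> x $ i)"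
      using assms by (intro continuous_on_component continuous_on_draw_prob) simp
    have W1: "continuous_on (prob_simplex \<times> prob_simplex) (\<lambda>z :: (real^'a) \<times> (real^'a). weight \<beta> (fst z))"
      by (rule continuous_on_compose2[OF W]) (auto intro!: continuous_intros)
    have P1: "continuous_on (prob_simplex \<times> prob_simplex) (\<lambda>z :: (real^'a) \<times> (real^'a). draw_prob \<beta> (snd z) $ i)"
      by (rule continuous_on_compose2[OF P]) (auto intro!: continuous_intros)
    have "continuous_on (prob_simplex \<times> prob_simplex)
       (\<lambda>z :: (real^'a) \<times> (real^'a). ((if i = j then 1 else 0) - draw_prob \<beta> (snd z) $ i) / weight \<beta> (fst z))"
      using assms by (intro continuous_on_divide continuous_on_diff continuous_on_const W1 P1)
        (auto dest: weight_pos[of _ \<beta>])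
    then show ?thesis by (simp add: \<theta>_def case_prod_beta')
  qed
  have ex: "\<exists>d>0. \<forall>x\<in>prob_simplex. \<forall>y\<in>prob_simplex. dist (x, y) (?u, ?u) < d \<longrightarrow> \<bar>\<theta> x y i j - \<theta> ?u ?u i j\<bar> < e" for i j
  proof -
    have "(?u, ?u) \<in> prob_simplex \<times> prob_simplex" using u by simp
    with cont[of i j] e(1) obtain d where "d > 0"
      "\<forall>z\<in>prob_simplex \<times> prob_simplex. dist z (?u, ?u) < d \<longrightarrow>
         dist (case z of (x, y) \<Rightarrow> \<theta> x y i j) (case (?u, ?u) of (x, y) \<Rightarrow> \<theta> x y i j) < e"
      unfolding continuous_on_iff by blast
    then show ?thesis by (intro exI[of _ d]) (auto simp: dist_real_def)
  qed
  define d2 where "d2 i j = (SOME d. d > 0 \<and> (\<forall>x\<in>prob_simplex. \<forall>y\<in>prob_simplex. dist (x, y) (?u, ?u) < d \<longrightarrow> \<bar>\<theta> x y i j - \<theta> ?u ?u i j\<bar> < e))" for i j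
  have "d2 i j > 0 \<and> (\<forall>x\<in>prob_simplex. \<forall>y\<in>prob_simplex. dist (x, y) (?u, ?u) < d2 i j \<longrightarrow> \<bar>\<theta> x y i j - \<theta> ?u ?u i j\<bar> < e)" for i j
    unfolding d2_def by (rule someI_ex[OF ex])
  then have d2: "\<And>i j. d2 i j > 0"
    "\<And>i j x y. x \<in> prob_simplex \<Longrightarrow> y \<in> prob_simplex \<Longrightarrow> dist (x, y) (?u, ?u) < d2 i j \<Longrightarrow> \<bar>\<theta> x y i j - \<theta> ?u ?u i j\<bar> < e"
    by auto
  define D1 where "D1 = Min (range d1)"
  define D2 where "D2 = Min (range (\<lambda>(i, j). d2 i j))"
  have D1: "D1 > 0" "\<And>j. D1 \<le> d1 j" using d1(1) by (auto simp: D1_def)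
  have D2: "D2 > 0" "\<And>i j. D2 \<le> d2 i j"
    using d2(1) by (auto simp: D2_def intro!: Min_le)
  define \<delta> where "\<delta> = min D1 (D2 / 2)"
  show ?thesis
  proof (rule that[of \<delta>])
    show "\<delta> > 0" using D1 D2 by (simp add: \<delta>_def)
    fix x y :: "real ^ 'a"
    assume x: "x \<in> prob_simplex" and y: "y \<in> prob_simplex"
      and dx: "dist x ?u < \<delta>" and dy: "dist y ?u < \<delta>"
    have comp: "\<bar>v $ j - ?u $ j\<bar> < d1 j" if "dist v ?u < \<delta>" for v j
    proof -
      have "\<bar>v $ j - ?u $ j\<bar> \<le> dist v ?u"
        using component_le_norm_cart[of "v - ?u" j] by (simp add: dist_norm)
      also have "\<dots> < d1 j" using that D1(2)[of j] by (simp add: \<delta>_def)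
      finally show ?thesis .
    qed
    have pair: "dist (x, y) (?u, ?u) < d2 i j" for i j
    proof -
      have "dist (x, y) (?u, ?u) \<le> dist x ?u + dist y ?u"
        unfolding dist_Pair_Pair by (rule sqrt_sum_squares_le_sum) auto
      also have "\<dots> < d2 i j" using dx dy D2(2)[of i j] by (simp add: \<delta>_def)
      finally show ?thesis .
    qed
    let ?N = "norm (x - y)"
    have c: "\<bar>x $ j - y $ j\<bar> \<le> ?N" for j using component_le_norm_cart[of "x - y" j] by simp
    define a where "a j = x $ j powr \<beta> - y $ j powr \<beta>" for j
    have a: "\<bar>a j - h j * (x $ j - y $ j)\<bar> \<le> e * ?N" for j
    proof -
      have "\<bar>a j - h j * (x $ j - y $ j)\<bar> \<le> e * \<bar>x $ j - y $ j\<bar>"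
        unfolding a_def using x y comp[OF dx] comp[OF dy] by (intro d1(2)) (auto simp: simplex_nonneg)
      also have "\<dots> \<le> e * ?N" using c e by (intro mult_left_mono) auto
      finally show ?thesis .
    qed
    have "\<bar>(draw_prob \<beta> x - draw_prob \<beta> y - spread \<beta> S (x - y)) $ i\<bar> \<le> (?n * ((1 / w + \<beta>) * e)) * ?N" for i
    proof -
      have wx: "weight \<beta> x \<noteq> 0" "weight \<beta> y \<noteq> 0"
        using weight_pos[OF x, of \<beta>] weight_pos[OF y, of \<beta>] assms by auto
      have diff: "draw_prob \<beta> x $ i - draw_prob \<beta> y $ i = (\<Sum>j\<in>UNIV. \<theta> x y i j * a j)"
      proof -
        have "(\<Sum>j\<in>UNIV. \<theta> x y i j * a j)
           = (\<Sum>j\<in>UNIV. (if i = j then a j / weight \<beta> x else 0) - draw_prob \<beta> y $ i * a j / weight \<beta> x)"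
          unfolding \<theta>_def by (intro sum.cong) (auto simp: diff_divide_distrib algebra_simps)
        also have "\<dots> = a i / weight \<beta> x - draw_prob \<beta> y $ i * (\<Sum>j\<in>UNIV. a j) / weight \<beta> x"
          by (simp add: sum_subtractf sum_distrib_left sum_divide_distrib)
        also have "(\<Sum>j\<in>UNIV. a j) = weight \<beta> x - weight \<beta> y"
          by (simp add: a_def weight_def sum_subtractf)
        finally show ?thesis
          by (subst draw_prob_diff[OF wx]) (simp add: a_def diff_divide_distrib)
      qed
      have "(draw_prob \<beta> x - draw_prob \<beta> y - spread \<beta> S (x - y)) $ i
         = (\<Sum>j\<in>UNIV. \<theta> x y i j * a j) - (\<Sum>j\<in>UNIV. \<theta> ?u ?u i j * (h j * (x $ j - y $ j)))"
        by (simp only: vector_minus_component diff spread_eq)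
      also have "\<dots> = (\<Sum>j\<in>UNIV. \<theta> x y i j * (a j - h j * (x $ j - y $ j)) + (\<theta> x y i j - \<theta> ?u ?u i j) * (h j * (x $ j - y $ j)))"
        unfolding sum_subtractf[symmetric] by (intro sum.cong refl) (simp add: algebra_simps)
      also have "\<bar>\<dots>\<bar> \<le> (\<Sum>j\<in>(UNIV::'a set). (1 / w) * (e * ?N) + e * (\<beta> * ?N))"
      proof (rule order_trans[OF sum_abs sum_mono])
        fix j
        have 1: "\<bar>\<theta> x y i j * (a j - h j * (x $ j - y $ j))\<bar> \<le> (1 / w) * (e * ?N)"
          unfolding abs_mult using \<theta>_bound[OF x y] a[of j] w by (intro mult_mono) auto
        have "\<bar>h j * (x $ j - y $ j)\<bar> \<le> \<beta> * ?N"
          unfolding abs_mult using h[of j] c[of j] assms by (intro mult_mono) auto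
        then have 2: "\<bar>(\<theta> x y i j - \<theta> ?u ?u i j) * (h j * (x $ j - y $ j))\<bar> \<le> e * (\<beta> * ?N)"
          unfolding abs_mult[of "\<theta> x y i j - _"] using d2(2)[OF x y pair[of i j]] e
          by (intro mult_mono) auto
        show "\<bar>\<theta> x y i j * (a j - h j * (x $ j - y $ j)) + (\<theta> x y i j - \<theta> ?u ?u i j) * (h j * (x $ j - y $ j))\<bar>
          \<le> (1 / w) * (e * ?N) + e * (\<beta> * ?N)"
          using 1 2 by linarith
      qed
      also have "\<dots> = (?n * ((1 / w + \<beta>) * e)) * ?N" by (simp add: algebra_simps)
      finally show ?thesis .
    qed
    from norm_le_of_components[OF this]
    have "norm (draw_prob \<beta> x - draw_prob \<beta> y - spread \<beta> S (x - y)) \<le> (?n * (?n * ((1 / w + \<beta>) * e))) * ?N"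
      by (simp add: mult.assoc)
    also have "\<dots> \<le> \<eta> * ?N" using e by (intro mult_right_mono) auto
    finally show "norm (draw_prob \<beta> x - draw_prob \<beta> y - spread \<beta> S (x - y)) \<le> \<eta> * ?N" .
  qed
qed

text \<open>If \<open>p x = x\<close>, then \<open>x\<^sub>i powr (\<beta> - 1)\<close> has the same value for all \<open>i\<close> with positive share.\<close>

lemma fixed_point_draw_prob:
  assumes x: "x \<in> prob_simplex" and \<beta>: "\<beta> > 1" and fp: "draw_prob \<beta> x = x"
  shows "\<exists>S. S \<noteq> {} \<and> x = uniform_on S"
proof -
  define S where "S = {i. 0 < x $ i}"
  define c where "c = weight \<beta> x powr (1 / (\<beta> - 1))"
  have w: "0 < weight \<beta> x" using weight_pos[OF x] \<beta> by simp
  have xc: "x $ i = (if i \<in> S then c else 0)" for i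
  proof (cases "i \<in> S")
    case True
    then have p: "0 < x $ i" by (simp add: S_def)
    have "x $ i powr \<beta> / weight \<beta> x = x $ i" using fp by (metis draw_prob_nth)
    then have "x $ i powr (\<beta> - 1) = weight \<beta> x" using p w by (simp add: powr_diff field_simps)
    then have "c = (x $ i powr (\<beta> - 1)) powr (1 / (\<beta> - 1))" by (simp add: c_def)
    also have "\<dots> = x $ i" using p \<beta> by (simp add: powr_powr)
    finally show ?thesis using True by simp
  next
    case False
    then show ?thesis using simplex_nonneg[OF x, of i] by (simp add: S_def)
  qed
  have "1 = (\<Sum>i\<in>UNIV. if i \<in> S then c else 0)"
    using simplex_sum[OF x] xc by simp
  also have "\<dots> = card S * c" by (simp add: sum.If_cases)
  finally have e: "card S * c = 1" by simp
  then have "S \<noteq> {}" by auto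
  moreover have "c = 1 / card S" using e by (metis mult_zero_left nonzero_eq_divide_eq zero_neq_one mult.commute)
  ultimately show ?thesis using xc by (auto simp: vec_eq_iff uniform_on_def)
qed

lemma compact_prob_simplex: "compact (prob_simplex :: (real ^ 'a::finite) set)"
proof -
  have "prob_simplex = {x :: real ^ 'a. \<forall>i. 0 \<le> x $ i} \<inter> {x. \<forall>i. x $ i \<le> 1} \<inter> {x. (\<Sum>i\<in>UNIV. x $ i) = 1}"
    by (auto simp: prob_simplex_def)
  also have "closed \<dots>"
    by (intro closed_Int closed_Collect_all closed_Collect_le closed_Collect_eq continuous_intros)
  finally have "closed (prob_simplex :: (real ^ 'a) set)" .
  moreover have "bounded (prob_simplex :: (real ^ 'a) set)"
    unfolding bounded_iff using norm_simplex_le_1 by blast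
  ultimately show ?thesis by (simp add: compact_eq_bounded_closed)
qed

text \<open>The continuous function \<open>\<bar>p x - x\<bar>\<close> is positive on the compact set of points that are not
  \<open>\<delta>\<close>-close to a uniform distribution.\<close>

lemma almost_fixed_points_cluster:
  fixes \<beta> \<delta> :: real
  assumes \<beta>: "\<beta> > 1" and \<delta>: "\<delta> > 0"
  obtains \<eta> where "\<eta> > 0" "\<And>x :: real ^ 'a::finite. x \<in> prob_simplex \<Longrightarrow>
    norm (draw_prob \<beta> x - x) < \<eta> \<Longrightarrow> \<exists>S. S \<noteq> {} \<and> dist x (uniform_on S) < \<delta>"
proof -
  define K where "K = prob_simplex - (\<Union>S\<in>{S. S \<noteq> {}}. ball (uniform_on S :: real ^ 'a) \<delta>)"
  have K: "compact K" unfolding K_def by (intro compact_diff compact_prob_simplex) auto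
  have inK: "x \<in> K" if "x \<in> prob_simplex" "\<And>S. S \<noteq> {} \<Longrightarrow> \<not> dist x (uniform_on S) < \<delta>" for x :: "real ^ 'a"
    using that by (auto simp: K_def dist_commute)
  show ?thesis
  proof (cases "K = {}")
    case True
    show ?thesis
    proof (rule that[of 1])
      fix x :: "real ^ 'a" assume "x \<in> prob_simplex"
      then show "\<exists>S. S \<noteq> {} \<and> dist x (uniform_on S) < \<delta>" using True inK by blast
    qed simp
  next
    case False
    have c: "continuous_on K (\<lambda>x. norm (draw_prob \<beta> x - x))"
      using \<beta> by (intro continuous_intros continuous_on_subset[OF continuous_on_draw_prob]) (auto simp: K_def)
    obtain z where z: "z \<in> K" "\<And>x. x \<in> K \<Longrightarrow> norm (draw_prob \<beta> z - z) \<le> norm (draw_prob \<beta> x - x)"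
      using continuous_attains_inf[OF K False c] by blast
    have zs: "z \<in> prob_simplex" and zf: "\<And>S. S \<noteq> {} \<Longrightarrow> z \<noteq> uniform_on S"
      using z(1) \<delta> by (auto simp: K_def)
    have "draw_prob \<beta> z \<noteq> z" using fixed_point_draw_prob[OF zs \<beta>] zf by blast
    then have "0 < norm (draw_prob \<beta> z - z)" by simp
    then show ?thesis
    proof (rule that)
      fix x :: "real ^ 'a" assume x: "x \<in> prob_simplex" "norm (draw_prob \<beta> x - x) < norm (draw_prob \<beta> z - z)"
      then have "x \<notin> K" using z(2) by force
      then show "\<exists>S. S \<noteq> {} \<and> dist x (uniform_on S) < \<delta>" using inK[OF x(1)] by blast
    qed
  qed
qed

section \<open>An indefinite form that the drift increases\<close>

text \<open>The symmetric operator that belongs to the indefinite form \<open>V d = inner d (reflect S d)\<close>: on \<open>S\<close>, the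
  projection along the constants; outside \<open>S\<close>, minus the identity. The repelling directions of the mean field at the
  uniform distribution on \<open>S\<close> are the ones in which \<open>V\<close> is positive, and the attracting ones those in which
  it is negative.\<close>

definition reflect :: "'a set \<Rightarrow> real ^ 'a::finite \<Rightarrow> real ^ 'a" where
  "reflect S d = (\<chi> i. if i \<in> S then d $ i - (\<Sum>j\<in>S. d $ j) / card S else - d $ i)"

lemma reflect_add: "reflect S (x + y) = reflect S x + reflect S y"
  by (simp add: reflect_def vec_eq_iff sum.distrib add_divide_distrib)

lemma reflect_scale: "reflect S (c *\<^sub>R x) = c *\<^sub>R reflect S x"
  by (simp add: reflect_def vec_eq_iff algebra_simps flip: sum_distrib_left)

lemma reflect_diff: "reflect S (x - y) = reflect S x - reflect S y"
  by (simp add: reflect_def vec_eq_iff sum_subtractf diff_divide_distrib)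

lemma sum_split_set:
  fixes S :: "'a::finite set" and f :: "'a \<Rightarrow> real"
  shows "(\<Sum>i\<in>UNIV. f i) = (\<Sum>i\<in>S. f i) + (\<Sum>i\<in>-S. f i)"
  using sum.union_disjoint[of S "-S" f] by simp

lemma inner_reflect:
  "inner x (reflect S y) = (\<Sum>i\<in>S. x $ i * y $ i) - (\<Sum>i\<in>S. x $ i) * (\<Sum>i\<in>S. y $ i) / card S - (\<Sum>i\<in>-S. x $ i * y $ i)"
proof -
  have 1: "(\<Sum>i\<in>S. x $ i * reflect S y $ i)
      = (\<Sum>i\<in>S. x $ i * y $ i - x $ i * ((\<Sum>j\<in>S. y $ j) / card S))"
    by (intro sum.cong) (auto simp: reflect_def right_diff_distrib)
  have 2: "(\<Sum>i\<in>-S. x $ i * reflect S y $ i) = (\<Sum>i\<in>-S. - (x $ i * y $ i))"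
    by (intro sum.cong) (auto simp: reflect_def)
  show ?thesis
    unfolding inner_vec_def inner_real_def sum_split_set[of _ S] 1 2
    by (simp add: sum_subtractf sum_negf flip: sum_distrib_right sum_divide_distrib)
qed

lemma reflect_self_adjoint: "inner x (reflect S y) = inner y (reflect S x)"
  unfolding inner_reflect by (simp add: mult.commute)

lemma norm_reflect_le:
  fixes x :: "real ^ 'a::finite"
  shows "norm (reflect S x) \<le> norm x"
proof -
  let ?a = "(\<Sum>j\<in>S. x $ j) / card S"
  have "(\<Sum>i\<in>S. (x $ i - ?a)\<^sup>2) \<le> (\<Sum>i\<in>S. (x $ i)\<^sup>2)"
  proof -
    have "(\<Sum>i\<in>S. (x $ i - ?a)\<^sup>2) = (\<Sum>i\<in>S. (x $ i)\<^sup>2 + ?a\<^sup>2 - 2 * ?a * x $ i)"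
      by (intro sum.cong) (auto simp: power2_eq_square algebra_simps)
    also have "\<dots> = (\<Sum>i\<in>S. (x $ i)\<^sup>2) + card S * ?a\<^sup>2 - 2 * ?a * (\<Sum>i\<in>S. x $ i)"
      by (simp add: sum.distrib sum_subtractf flip: sum_distrib_left sum_divide_distrib)
    also have "\<dots> = (\<Sum>i\<in>S. (x $ i)\<^sup>2) - card S * ?a\<^sup>2"
    proof (cases "card S = 0")
      case True
      then show ?thesis by simp
    next
      case False
      then have "(\<Sum>i\<in>S. x $ i) = card S * ?a" by simp
      then have "2 * ?a * (\<Sum>i\<in>S. x $ i) = 2 * (card S * ?a\<^sup>2)"
        by (simp only: power2_eq_square) algebra
      then show ?thesis by simp
    qed
    finally show ?thesis by simp
  qed
  then have "(norm (reflect S x))\<^sup>2 \<le> (norm x)\<^sup>2"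
    unfolding power2_norm_eq_inner inner_vec_def inner_real_def sum_split_set[of _ S]
    by (simp add: reflect_def power2_eq_square)
  then show ?thesis by (rule power2_le_imp_le) simp
qed

lemma abs_inner_reflect_le: "\<bar>inner x (reflect S y)\<bar> \<le> norm x * norm y"
  using Cauchy_Schwarz_ineq2[of x "reflect S y"] norm_reflect_le[of S y]
  by (meson mult_left_mono norm_ge_zero order_trans)

lemma reflect_quadratic:
  "inner (x + y) (reflect S (x + y)) = inner x (reflect S x) + 2 * inner x (reflect S y) + inner y (reflect S y)"
  using reflect_self_adjoint[of y S x] by (simp add: reflect_add inner_add_left inner_add_right)

lemma reflect_quadratic_diff:
  "inner x (reflect S x) - inner y (reflect S y) = inner (x - y) (reflect S (x + y))"
  using reflect_self_adjoint[of x S y] by (simp add: reflect_add inner_diff_left inner_add_right)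

definition fluctuation :: "'a set \<Rightarrow> real ^ 'a::finite \<Rightarrow> real" where
  "fluctuation S d = (\<Sum>i\<in>S. (d $ i - (\<Sum>j\<in>S. d $ j) / card S)\<^sup>2)"

definition leakage :: "'a set \<Rightarrow> real ^ 'a::finite \<Rightarrow> real" where
  "leakage S d = (\<Sum>i\<in>-S. (d $ i)\<^sup>2)"

lemma fluctuation_nonneg: "0 \<le> fluctuation S d"
  by (simp add: fluctuation_def sum_nonneg)

lemma leakage_nonneg: "0 \<le> leakage S d"
  by (simp add: leakage_def sum_nonneg)

lemma fluctuation_eq:
  fixes S :: "'a::finite set"
  assumes "S \<noteq> {}"
  shows "fluctuation S d = (\<Sum>i\<in>S. (d $ i)\<^sup>2) - (\<Sum>i\<in>S. d $ i)\<^sup>2 / card S"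
proof -
  have s: "real (card S) > 0" using assms by (simp add: card_gt_0_iff)
  let ?t = "\<Sum>j\<in>S. d $ j"
  have "fluctuation S d = (\<Sum>i\<in>S. (d $ i)\<^sup>2 + (?t / card S)\<^sup>2 - 2 * (?t / card S) * d $ i)"
    unfolding fluctuation_def by (intro sum.cong) (auto simp: power2_eq_square algebra_simps)
  also have "\<dots> = (\<Sum>i\<in>S. (d $ i)\<^sup>2) + card S * (?t / card S)\<^sup>2 - 2 * (?t / card S) * ?t"
    by (simp add: sum.distrib sum_subtractf flip: sum_distrib_left sum_divide_distrib)
  also have "\<dots> = (\<Sum>i\<in>S. (d $ i)\<^sup>2) - ?t\<^sup>2 / card S"
    using s assms by (simp add: power2_eq_square)
  finally show ?thesis .
qed

lemma inner_reflect_self: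
  assumes "S \<noteq> {}"
  shows "inner d (reflect S d) = fluctuation S d - leakage S d"
  unfolding inner_reflect fluctuation_eq[OF assms] leakage_def by (simp add: power2_eq_square)

lemma inner_reflect_spread:
  assumes "S \<noteq> {}"
  shows "inner d (reflect S (spread \<beta> S d)) = \<beta> * fluctuation S d"
proof -
  have s: "real (card S) > 0" using assms by (simp add: card_gt_0_iff)
  let ?t = "\<Sum>j\<in>S. d $ j"
  have 0: "(\<Sum>i\<in>S. spread \<beta> S d $ i) = 0"
    using s by (simp add: spread_def sum_subtractf flip: sum_distrib_left)
  have 1: "(\<Sum>i\<in>S. d $ i * spread \<beta> S d $ i) = (\<Sum>i\<in>S. \<beta> * (d $ i)\<^sup>2 - \<beta> * (?t / card S) * d $ i)"
    by (intro sum.cong) (auto simp: spread_def power2_eq_square algebra_simps)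
  have 2: "(\<Sum>i\<in>-S. d $ i * spread \<beta> S d $ i) = 0"
    by (intro sum.neutral) (auto simp: spread_def)
  show ?thesis
    unfolding inner_reflect 0 1 2 fluctuation_eq[OF assms]
    by (simp add: sum_subtractf power2_eq_square right_diff_distrib flip: sum_distrib_left sum_divide_distrib)
qed

text \<open>The component that \<^const>\<open>fluctuation\<close> and \<^const>\<open>leakage\<close> do not see, the mean of
  \<open>d\<close> over \<open>S\<close>, is determined by the coordinates outside \<open>S\<close> when the total is 0.\<close>

lemma norm_le_fluctuation_leakage:
  fixes d :: "real ^ 'a::finite"
  assumes S: "S \<noteq> {}" and d: "(\<Sum>i\<in>UNIV. d $ i) = 0"
  shows "(norm d)\<^sup>2 \<le> (CARD('a) + 1) * (fluctuation S d + leakage S d)"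
proof -
  have s: "1 \<le> real (card S)" using S by (simp add: Suc_le_eq card_gt_0_iff)
  let ?t = "\<Sum>j\<in>S. d $ j"
  have "?t = - (\<Sum>i\<in>-S. d $ i)" using d sum_split_set[of "\<lambda>i. d $ i" S] by simp
  then have "?t\<^sup>2 = (\<Sum>i\<in>-S. 1 * d $ i)\<^sup>2" by simp
  also have "\<dots> \<le> (\<Sum>i\<in>-S. 1\<^sup>2) * (\<Sum>i\<in>-S. (d $ i)\<^sup>2)" by (rule Cauchy_Schwarz_ineq_sum)
  also have "\<dots> \<le> CARD('a) * leakage S d"
    unfolding leakage_def using card_mono[of UNIV "-S"] by (intro mult_right_mono) (auto intro: sum_nonneg)
  finally have t: "?t\<^sup>2 \<le> CARD('a) * leakage S d" .
  have "?t\<^sup>2 / card S \<le> ?t\<^sup>2 / 1" using s by (intro divide_left_mono) auto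
  then have "?t\<^sup>2 / card S \<le> CARD('a) * leakage S d" using t by simp
  moreover have "(norm d)\<^sup>2 = fluctuation S d + ?t\<^sup>2 / card S + leakage S d"
    unfolding power2_norm_eq_inner inner_vec_def inner_real_def sum_split_set[of _ S] fluctuation_eq[OF S] leakage_def
    by (simp add: power2_eq_square)
  moreover have "0 \<le> real CARD('a) * fluctuation S d" using fluctuation_nonneg[of S d] by simp
  ultimately show ?thesis by (simp add: algebra_simps)
qed

text \<open>In the linearisation the drift of \<open>V\<close> is \<open>2 ((1 - r) \<beta> - 1)\<close> times the fluctuation plus twice the
  leakage, both with positive coefficients. In the second bound the summand \<open>V\<close>, which is negative when the leakage
  dominates, comes from the growth of \<open>m\<close> in \<open>m V\<close>; it is absorbed because the leakage enters the drift with
  coefficient 2.\<close>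

lemma reflected_drift_bounds:
  fixes x q \<gamma> :: "real ^ 'a::finite"
  assumes S: "S \<noteq> {}" and \<beta>: "\<beta> > 1" and r: "0 \<le> r" "r \<le> (\<beta> - 1) / (2 * \<beta>)"
    and x: "x \<in> prob_simplex" and q: "q \<in> prob_simplex" and fp: "mean_increment \<beta> r \<gamma> q = q"
    and e: "norm (draw_prob \<beta> x - draw_prob \<beta> q - spread \<beta> S (x - q))
      \<le> min ((\<beta> - 1) / 2) 1 / (4 * real (CARD('a) + 1)) * norm (x - q)"
  shows "min ((\<beta> - 1) / 2) 1 / (2 * real (CARD('a) + 1)) * (norm (x - q))\<^sup>2
      \<le> 2 * inner (x - q) (reflect S (mean_increment \<beta> r \<gamma> x - x))"
    and "min ((\<beta> - 1) / 2) 1 / (2 * real (CARD('a) + 1)) * (norm (x - q))\<^sup>2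
      \<le> inner (x - q) (reflect S (x - q)) + 2 * inner (x - q) (reflect S (mean_increment \<beta> r \<gamma> x - x))"
proof -
  let ?n = "real (CARD('a) + 1)"
  define \<mu> where "\<mu> = min ((\<beta> - 1) / 2) 1"
  define d where "d = x - q"
  define b where "b = fluctuation S d"
  define c where "c = leakage S d"
  define err where "err = draw_prob \<beta> x - draw_prob \<beta> q - spread \<beta> S d"
  define D where "D = (norm d)\<^sup>2"
  have "\<mu> \<le> (\<beta> - 1) / 2" unfolding \<mu>_def by (rule min.cobounded1)
  then have \<mu>: "0 < \<mu>" "\<mu> \<le> 1" "\<mu> \<le> (\<beta> - 1) / 2" using \<beta> by (auto simp: \<mu>_def)
  have bc: "0 \<le> b" "0 \<le> c" by (auto simp: b_def c_def fluctuation_nonneg leakage_nonneg)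
  have r1: "r \<le> 1"
  proof -
    have "(\<beta> - 1) / (2 * \<beta>) \<le> 1" using \<beta> by (simp add: divide_le_eq)
    then show ?thesis using r(2) by linarith
  qed
  have rb: "(\<beta> - 1) / 2 \<le> (1 - r) * \<beta> - 1" using r(2) \<beta> by (simp add: field_simps)
  have "(\<Sum>i\<in>UNIV. d $ i) = 0" using x q by (simp add: d_def sum_subtractf simplex_sum)
  from norm_le_fluctuation_leakage[OF S this] have D: "D \<le> ?n * (b + c)" by (simp add: D_def b_def c_def)
  have eq: "mean_increment \<beta> r \<gamma> x - x = (1 - r) *\<^sub>R (spread \<beta> S d + err) - d"
  proof -
    have "mean_increment \<beta> r \<gamma> x - x = mean_increment \<beta> r \<gamma> x - mean_increment \<beta> r \<gamma> q - d"
      using fp by (simp add: d_def)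
    also have "\<dots> = (1 - r) *\<^sub>R (draw_prob \<beta> x - draw_prob \<beta> q) - d"
      by (simp add: mean_increment_def scaleR_diff_right)
    finally show ?thesis by (simp add: err_def)
  qed
  have "\<bar>inner d (reflect S err)\<bar> \<le> norm d * norm err" by (rule abs_inner_reflect_le)
  also have "\<dots> \<le> norm d * (\<mu> / (4 * ?n) * norm d)"
    using e by (intro mult_left_mono) (auto simp: err_def d_def \<mu>_def)
  finally have E: "\<bar>inner d (reflect S err)\<bar> \<le> \<mu> / (4 * ?n) * D" by (simp add: D_def power2_eq_square mult.left_commute)
  have E': "(1 - r) * inner d (reflect S err) \<ge> - (\<mu> / (4 * ?n) * D)"
  proof -
    have "\<bar>(1 - r) * inner d (reflect S err)\<bar> \<le> 1 * \<bar>inner d (reflect S err)\<bar>"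
      unfolding abs_mult using r r1 by (intro mult_right_mono) auto
    then show ?thesis using E by linarith
  qed
  have I: "inner d (reflect S (mean_increment \<beta> r \<gamma> x - x))
     = (1 - r) * \<beta> * b + (1 - r) * inner d (reflect S err) - (b - c)"
    unfolding eq reflect_diff reflect_scale reflect_add inner_diff_right inner_scaleR_right inner_add_right
      inner_reflect_spread[OF S] inner_reflect_self[OF S]
    by (simp add: b_def c_def algebra_simps)
  have "\<mu> * b \<le> ((1 - r) * \<beta> - 1) * b" using \<mu> rb bc by (intro mult_right_mono) auto
  moreover have "\<mu> * c \<le> c" using \<mu> bc by (simp add: mult_left_le_one_le)
  ultimately have I2: "\<mu> * (b + c) - \<mu> / (4 * ?n) * D \<le> inner d (reflect S (mean_increment \<beta> r \<gamma> x - x))"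
    unfolding I using E' by (simp add: algebra_simps)
  define t where "t = \<mu> / ?n * D"
  have nD: "t \<le> \<mu> * (b + c)"
  proof -
    have "D / ?n \<le> b + c" using D by (simp add: divide_le_eq mult.commute)
    then have "\<mu> * (D / ?n) \<le> \<mu> * (b + c)" using \<mu> by (intro mult_left_mono) auto
    then show ?thesis by (simp add: t_def)
  qed
  have pos: "0 \<le> t" using \<mu> by (simp add: t_def D_def)
  have h: "\<mu> / (4 * ?n) * D = t / 4" "\<mu> / (2 * ?n) * D = t / 2" by (simp_all add: t_def)
  show "min ((\<beta> - 1) / 2) 1 / (2 * real (CARD('a) + 1)) * (norm (x - q))\<^sup>2
      \<le> 2 * inner (x - q) (reflect S (mean_increment \<beta> r \<gamma> x - x))"
    unfolding \<mu>_def[symmetric] d_def[symmetric] D_def[symmetric] h(2) using I2[unfolded h(1)] nD pos by linarith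
  have bc': "\<mu> * (b + c) \<le> b + c" using \<mu> bc by (simp add: mult_left_le_one_le)
  have "inner d (reflect S d) + 2 * inner d (reflect S (mean_increment \<beta> r \<gamma> x - x))
      \<ge> \<mu> * (b + c) - 2 * (\<mu> / (4 * ?n) * D)"
  proof -
    have "0 \<le> ((1 - r) * \<beta> - 1) * b" using rb \<beta> bc by (intro mult_nonneg_nonneg) auto
    then have "2 * ((1 - r) * \<beta> * b - (b - c)) + (b - c) \<ge> b + c" using bc by (simp add: algebra_simps)
    then show ?thesis
      unfolding inner_reflect_self[OF S] I b_def[symmetric] c_def[symmetric] using E' bc' by simp
  qed
  then show "min ((\<beta> - 1) / 2) 1 / (2 * real (CARD('a) + 1)) * (norm (x - q))\<^sup>2
      \<le> inner (x - q) (reflect S (x - q)) + 2 * inner (x - q) (reflect S (mean_increment \<beta> r \<gamma> x - x))"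
    unfolding \<mu>_def[symmetric] d_def[symmetric] D_def[symmetric] h using nD pos by linarith
qed

text \<open>The factor on the right is small enough for the linear part to decide the sign of the drift of
  \<open>V\<close> when \<open>S\<close> has several elements, and for \<^const>\<open>draw_prob\<close> to be a contraction when \<open>S\<close> has one.\<close>

definition linear_near :: "real \<Rightarrow> real \<Rightarrow> 'a::finite set \<Rightarrow> bool" where
  "linear_near \<beta> \<delta> S \<longleftrightarrow> (\<forall>x\<in>prob_simplex. \<forall>y\<in>prob_simplex.
     dist x (uniform_on S) < \<delta> \<longrightarrow> dist y (uniform_on S) < \<delta> \<longrightarrow>
     norm (draw_prob \<beta> x - draw_prob \<beta> y - spread \<beta> S (x - y))
       \<le> min ((\<beta> - 1) / 2) 1 / (4 * real (CARD('a) + 1)) * norm (x - y))"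

text \<open>The noise of one draw adds at least a fixed positive amount to the mean of \<open>V\<close>.\<close>

definition excited_near :: "real \<Rightarrow> real \<Rightarrow> real ^ 'a::finite \<Rightarrow> real \<Rightarrow> 'a set \<Rightarrow> bool" where
  "excited_near \<beta> r \<gamma> \<delta> S \<longleftrightarrow> (\<forall>x\<in>prob_simplex. dist x (uniform_on S) < \<delta> \<longrightarrow>
     1 / 16 \<le> (\<Sum>i\<in>UNIV. draw_prob \<beta> x $ i *
       inner (urn_increment r \<gamma> i - x) (reflect S (urn_increment r \<gamma> i - x))))"

text \<open>A draw of \<open>i \<in> S\<close> moves the shares in the direction of \<open>axis i 1 - uniform_on S\<close>, which is a pure
  fluctuation, and draws outside \<open>S\<close> are rare. So the noise increases \<open>V\<close> on average, even at the fixed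
  point.\<close>

lemma draws_excite_reflected_form:
  fixes \<beta> :: real and S :: "'a::finite set"
  assumes S: "2 \<le> card S" and \<beta>: "\<beta> > 1"
  obtains \<delta> where "\<delta> > 0"
    "\<And>\<gamma> r. \<gamma> \<in> prob_simplex \<Longrightarrow> 0 \<le> r \<Longrightarrow> r \<le> 1 / 256 \<Longrightarrow> excited_near \<beta> r \<gamma> \<delta> S"
proof -
  let ?u = "uniform_on S :: real ^ 'a"
  let ?n = "real CARD('a)"
  have ne: "S \<noteq> {}" using S by auto
  have u: "?u \<in> prob_simplex" by (rule uniform_on_simplex[OF ne])
  obtain C where C: "C \<ge> 0" "\<And>x y :: real ^ 'a. x \<in> prob_simplex \<Longrightarrow> y \<in> prob_simplex \<Longrightarrow>
    norm (draw_prob \<beta> x - draw_prob \<beta> y) \<le> C * norm (x - y)"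
    using draw_prob_lipschitz[OF \<beta>] by blast
  define \<delta> where "\<delta> = min (1 / 128) (1 / (64 * (?n * C + 1)))"
  have nC: "?n * C + 1 > 0" using C by (simp add: add_nonneg_pos)
  have \<delta>: "\<delta> > 0" "\<delta> \<le> 1 / 128" "?n * C * \<delta> \<le> 1 / 64"
  proof -
    show "\<delta> > 0" using nC by (simp add: \<delta>_def)
    show "\<delta> \<le> 1 / 128" by (simp add: \<delta>_def)
    have "(?n * C + 1) * \<delta> \<le> (?n * C + 1) * (1 / (64 * (?n * C + 1)))"
      using nC by (intro mult_left_mono) (auto simp: \<delta>_def)
    also have "\<dots> = 1 / 64" using nC by simp
    finally show "?n * C * \<delta> \<le> 1 / 64" using \<open>\<delta> > 0\<close> by (simp add: algebra_simps)
  qed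
  show ?thesis
  proof (rule that[OF \<delta>(1)], unfold excited_near_def, intro ballI impI)
    fix x \<gamma> :: "real ^ 'a" and r :: real
    assume g: "\<gamma> \<in> prob_simplex" and r: "0 \<le> r" "r \<le> 1 / 256"
      and x: "x \<in> prob_simplex" and dx: "dist x ?u < \<delta>"
    let ?V = "\<lambda>v. inner v (reflect S v)"
    have p: "draw_prob \<beta> x \<in> prob_simplex" using weight_pos[OF x, of \<beta>] \<beta> by (intro draw_prob_simplex) auto
    have close: "\<bar>?V (urn_increment r \<gamma> i - x) - ?V (axis i 1 - ?u)\<bar> \<le> 1 / 16" for i
    proof -
      let ?a = "urn_increment r \<gamma> i - x" and ?b = "axis i 1 - ?u"
      have inc: "urn_increment r \<gamma> i \<in> prob_simplex"
        unfolding urn_increment_def using r by (intro simplex_mix axis_simplex g) auto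
      have "?a - ?b = r *\<^sub>R (\<gamma> - axis i 1) + (?u - x)"
        by (simp add: urn_increment_def algebra_simps)
      then have "norm (?a - ?b) \<le> norm (r *\<^sub>R (\<gamma> - axis i 1)) + norm (?u - x)"
        by (metis norm_triangle_ineq)
      also have "\<dots> \<le> r * 2 + \<delta>"
        using norm_simplex_diff_le_2[OF g axis_simplex[of i]] dx r
        by (intro add_mono) (auto simp: dist_norm norm_minus_commute intro!: mult_left_mono)
      also have "\<dots> \<le> 1 / 64" using r \<delta>(2) by simp
      finally have n1: "norm (?a - ?b) \<le> 1 / 64" .
      have n2: "norm (?a + ?b) \<le> 4"
        using norm_triangle_ineq[of ?a ?b] norm_simplex_diff_le_2[OF inc x]
          norm_simplex_diff_le_2[OF axis_simplex[of i] u] by linarith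
      have "\<bar>?V ?a - ?V ?b\<bar> \<le> norm (?a - ?b) * norm (?a + ?b)"
        unfolding reflect_quadratic_diff by (rule abs_inner_reflect_le)
      also have "\<dots> \<le> 1 / 64 * 4" using n1 n2 by (intro mult_mono) auto
      finally show ?thesis by simp
    qed
    have inside: "1 / 4 \<le> ?V (axis i 1 - ?u)" if i: "i \<in> S" for i
    proof -
      let ?b = "axis i 1 - ?u"
      have sS: "(\<Sum>j\<in>S. ?b $ j) = 0"
        using i ne by (simp add: sum_subtractf axis_def uniform_on_def)
      have "reflect S ?b = ?b"
        unfolding vec_eq_iff
      proof
        fix j
        show "reflect S ?b $ j = ?b $ j"
          unfolding reflect_def using sS i by (auto simp: axis_def uniform_on_def)
      qed
      then have "?V ?b = (norm ?b)\<^sup>2" by (simp add: power2_norm_eq_inner)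
      moreover have "1 / 2 \<le> norm ?b"
      proof -
        have "1 / real (card S) \<le> 1 / 2" using S by (intro divide_left_mono) auto
        then have "1 / 2 \<le> \<bar>?b $ i\<bar>" using i by (simp add: axis_def uniform_on_def)
        also have "\<dots> \<le> norm ?b" by (rule component_le_norm_cart)
        finally show ?thesis .
      qed
      ultimately show ?thesis using power_mono[of "1 / 2" "norm ?b" 2] by (simp add: power2_eq_square)
    qed
    have outside: "- 4 \<le> ?V (axis i 1 - ?u)" for i
    proof -
      have "\<bar>?V (axis i 1 - ?u)\<bar> \<le> norm (axis i 1 - ?u) * norm (axis i 1 - ?u)" by (rule abs_inner_reflect_le)
      also have "\<dots> \<le> 2 * 2" using norm_simplex_diff_le_2[OF axis_simplex[of i] u] by (intro mult_mono) auto
      finally show ?thesis by simp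
    qed
    have small: "draw_prob \<beta> x $ i \<le> C * \<delta>" if "i \<notin> S" for i
    proof -
      have "draw_prob \<beta> x $ i = (draw_prob \<beta> x - draw_prob \<beta> ?u) $ i"
        using that \<beta> by (simp add: draw_prob_uniform_on[OF ne]) (simp add: uniform_on_def)
      also have "\<dots> \<le> norm (draw_prob \<beta> x - draw_prob \<beta> ?u)"
        using component_le_norm_cart[of "draw_prob \<beta> x - draw_prob \<beta> ?u" i] by linarith
      also have "\<dots> \<le> C * norm (x - ?u)" by (rule C(2)[OF x u])
      also have "\<dots> \<le> C * \<delta>" using dx C(1) by (intro mult_left_mono) (auto simp: dist_norm)
      finally show ?thesis .
    qed
    have "(\<Sum>i\<in>UNIV. draw_prob \<beta> x $ i * (1 / 4 - 1 / 16) - 1 / 16 * (4 * 17 * (C * \<delta>)))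
       \<le> (\<Sum>i\<in>UNIV. draw_prob \<beta> x $ i * ?V (urn_increment r \<gamma> i - x))"
    proof (rule sum_mono)
      fix i
      have pi: "0 \<le> draw_prob \<beta> x $ i" by (rule simplex_nonneg[OF p])
      show "draw_prob \<beta> x $ i * (1 / 4 - 1 / 16) - 1 / 16 * (4 * 17 * (C * \<delta>)) \<le> draw_prob \<beta> x $ i * ?V (urn_increment r \<gamma> i - x)"
      proof (cases "i \<in> S")
        case True
        then have "1 / 4 - 1 / 16 \<le> ?V (urn_increment r \<gamma> i - x)" using close[of i] inside[of i] by linarith
        then have "draw_prob \<beta> x $ i * (1 / 4 - 1 / 16) \<le> draw_prob \<beta> x $ i * ?V (urn_increment r \<gamma> i - x)"
          using pi by (rule mult_left_mono)
        moreover have "0 \<le> C * \<delta>" using C(1) \<delta>(1) by simp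
        ultimately show ?thesis by linarith
      next
        case False
        have "- 4 - 1 / 16 \<le> ?V (urn_increment r \<gamma> i - x)" using close[of i] outside[of i] by linarith
        then have "draw_prob \<beta> x $ i * (- 4 - 1 / 16) \<le> draw_prob \<beta> x $ i * ?V (urn_increment r \<gamma> i - x)"
          using pi by (rule mult_left_mono)
        then show ?thesis using small[OF False] by (simp add: algebra_simps)
      qed
    qed
    moreover have "(\<Sum>i\<in>UNIV. draw_prob \<beta> x $ i * (1 / 4 - 1 / 16) - 1 / 16 * (4 * 17 * (C * \<delta>)))
       = (1 / 4 - 1 / 16) - 1 / 16 * (4 * 17 * (?n * C * \<delta>))"
      by (simp only: sum_subtractf simplex_sum[OF p] sum_constant flip: sum_distrib_right) (simp add: algebra_simps)
    ultimately show "1 / 16 \<le> (\<Sum>i\<in>UNIV. draw_prob \<beta> x $ i * ?V (urn_increment r \<gamma> i - x))"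
      using \<delta>(3) by (simp add: algebra_simps)
  qed
qed

section \<open>Sequences weighted by the harmonic series\<close>

lemma not_summable_shifted_harmonic:
  fixes c N :: real
  assumes "c > 0" "N \<ge> 0"
  shows "\<not> summable (\<lambda>n. c / (N + real n + 1))"
proof
  assume s: "summable (\<lambda>n. c / (N + real n + 1))"
  have "summable (\<lambda>n. inverse (real (Suc n)))"
  proof (rule summable_comparison_test'[where N = 0])
    show "summable (\<lambda>n. ((N + 1) / c) * (c / (N + real n + 1)))" by (rule summable_mult[OF s])
    show "norm (inverse (real (Suc n))) \<le> (N + 1) / c * (c / (N + real n + 1))" for n
    proof -
      have "N + real n + 1 > 0" using assms by simp
      then have "(N + 1) / c * (c / (N + real n + 1)) = (N + 1) / (N + real n + 1)"
        using assms(1) by (metis (no_types, lifting) less_irrefl nonzero_eq_divide_eq times_divide_eq_left times_divide_eq_right)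
      moreover have "1 / (real n + 1) \<le> (N + 1) / (N + real n + 1)"
        using assms by (simp add: divide_le_eq pos_le_divide_eq algebra_simps)
      moreover have "norm (inverse (real (Suc n))) = 1 / (real n + 1)"
        by (simp add: inverse_eq_divide add.commute)
      ultimately show ?thesis by linarith
    qed
  qed
  then have "summable (\<lambda>n. inverse (real n))" using summable_Suc_iff[of "\<lambda>n. inverse (real n)"] by blast
  then show False using not_summable_harmonic[where 'a = real] by simp
qed

lemma tendsto_zero_of_harmonic_decay:
  fixes b :: "nat \<Rightarrow> real"
  assumes c: "c > 0" and N: "N \<ge> 0" and nn: "\<And>n. 0 \<le> b n"
    and dec: "\<And>n. n \<ge> n0 \<Longrightarrow> b (Suc n) \<le> (1 - c / (N + real n + 1)) * b n"
  shows "b \<longlonglongrightarrow> 0"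
proof -
  define a where "a n = b (n + n0)" for n
  have a: "a (Suc n) \<le> (1 - c / (N + real (n + n0) + 1)) * a n" for n
    using dec[of "n + n0"] by (simp add: a_def)
  have an: "0 \<le> a n" for n using nn by (simp add: a_def)
  have t: "0 \<le> c / (N + real (n + n0) + 1)" for n using c N by simp
  have le: "a (Suc n) \<le> a n" for n
    using a[of n] mult_nonneg_nonneg[OF t[of n] an[of n]] by (simp add: algebra_simps)
  have "decseq a" by (rule decseq_SucI) (rule le)
  then obtain l where l: "a \<longlonglongrightarrow> l" "\<And>n. l \<le> a n"
    using decseq_convergent[of a 0] an by auto
  have l0: "0 \<le> l" using l(1) an by (intro LIMSEQ_le_const) auto
  have "l = 0"
  proof (rule ccontr)
    assume "l \<noteq> 0"
    then have lp: "l > 0" using l0 by simp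
    have "summable (\<lambda>n. a n - a (Suc n))"
      using telescope_summable'[OF l(1)] .
    then have "summable (\<lambda>n. (c * l) / (N + real (n + n0) + 1))"
    proof (rule summable_comparison_test'[where N = 0])
      fix n
      have "c / (N + real (n + n0) + 1) * l \<le> c / (N + real (n + n0) + 1) * a n"
        using l(2) t by (intro mult_left_mono) auto
      also have "\<dots> \<le> a n - a (Suc n)" using a[of n] by (simp add: algebra_simps)
      finally show "norm ((c * l) / (N + real (n + n0) + 1)) \<le> a n - a (Suc n)"
        using lp c N by simp
    qed
    moreover have "(\<lambda>n. (c * l) / (N + real (n + n0) + 1)) = (\<lambda>n. (c * l) / ((N + real n0) + real n + 1))"
      by (simp add: algebra_simps)
    ultimately show False
      using not_summable_shifted_harmonic[of "c * l" "N + real n0"] c lp N by simp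
  qed
  then have "(\<lambda>n. b (n + n0)) \<longlonglongrightarrow> 0" using l by (simp add: a_def[abs_def])
  then show ?thesis by (rule LIMSEQ_offset)
qed

text \<open>The cubes have summable increments, so the sequence converges; a nonzero limit would contradict the
  divergence of the harmonic series.\<close>

lemma tendsto_zero_of_harmonic_square_summable:
  fixes g :: "nat \<Rightarrow> real"
  assumes N: "N \<ge> 0" and nn: "\<And>n. 0 \<le> g n"
    and lip: "\<And>n. \<bar>g (Suc n) - g n\<bar> \<le> C / (N + real n + 1)"
    and sq: "summable (\<lambda>n. (g n)\<^sup>2 / (N + real n + 1))"
  shows "g \<longlonglongrightarrow> 0"
proof -
  let ?m = "\<lambda>n. N + real n + 1"
  have m: "?m n > 0" for n using N by (simp add: add_nonneg_pos)
  have C: "C \<ge> 0"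
  proof -
    have "0 \<le> C / ?m 0" using lip[of 0] abs_ge_zero order_trans by blast
    then show ?thesis using m[of 0] by (simp add: zero_le_divide_iff)
  qed
  \<comment> \<open>The increments of the cube are summable, because they are at most the increment of \<open>g\<close>
    times a sum of squares.\<close>
  have sq': "summable (\<lambda>n. 2 * ((g (Suc n))\<^sup>2 / ?m (Suc n)))"
    using summable_mult[OF iffD2[OF summable_Suc_iff sq]] .
  have "summable (\<lambda>n. (g (Suc n))^3 - (g n)^3)"
  proof (rule summable_comparison_test'[where N = 0])
    show "summable (\<lambda>n. 2 * C * ((g n)\<^sup>2 / ?m n + 2 * ((g (Suc n))\<^sup>2 / ?m (Suc n))))"
      by (intro summable_mult summable_add sq sq')
    fix n
    have eq: "(g (Suc n))^3 - (g n)^3 = (g (Suc n) - g n) * ((g (Suc n))\<^sup>2 + g (Suc n) * g n + (g n)\<^sup>2)"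
      by (simp add: power2_eq_square power3_eq_cube algebra_simps)
    have q: "0 \<le> (g (Suc n))\<^sup>2 + g (Suc n) * g n + (g n)\<^sup>2"
      "(g (Suc n))\<^sup>2 + g (Suc n) * g n + (g n)\<^sup>2 \<le> 2 * ((g n)\<^sup>2 + (g (Suc n))\<^sup>2)"
    proof -
      have "0 \<le> g (Suc n) * g n" using nn by simp
      with sum_squares_bound[of "g (Suc n)" "g n"]
      show "0 \<le> (g (Suc n))\<^sup>2 + g (Suc n) * g n + (g n)\<^sup>2"
        "(g (Suc n))\<^sup>2 + g (Suc n) * g n + (g n)\<^sup>2 \<le> 2 * ((g n)\<^sup>2 + (g (Suc n))\<^sup>2)"
        by (auto simp: mult.assoc)
    qed
    have "\<bar>(g (Suc n))^3 - (g n)^3\<bar> \<le> C / ?m n * (2 * ((g n)\<^sup>2 + (g (Suc n))\<^sup>2))"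
      unfolding eq abs_mult using lip[of n] q C m[of n] by (intro mult_mono) auto
    also have "\<dots> = 2 * C * ((g n)\<^sup>2 / ?m n + (g (Suc n))\<^sup>2 / ?m n)"
      by (simp add: add_divide_distrib algebra_simps)
    also have "\<dots> \<le> 2 * C * ((g n)\<^sup>2 / ?m n + 2 * ((g (Suc n))\<^sup>2 / ?m (Suc n)))"
    proof -
      have "1 / ?m n \<le> 2 / ?m (Suc n)" using N by (simp add: field_simps)
      then have "(g (Suc n))\<^sup>2 * (1 / ?m n) \<le> (g (Suc n))\<^sup>2 * (2 / ?m (Suc n))"
        by (rule mult_left_mono) simp
      then show ?thesis using C by (intro mult_left_mono) (auto simp: mult.commute)
    qed
    finally show "norm ((g (Suc n))^3 - (g n)^3) \<le> 2 * C * ((g n)\<^sup>2 / ?m n + 2 * ((g (Suc n))\<^sup>2 / ?m (Suc n)))"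
      by simp
  qed
  then obtain t where "(\<lambda>n. \<Sum>k<n. (g (Suc k))^3 - (g k)^3) \<longlonglongrightarrow> t"
    using summable_LIMSEQ by blast
  then have "(\<lambda>n. (g n)^3 - (g 0)^3) \<longlonglongrightarrow> t"
    by (simp only: sum_lessThan_telescope[of "\<lambda>k. (g k)^3"])
  from tendsto_add[OF this tendsto_const[of "(g 0)^3"]]
  have "\<exists>l. (\<lambda>n. (g n)^3) \<longlonglongrightarrow> l" by auto
  then obtain l where l: "(\<lambda>n. (g n)^3) \<longlonglongrightarrow> l" ..
  have l0: "0 \<le> l" using l nn by (intro LIMSEQ_le_const[OF l]) auto
  have "(\<lambda>n. root 3 ((g n)^3)) \<longlonglongrightarrow> root 3 l" using l by (rule tendsto_real_root)
  then have g: "g \<longlonglongrightarrow> root 3 l" using nn by (simp add: real_root_power_cancel)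
  have "root 3 l = 0"
  proof (rule ccontr)
    assume "root 3 l \<noteq> 0"
    then have p: "root 3 l > 0" using l0 by (metis order.not_eq_order_implies_strict real_root_zero real_root_gt_0_iff zero_less_numeral)
    define a where "a = root 3 l / 2"
    have a: "a > 0" "a < root 3 l" using p by (auto simp: a_def)
    obtain n1 where n1: "\<And>n. n \<ge> n1 \<Longrightarrow> a < g n"
      using order_tendstoD(1)[OF g a(2)] by (auto simp: eventually_sequentially)
    have "summable (\<lambda>n. a\<^sup>2 / ?m n)"
    proof (rule summable_comparison_test'[OF sq])
      fix n assume "n \<ge> n1"
      then have "a\<^sup>2 \<le> (g n)\<^sup>2" using n1[of n] a by (intro power_mono) auto
      then show "norm (a\<^sup>2 / ?m n) \<le> (g n)\<^sup>2 / ?m n"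
        using m[of n] by (simp add: divide_right_mono)
    qed
    then show False using not_summable_shifted_harmonic[of "a\<^sup>2" N] a N by simp
  qed
  then show ?thesis using g by simp
qed

section \<open>The Markov chain of shares\<close>

text \<open>The urn with feedback \<open>k powr \<beta>\<close>. From here on the chain is studied through its shares \<open>Y\<close>, which are normalised by the
  deterministic mass \<open>N + n\<close> and agree almost surely with \<^const>\<open>share\<close>.\<close>

locale power_urn = polya_urn M r \<gamma> "\<lambda>i k. k powr \<beta>" x0 X
  for M :: "'w measure" and r :: real and \<gamma> :: "real ^ 'a::finite" and x0 :: "real ^ 'a"
    and X :: "nat \<Rightarrow> 'w \<Rightarrow> real ^ 'a" and \<beta> :: real +
  assumes \<beta>: "\<beta> > 1"
begin

abbreviation inc :: "'a \<Rightarrow> real ^ 'a" where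
  "inc \<equiv> urn_increment r \<gamma>"

abbreviation draw :: "real ^ 'a \<Rightarrow> real ^ 'a" where
  "draw \<equiv> draw_prob \<beta>"

abbreviation target :: "real ^ 'a \<Rightarrow> real ^ 'a" where
  "target \<equiv> mean_increment \<beta> r \<gamma>"

definition N :: real where
  "N = (\<Sum>i\<in>UNIV. x0 $ i)"

definition Y :: "nat \<Rightarrow> 'w \<Rightarrow> real ^ 'a" where
  "Y n \<omega> = (1 / (N + real n)) *\<^sub>R X n \<omega>"

definition step :: "nat \<Rightarrow> real ^ 'a \<Rightarrow> 'a \<Rightarrow> real ^ 'a" where
  "step n x i = x + (1 / (N + real n + 1)) *\<^sub>R (inc i - x)"

text \<open>An invariant set of shares. The lower bound by \<open>min (x0 $ i / N) (r * \<gamma> $ i)\<close> keeps \<open>ln (x $ i)\<close> bounded for every agent who receives a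
  positive wage.\<close>

definition states :: "(real ^ 'a) set" where
  "states = {x. (\<forall>i. 0 < x $ i \<and> min (x0 $ i / N) (r * \<gamma> $ i) \<le> x $ i) \<and> (\<Sum>i\<in>UNIV. x $ i) = 1}"

lemma N_ge_1: "1 \<le> N"
proof -
  have "x0 $ undefined \<le> N"
    unfolding N_def using x0 by (intro member_le_sum) (auto intro: order_trans[OF zero_le_one])
  then show ?thesis using x0[of undefined] by simp
qed

lemma time_pos: "0 < N + real n"
  using N_ge_1 by simp

lemma increment_simplex: "inc i \<in> prob_simplex"
  unfolding urn_increment_def using r \<gamma> by (intro simplex_mix axis_simplex)

lemma states_simplex: "x \<in> states \<Longrightarrow> x \<in> prob_simplex"
  by (rule simplexI) (auto simp: states_def less_imp_le)

lemma X_measurable' [measurable]: "X n \<in> borel_measurable M"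
  by (rule X_measurable)

lemma Y_measurable [measurable]: "Y n \<in> borel_measurable M"
  unfolding Y_def by measurable

lemma weight_measurable [measurable]: "weight \<beta> \<in> borel_measurable borel"
  unfolding weight_def by measurable

lemma draw_prob_measurable [measurable]: "(\<lambda>x. draw x $ i) \<in> borel_measurable borel"
  unfolding draw_prob_nth by measurable

lemma states_borel [measurable]: "states \<in> sets borel"
  unfolding states_def by measurable

lemma step_measurable [measurable]: "(\<lambda>x. step n x i) \<in> borel_measurable borel"
  unfolding step_def by measurable

lemma space_history: "space (history M X n) = space M"
  by (simp add: history_def)

lemma space_in_history: "space M \<in> sets (history M X n)"
  using sets.top[of "history M X n"] by (simp add: space_history)

lemma X_measurable_history: "k \<le> n \<Longrightarrow> X k \<in> borel_measurable (history M X n)"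
proof -
  assume k: "k \<le> n"
  have "(\<lambda>\<omega>. \<lambda>k\<in>{..n}. X k \<omega>) \<in> measurable (history M X n) (\<Pi>\<^sub>M k\<in>{..n}. borel)"
    unfolding history_def by (rule measurable_vimage_algebra1) (auto simp: space_PiM)
  from measurable_compose[OF this measurable_component_singleton[of k]] k
  show ?thesis by simp
qed

lemma Y_measurable_history: "k \<le> n \<Longrightarrow> Y k \<in> borel_measurable (history M X n)"
  unfolding Y_def using X_measurable_history[of k n] by measurable

lemma history_mono:
  assumes "m \<le> n"
  shows "sets (history M X m) \<subseteq> sets (history M X n)"
proof -
  have f: "(\<lambda>\<omega>. \<lambda>k\<in>{..m}. X k \<omega>) \<in> measurable (history M X n) (\<Pi>\<^sub>M k\<in>{..m}. borel)"
    using assms by (intro measurable_restrict X_measurable_history) auto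
  have "A \<in> sets (history M X n)" if "A \<in> sets (history M X m)" for A
  proof -
    have "A \<in> sets (vimage_algebra (space M) (\<lambda>\<omega>. \<lambda>k\<in>{..m}. X k \<omega>) (\<Pi>\<^sub>M k\<in>{..m}. borel))"
      using that by (simp add: history_def)
    then obtain B where "B \<in> sets (\<Pi>\<^sub>M k\<in>{..m}. borel)"
        "A = (\<lambda>\<omega>. \<lambda>k\<in>{..m}. X k \<omega>) -` B \<inter> space M"
      by (subst (asm) sets_vimage_algebra2) (auto simp: space_PiM)
    then show ?thesis using measurable_sets[OF f] by (simp add: space_history)
  qed
  then show ?thesis by blast
qed

lemma history_sets: "D \<in> sets (history M X n) \<Longrightarrow> D \<in> sets M"
  using subalgebra_history[of X M n] X_measurable by (auto simp: subalgebra_def)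

lemma kernel_prob:
  assumes "\<And>i. 0 < x $ i"
  shows "measure_pmf.prob (urn_kernel r \<gamma> (\<lambda>i k. k powr \<beta>) x) B
    = (\<Sum>i\<in>UNIV. draw x $ i * indicator B (x + inc i))"
proof -
  have p: "pmf (urn_draw (\<lambda>i k. k powr \<beta>) x) i = draw x $ i" for i
    using assms by (subst pmf_urn_draw) (auto simp: draw_prob_nth weight_def)
  have "measure_pmf.prob (urn_kernel r \<gamma> (\<lambda>i k. k powr \<beta>) x) B
    = (\<Sum>i\<in>UNIV \<inter> {i. x + inc i \<in> B}. draw x $ i)"
    unfolding urn_kernel_def measure_map_pmf
    by (subst measure_measure_pmf_finite) (auto simp: p vimage_def)
  also have "\<dots> = (\<Sum>i\<in>UNIV. draw x $ i * indicator B (x + inc i))"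
    by (rule sum.mono_neutral_cong_left) (auto simp: indicator_def)
  finally show ?thesis .
qed

text \<open>The Markov property in terms of integrals over events of the history.\<close>

lemma one_step_event:
  assumes D: "D \<in> sets (history M X n)" and B [measurable]: "B \<in> sets borel"
    and pos: "AE \<omega> in M. \<forall>i. 0 < X n \<omega> $ i"
  shows "(\<integral>\<^sup>+\<omega>. indicator B (X (Suc n) \<omega>) * indicator D \<omega> \<partial>M)
    = (\<integral>\<^sup>+\<omega>. (\<Sum>i\<in>UNIV. ennreal (draw (X n \<omega>) $ i) * indicator B (X n \<omega> + inc i)) * indicator D \<omega> \<partial>M)"
proof -
  have DM [measurable]: "D \<in> sets M" using D by (rule history_sets)
  interpret finite_measure_subalgebra M "history M X n"
    by unfold_locales (rule subalgebra_history, rule X_measurable)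
  define K where "K \<omega> = (\<Sum>i\<in>UNIV. draw (X n \<omega>) $ i * indicator B (X n \<omega> + inc i))" for \<omega>
  have [measurable]: "K \<in> borel_measurable M"
    unfolding K_def by measurable
  have Kn: "AE \<omega> in M. 0 \<le> K \<omega> \<and> K \<omega> \<le> 1 \<and> (\<forall>i. 0 \<le> draw (X n \<omega>) $ i)"
    using pos
  proof eventually_elim
    case (elim \<omega>)
    have "draw (X n \<omega>) \<in> prob_simplex"
      using elim by (intro draw_prob_simplex) (auto simp: weight_def less_imp_neq[THEN not_sym] intro!: sum_pos)
    moreover from elim have "K \<omega> = measure_pmf.prob (urn_kernel r \<gamma> (\<lambda>i k. k powr \<beta>) (X n \<omega>)) B"
      by (subst kernel_prob) (auto simp: K_def)
    ultimately show ?case by (auto simp: simplex_nonneg)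
  qed
  have i1: "integrable M (\<lambda>\<omega>. indicator B (X (Suc n) \<omega>) :: real)"
    by (rule integrable_const_bound[where B = 1]) auto
  have i2: "integrable M (\<lambda>\<omega>. indicator D \<omega> *\<^sub>R (indicator B (X (Suc n) \<omega>) :: real))"
    by (rule integrable_const_bound[where B = 1]) (auto simp: indicator_def)
  have i3: "integrable M (\<lambda>\<omega>. indicator D \<omega> *\<^sub>R K \<omega>)"
  proof (rule integrable_const_bound[where B = 1])
    show "AE \<omega> in M. norm (indicator D \<omega> *\<^sub>R K \<omega>) \<le> 1"
      using Kn by eventually_elim (auto simp: indicator_def)
  qed measurable
  have "(\<integral>\<^sup>+\<omega>. indicator B (X (Suc n) \<omega>) * indicator D \<omega> \<partial>M)
     = (\<integral>\<^sup>+\<omega>. ennreal (indicator D \<omega> *\<^sub>R indicator B (X (Suc n) \<omega>)) \<partial>M)"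
    by (intro nn_integral_cong) (auto simp: indicator_def)
  also have "\<dots> = ennreal (\<integral>\<omega>\<in>D. indicator B (X (Suc n) \<omega>) \<partial>M)"
    unfolding set_lebesgue_integral_def by (rule nn_integral_eq_integral[OF i2]) auto
  also have "(\<integral>\<omega>\<in>D. indicator B (X (Suc n) \<omega>) \<partial>M)
     = (\<integral>\<omega>\<in>D. real_cond_exp M (history M X n) (\<lambda>\<omega>. indicator B (X (Suc n) \<omega>)) \<omega> \<partial>M)"
    by (rule real_cond_exp_intA[OF i1 D])
  also have "\<dots> = (\<integral>\<omega>\<in>D. K \<omega> \<partial>M)"
    unfolding set_lebesgue_integral_def
  proof (rule integral_cong_AE)
    have "AE \<omega> in M. real_cond_exp M (history M X n) (\<lambda>\<omega>. indicator B (X (Suc n) \<omega>)) \<omega> = K \<omega>"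
      using markov[OF B, of n] pos by eventually_elim (simp add: kernel_prob K_def)
    then show "AE \<omega> in M. indicator D \<omega> *\<^sub>R real_cond_exp M (history M X n) (\<lambda>\<omega>. indicator B (X (Suc n) \<omega>)) \<omega>
      = indicator D \<omega> *\<^sub>R K \<omega>" by eventually_elim simp
  qed measurable
  also have "ennreal \<dots> = (\<integral>\<^sup>+\<omega>. ennreal (indicator D \<omega> *\<^sub>R K \<omega>) \<partial>M)"
    unfolding set_lebesgue_integral_def
  proof (rule nn_integral_eq_integral[OF i3, symmetric])
    show "AE \<omega> in M. 0 \<le> indicator D \<omega> *\<^sub>R K \<omega>"
      using Kn by eventually_elim (auto simp: indicator_def)
  qed
  also have "\<dots> = (\<integral>\<^sup>+\<omega>. (\<Sum>i\<in>UNIV. ennreal (draw (X n \<omega>) $ i) * indicator B (X n \<omega> + inc i)) * indicator D \<omega> \<partial>M)"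
    using Kn
  proof (intro nn_integral_cong_AE, eventually_elim)
    case (elim \<omega>)
    have "ennreal (K \<omega>) = (\<Sum>i\<in>UNIV. ennreal (draw (X n \<omega>) $ i) * indicator B (X n \<omega> + inc i))"
      unfolding K_def using elim
      by (subst sum_ennreal[symmetric]) (auto simp: ennreal_mult' ennreal_indicator intro!: sum.cong)
    then show ?case by (simp add: indicator_def)
  qed
  finally show ?thesis .
qed

text \<open>Extension from indicators to nonnegative Borel functions by monotone approximation.\<close>

lemma one_step:
  assumes D: "D \<in> sets (history M X n)" and f: "f \<in> borel_measurable borel"
    and pos: "AE \<omega> in M. \<forall>i. 0 < X n \<omega> $ i"
  shows "(\<integral>\<^sup>+\<omega>. f (X (Suc n) \<omega>) * indicator D \<omega> \<partial>M)
    = (\<integral>\<^sup>+\<omega>. (\<Sum>i\<in>UNIV. ennreal (draw (X n \<omega>) $ i) * f (X n \<omega> + inc i)) * indicator D \<omega> \<partial>M)"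
proof -
  have DM [measurable]: "D \<in> sets M" using D by (rule history_sets)
  show ?thesis
    using f
  proof (induction rule: borel_measurable_induct)
    case (cong f g)
    then have "f = g" by auto
    then show ?case using cong by simp
  next
    case (set A)
    then show ?case using one_step_event[OF D _ pos] by simp
  next
    case (mult u c)
    note [measurable] = mult.hyps(2)
    have "(\<integral>\<^sup>+\<omega>. c * u (X (Suc n) \<omega>) * indicator D \<omega> \<partial>M)
      = c * (\<integral>\<^sup>+\<omega>. u (X (Suc n) \<omega>) * indicator D \<omega> \<partial>M)"
      by (subst nn_integral_cmult[symmetric]) (auto simp: mult.assoc)
    also have "\<dots> = (\<integral>\<^sup>+\<omega>. c * ((\<Sum>i\<in>UNIV. ennreal (draw (X n \<omega>) $ i) * u (X n \<omega> + inc i)) * indicator D \<omega>) \<partial>M)"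
      unfolding mult.IH by (rule nn_integral_cmult[symmetric]) measurable
    also have "\<dots> = (\<integral>\<^sup>+\<omega>. (\<Sum>i\<in>UNIV. ennreal (draw (X n \<omega>) $ i) * (c * u (X n \<omega> + inc i))) * indicator D \<omega> \<partial>M)"
      by (intro nn_integral_cong) (simp add: sum_distrib_left sum_distrib_right ac_simps)
    finally show ?case .
  next
    case (add u v)
    note [measurable] = add.hyps(1,3)
    have "(\<integral>\<^sup>+\<omega>. (v (X (Suc n) \<omega>) + u (X (Suc n) \<omega>)) * indicator D \<omega> \<partial>M)
      = (\<integral>\<^sup>+\<omega>. v (X (Suc n) \<omega>) * indicator D \<omega> \<partial>M) + (\<integral>\<^sup>+\<omega>. u (X (Suc n) \<omega>) * indicator D \<omega> \<partial>M)"
      by (subst nn_integral_add[symmetric]) (auto simp: distrib_right)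
    also have "\<dots> = (\<integral>\<^sup>+\<omega>. (\<Sum>i\<in>UNIV. ennreal (draw (X n \<omega>) $ i) * v (X n \<omega> + inc i)) * indicator D \<omega>
       + (\<Sum>i\<in>UNIV. ennreal (draw (X n \<omega>) $ i) * u (X n \<omega> + inc i)) * indicator D \<omega> \<partial>M)"
      unfolding add.IH by (rule nn_integral_add[symmetric]) measurable
    also have "\<dots> = (\<integral>\<^sup>+\<omega>. (\<Sum>i\<in>UNIV. ennreal (draw (X n \<omega>) $ i) * (v (X n \<omega> + inc i) + u (X n \<omega> + inc i))) * indicator D \<omega> \<partial>M)"
      by (intro nn_integral_cong) (simp add: distrib_left distrib_right sum.distrib)
    finally show ?case .
  next
    case (seq U)
    note [measurable] = seq.hyps(1)
    have inc: "incseq (\<lambda>i. U i x)" for x using seq.hyps(3) by (auto simp: incseq_def le_fun_def)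
    have "(\<integral>\<^sup>+\<omega>. (SUP k. U k) (X (Suc n) \<omega>) * indicator D \<omega> \<partial>M)
      = (\<integral>\<^sup>+\<omega>. (SUP k. U k (X (Suc n) \<omega>) * indicator D \<omega>) \<partial>M)"
      by (simp add: SUP_apply image_image SUP_mult_right_ennreal)
    also have "\<dots> = (SUP k. \<integral>\<^sup>+\<omega>. U k (X (Suc n) \<omega>) * indicator D \<omega> \<partial>M)"
      using inc by (intro nn_integral_monotone_convergence_SUP)
        (auto simp: incseq_def le_fun_def intro!: mult_right_mono)
    also have "\<dots> = (SUP k. \<integral>\<^sup>+\<omega>. (\<Sum>i\<in>UNIV. ennreal (draw (X n \<omega>) $ i) * U k (X n \<omega> + inc i)) * indicator D \<omega> \<partial>M)"
      using seq.IH by simp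
    also have "\<dots> = (\<integral>\<^sup>+\<omega>. (SUP k. (\<Sum>i\<in>UNIV. ennreal (draw (X n \<omega>) $ i) * U k (X n \<omega> + inc i)) * indicator D \<omega>) \<partial>M)"
      using inc by (intro nn_integral_monotone_convergence_SUP[symmetric])
        (auto simp: incseq_def le_fun_def intro!: mult_right_mono sum_mono mult_left_mono)
    also have "\<dots> = (\<integral>\<^sup>+\<omega>. (\<Sum>i\<in>UNIV. ennreal (draw (X n \<omega>) $ i) * (SUP k. U k) (X n \<omega> + inc i)) * indicator D \<omega> \<partial>M)"
    proof (intro nn_integral_cong)
      fix \<omega>
      have "(SUP k. (\<Sum>i\<in>UNIV. ennreal (draw (X n \<omega>) $ i) * U k (X n \<omega> + inc i)))
        = (\<Sum>i\<in>UNIV. SUP k. ennreal (draw (X n \<omega>) $ i) * U k (X n \<omega> + inc i))"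
        using inc by (intro ennreal_SUP_sum) (auto simp: incseq_def intro!: mult_left_mono)
      then show "(SUP k. (\<Sum>i\<in>UNIV. ennreal (draw (X n \<omega>) $ i) * U k (X n \<omega> + inc i)) * indicator D \<omega>)
        = (\<Sum>i\<in>UNIV. ennreal (draw (X n \<omega>) $ i) * (SUP k. U k) (X n \<omega> + inc i)) * indicator D \<omega>"
        by (simp add: SUP_apply image_image SUP_mult_left_ennreal flip: SUP_mult_right_ennreal)
    qed
    finally show ?case .
  qed
qed

lemma AE_X_pos: "AE \<omega> in M. \<forall>i. 0 < X n \<omega> $ i"
proof (induction n)
  case 0
  show ?case using init
  proof eventually_elim
    case (elim \<omega>)
    then show ?case using x0 by (metis less_le_trans zero_less_one)
  qed
next
  case (Suc n)
  let ?B = "{x :: real ^ 'a. \<exists>i. x $ i \<le> 0}"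
  have B: "?B \<in> sets borel" by measurable
  have "(\<integral>\<^sup>+\<omega>. indicator ?B (X (Suc n) \<omega>) * indicator (space M) \<omega> \<partial>M) = (\<integral>\<^sup>+\<omega>. 0 \<partial>M)"
    unfolding one_step_event[OF space_in_history B Suc]
    using Suc
  proof (intro nn_integral_cong_AE, eventually_elim)
    case (elim \<omega>)
    have "0 < X n \<omega> $ j + inc i $ j" for i j
      using elim simplex_nonneg[OF increment_simplex[of i], of j] by (simp add: add_pos_nonneg)
    then have "X n \<omega> + inc i \<notin> ?B" for i by (auto simp: not_le)
    then show ?case by simp
  qed
  also have "\<dots> = 0" by simp
  finally have "AE \<omega> in M. indicator ?B (X (Suc n) \<omega>) * indicator (space M) \<omega> = (0 :: ennreal)"
    using B by (subst (asm) nn_integral_0_iff_AE) auto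
  then show ?case using AE_space
    by eventually_elim (auto simp: indicator_def not_le split: if_splits)
qed

lemma draw_prob_scale:
  assumes "c > 0" "\<And>i. 0 \<le> x $ i"
  shows "draw (c *\<^sub>R x) = draw x"
proof -
  have "weight \<beta> (c *\<^sub>R x) = c powr \<beta> * weight \<beta> x"
    using assms by (simp add: weight_def powr_mult sum_distrib_left)
  then show ?thesis
    using assms by (simp add: vec_eq_iff draw_prob_nth powr_mult)
qed

lemma share_one_step:
  assumes D: "D \<in> sets (history M X n)" and f [measurable]: "f \<in> borel_measurable borel"
  shows "(\<integral>\<^sup>+\<omega>. f (Y (Suc n) \<omega>) * indicator D \<omega> \<partial>M)
    = (\<integral>\<^sup>+\<omega>. (\<Sum>i\<in>UNIV. ennreal (draw (Y n \<omega>) $ i) * f (step n (Y n \<omega>) i)) * indicator D \<omega> \<partial>M)"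
proof -
  have m: "N + real n + 1 > 0" "N + real n > 0" using N_ge_1 by auto
  have g: "(\<lambda>x. f ((1 / (N + real n + 1)) *\<^sub>R x)) \<in> borel_measurable borel" by measurable
  have "(\<integral>\<^sup>+\<omega>. f (Y (Suc n) \<omega>) * indicator D \<omega> \<partial>M)
    = (\<integral>\<^sup>+\<omega>. f ((1 / (N + real n + 1)) *\<^sub>R X (Suc n) \<omega>) * indicator D \<omega> \<partial>M)"
    by (simp add: Y_def algebra_simps)
  also have "\<dots> = (\<integral>\<^sup>+\<omega>. (\<Sum>i\<in>UNIV. ennreal (draw (X n \<omega>) $ i)
      * f ((1 / (N + real n + 1)) *\<^sub>R (X n \<omega> + inc i))) * indicator D \<omega> \<partial>M)"
    by (rule one_step[OF D g AE_X_pos])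
  also have "\<dots> = (\<integral>\<^sup>+\<omega>. (\<Sum>i\<in>UNIV. ennreal (draw (Y n \<omega>) $ i) * f (step n (Y n \<omega>) i)) * indicator D \<omega> \<partial>M)"
    using AE_X_pos[of n]
  proof (intro nn_integral_cong_AE, eventually_elim)
    case (elim \<omega>)
    have "draw (Y n \<omega>) = draw (X n \<omega>)"
      unfolding Y_def using elim m by (intro draw_prob_scale) (auto simp: less_imp_le)
    moreover have "(1 / (N + real n + 1)) *\<^sub>R (X n \<omega> + inc i) = step n (Y n \<omega>) i" for i
    proof -
      have "X n \<omega> = (N + real n) *\<^sub>R Y n \<omega>" using m by (simp add: Y_def)
      moreover have "(1 / (N + real n + 1)) * (N + real n) = 1 - 1 / (N + real n + 1)"
        using m by (simp add: field_simps)
      ultimately show ?thesis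
        by (simp add: step_def scaleR_add_right scaleR_diff_right scaleR_diff_left del: scaleR_scaleR)
          (simp add: scaleR_diff_left)
    qed
    ultimately show ?case by simp
  qed
  finally show ?thesis .
qed

lemma step_convex:
  "step n x i = (1 - 1 / (N + real n + 1)) *\<^sub>R x + (1 / (N + real n + 1)) *\<^sub>R inc i"
  by (simp add: step_def algebra_simps)

lemma step_states:
  assumes "x \<in> states"
  shows "step n x i \<in> states"
proof -
  define t where "t = 1 / (N + real n + 1)"
  have t: "0 < t" "t < 1" using N_ge_1 by (auto simp: t_def)
  have s: "step n x i = (1 - t) *\<^sub>R x + t *\<^sub>R inc i"
    by (simp add: step_convex t_def)
  have sim: "step n x i \<in> prob_simplex"
    unfolding s using t assms by (intro simplex_mix states_simplex increment_simplex) auto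
  have x: "0 < x $ j" "min (x0 $ j / N) (r * \<gamma> $ j) \<le> x $ j" for j
    using assms by (auto simp: states_def)
  have v: "r * \<gamma> $ j \<le> inc i $ j" for j
    using r by (simp add: urn_increment_def axis_def)
  have "0 < step n x i $ j" for j
    unfolding s using t x(1)[of j] simplex_nonneg[OF increment_simplex[of i], of j]
    by (simp add: add_pos_nonneg)
  moreover have "min (x0 $ j / N) (r * \<gamma> $ j) \<le> step n x i $ j" for j
  proof -
    let ?c = "min (x0 $ j / N) (r * \<gamma> $ j)"
    have "?c \<le> inc i $ j" using v[of j] by linarith
    then have "(1 - t) * ?c + t * ?c \<le> (1 - t) * x $ j + t * inc i $ j"
      using t x(2)[of j] by (intro add_mono mult_left_mono) auto
    then show ?thesis by (simp add: s algebra_simps)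
  qed
  ultimately show ?thesis using simplex_sum[OF sim] by (simp add: states_def)
qed

lemma AE_states: "AE \<omega> in M. \<forall>n. Y n \<omega> \<in> states"
proof -
  have "AE \<omega> in M. Y n \<omega> \<in> states" for n
  proof (induction n)
    case 0
    show ?case using init
    proof eventually_elim
      case (elim \<omega>)
      have "0 < x0 $ i / N" for i
        using x0[of i] N_ge_1 by simp
      then show ?case using elim N_ge_1
        by (simp add: Y_def states_def flip: sum_divide_distrib N_def)
    qed
  next
    case (Suc n)
    have "(\<integral>\<^sup>+\<omega>. indicator (- states) (Y (Suc n) \<omega>) * indicator (space M) \<omega> \<partial>M) = (\<integral>\<^sup>+\<omega>. 0 \<partial>M)"
    proof (subst share_one_step[OF space_in_history])
      show "(\<integral>\<^sup>+\<omega>. (\<Sum>i\<in>UNIV. ennreal (draw (Y n \<omega>) $ i) * indicator (- states) (step n (Y n \<omega>) i)) * indicator (space M) \<omega> \<partial>M)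
        = (\<integral>\<^sup>+\<omega>. 0 \<partial>M)"
        using Suc by (intro nn_integral_cong_AE, eventually_elim) (simp add: step_states)
    qed measurable
    also have "\<dots> = 0" by simp
    finally have "AE \<omega> in M. indicator (- states) (Y (Suc n) \<omega>) * indicator (space M) \<omega> = (0 :: ennreal)"
      by (subst (asm) nn_integral_0_iff_AE) auto
    then show ?case using AE_space
      by eventually_elim (auto simp: indicator_def split: if_splits)
  qed
  then show ?thesis by (simp add: AE_all_countable)
qed

lemma AE_share_eq: "AE \<omega> in M. \<forall>n. share X n \<omega> = Y n \<omega>"
  using init by eventually_elim (simp add: share_def Y_def N_def)

text \<open>The conditional expectation of \<open>f\<close> at the next shares, given the shares \<open>x\<close> at time \<open>n\<close>.\<close>

definition average :: "nat \<Rightarrow> (real ^ 'a \<Rightarrow> real) \<Rightarrow> real ^ 'a \<Rightarrow> real" where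
  "average n f x = (\<Sum>i\<in>UNIV. draw x $ i * f (step n x i))"

lemma draw_prob_states: "x \<in> states \<Longrightarrow> draw x \<in> prob_simplex"
  using \<beta> by (intro draw_prob_simplex weight_pos states_simplex) auto

lemma average_one_step:
  assumes D: "D \<in> sets (history M X n)" and f [measurable]: "f \<in> borel_measurable borel"
    and nn: "\<And>x. x \<in> states \<Longrightarrow> 0 \<le> f x"
  shows "(\<integral>\<^sup>+\<omega>. ennreal (f (Y (Suc n) \<omega>)) * indicator D \<omega> \<partial>M)
    = (\<integral>\<^sup>+\<omega>. ennreal (average n f (Y n \<omega>)) * indicator D \<omega> \<partial>M)"
proof -
  have "(\<integral>\<^sup>+\<omega>. ennreal (f (Y (Suc n) \<omega>)) * indicator D \<omega> \<partial>M)
    = (\<integral>\<^sup>+\<omega>. (\<Sum>i\<in>UNIV. ennreal (draw (Y n \<omega>) $ i) * ennreal (f (step n (Y n \<omega>) i))) * indicator D \<omega> \<partial>M)"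
    by (rule share_one_step[OF D, of "\<lambda>x. ennreal (f x)"]) measurable
  also have "\<dots> = (\<integral>\<^sup>+\<omega>. ennreal (average n f (Y n \<omega>)) * indicator D \<omega> \<partial>M)"
    using AE_states
  proof (intro nn_integral_cong_AE, eventually_elim)
    case (elim \<omega>)
    then have x: "Y n \<omega> \<in> states" by simp
    have p: "0 \<le> draw (Y n \<omega>) $ i" for i using draw_prob_states[OF x] by (simp add: simplex_nonneg)
    have q: "0 \<le> f (step n (Y n \<omega>) i)" for i using nn step_states[OF x] by blast
    show ?case unfolding average_def
      using p q by (subst sum_ennreal[symmetric]) (auto simp: ennreal_mult intro!: mult_nonneg_nonneg)
  qed
  finally show ?thesis .
qed

lemma average_measurable [measurable]:
  "f \<in> borel_measurable borel \<Longrightarrow> average n f \<in> borel_measurable borel"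
  unfolding average_def
  by (intro borel_measurable_sum borel_measurable_times draw_prob_measurable measurable_compose[OF step_measurable])

lemma stay_event:
  assumes D: "D \<in> sets (history M X n0)" and U [measurable]: "\<And>j. U j \<in> sets borel" and n: "n0 \<le> n"
  shows "{\<omega>\<in>D. \<forall>j\<in>{n0..n}. Y j \<omega> \<in> U j} \<in> sets (history M X n)"
proof -
  have D': "D \<in> sets (history M X n)" using history_mono[OF n] D by blast
  have Dsub: "D \<subseteq> space M" using sets.sets_into_space[OF D] by (simp add: space_history)
  have "{\<omega>\<in>space (history M X n). \<forall>j\<in>{n0..n}. Y j \<omega> \<in> U j} \<in> sets (history M X n)"
  proof (rule sets.sets_Collect_finite_All)
    fix j assume "j \<in> {n0..n}"
    then have "Y j \<in> borel_measurable (history M X n)" by (intro Y_measurable_history) auto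
    from measurable_sets[OF this U[of j]]
    show "{\<omega>\<in>space (history M X n). Y j \<omega> \<in> U j} \<in> sets (history M X n)"
      by (simp add: vimage_def Int_def conj_commute)
  qed simp
  from sets.Int[OF D' this] show ?thesis
    by (rule back_subst[of "\<lambda>A. A \<in> sets (history M X n)"]) (use Dsub in \<open>auto simp: space_history\<close>)
qed

text \<open>Doob's inequality for a nonnegative supermartingale, started on an event \<open>D\<close> of the history and localised: the
  supermartingale property is required only as long as the path stays in the regions \<open>U n\<close>. The proof splits the event
  according to the first time at which the level \<open>\<kappa>\<close> is reached.\<close>

lemma maximal_inequality:
  assumes D: "D \<in> sets (history M X n0)" and U [measurable]: "\<And>n. U n \<in> sets borel"
    and f [measurable]: "\<And>n. f n \<in> borel_measurable borel" and nn: "\<And>n x. x \<in> states \<Longrightarrow> 0 \<le> f n x"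
    and super: "\<And>n x. n \<ge> n0 \<Longrightarrow> x \<in> states \<Longrightarrow> x \<in> U n \<Longrightarrow> average n (f (Suc n)) x \<le> f n x"
  shows "ennreal \<kappa> * emeasure M {\<omega>\<in>D. \<exists>k\<ge>n0. (\<forall>j. n0 \<le> j \<and> j < k \<longrightarrow> Y j \<omega> \<in> U j) \<and> \<kappa> \<le> f k (Y k \<omega>)}
    \<le> (\<integral>\<^sup>+\<omega>. ennreal (f n0 (Y n0 \<omega>)) * indicator D \<omega> \<partial>M)"
proof -
  have DM [measurable]: "D \<in> sets M" using D by (rule history_sets)
  define Q where "Q n = {\<omega>\<in>D. \<forall>j\<in>{n0..n}. Y j \<omega> \<in> U j \<inter> {x. f j x < \<kappa>}}" for n
  define P where "P n = (if n = n0 then D else Q (n - 1))" for n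
  define H where "H n = {\<omega>\<in>P n. \<kappa> \<le> f n (Y n \<omega>)}" for n
  have Q: "Q n \<in> sets (history M X n)" if "n0 \<le> n" for n
    unfolding Q_def using that by (intro stay_event[OF D]) measurable
  have QM: "Q n \<in> sets M" if "n0 \<le> n" for n using Q[OF that] by (rule history_sets)
  have PM: "P n \<in> sets M" if "n0 \<le> n" for n using QM[of "n - 1"] that DM by (auto simp: P_def)
  have HM: "H n \<in> sets M" if "n0 \<le> n" for n
  proof -
    have "{\<omega>\<in>space M. \<kappa> \<le> f n (Y n \<omega>)} \<in> sets M" by measurable
    from sets.Int[OF PM[OF that] this] show ?thesis
      by (rule back_subst[of "\<lambda>A. A \<in> sets M"]) (use sets.sets_into_space[OF PM[OF that]] in \<open>auto simp: H_def\<close>)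
  qed
  have PQ: "Q n = {\<omega>\<in>P n. Y n \<omega> \<in> U n \<and> f n (Y n \<omega>) < \<kappa>}" if n: "n0 \<le> n" for n
  proof (cases "n = n0")
    case True
    then show ?thesis by (auto simp: P_def Q_def)
  next
    case False
    then obtain k where k: "n = Suc k" "n0 \<le> k" using n by (metis Suc_leI le_Suc_ex le_neq_implies_less not0_implies_Suc add_Suc_right less_imp_Suc_add le_add1)
    show ?thesis using k by (auto simp: P_def Q_def atLeastAtMostSuc_conv)
  qed
  have main: "ennreal \<kappa> * (\<Sum>j\<in>{n0..<n}. emeasure M (H j)) + (\<integral>\<^sup>+\<omega>. ennreal (f n (Y n \<omega>)) * indicator (P n) \<omega> \<partial>M)
      \<le> (\<integral>\<^sup>+\<omega>. ennreal (f n0 (Y n0 \<omega>)) * indicator D \<omega> \<partial>M)" if "n0 \<le> n" for n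
    using that
  proof (induction n rule: dec_induct)
    case base
    show ?case by (simp add: P_def)
  next
    case (step n)
    have [measurable]: "P n \<in> sets M" "H n \<in> sets M" "Q n \<in> sets M" using step PM HM QM by auto
    have "(\<integral>\<^sup>+\<omega>. ennreal (f (Suc n) (Y (Suc n) \<omega>)) * indicator (P (Suc n)) \<omega> \<partial>M)
       = (\<integral>\<^sup>+\<omega>. ennreal (f (Suc n) (Y (Suc n) \<omega>)) * indicator (Q n) \<omega> \<partial>M)"
      using step by (simp add: P_def)
    also have "\<dots> = (\<integral>\<^sup>+\<omega>. ennreal (average n (f (Suc n)) (Y n \<omega>)) * indicator (Q n) \<omega> \<partial>M)"
      using step by (intro average_one_step Q f nn) auto
    also have "\<dots> \<le> (\<integral>\<^sup>+\<omega>. ennreal (f n (Y n \<omega>)) * indicator (Q n) \<omega> \<partial>M)"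
      using AE_states
    proof (intro nn_integral_mono_AE, eventually_elim)
      case (elim \<omega>)
      then show ?case using super[OF step(1), of "Y n \<omega>"] PQ[OF step(1)]
        by (auto simp: indicator_def intro!: ennreal_leI)
    qed
    finally have 1: "(\<integral>\<^sup>+\<omega>. ennreal (f (Suc n) (Y (Suc n) \<omega>)) * indicator (P (Suc n)) \<omega> \<partial>M)
       \<le> (\<integral>\<^sup>+\<omega>. ennreal (f n (Y n \<omega>)) * indicator (Q n) \<omega> \<partial>M)" .
    have "ennreal \<kappa> * emeasure M (H n) + (\<integral>\<^sup>+\<omega>. ennreal (f n (Y n \<omega>)) * indicator (Q n) \<omega> \<partial>M)
      = (\<integral>\<^sup>+\<omega>. ennreal \<kappa> * indicator (H n) \<omega> + ennreal (f n (Y n \<omega>)) * indicator (Q n) \<omega> \<partial>M)"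
      by (subst nn_integral_add) (auto simp: nn_integral_cmult)
    also have "\<dots> \<le> (\<integral>\<^sup>+\<omega>. ennreal (f n (Y n \<omega>)) * indicator (P n) \<omega> \<partial>M)"
      using PQ[OF step(1)] by (intro nn_integral_mono) (auto simp: H_def indicator_def intro!: ennreal_leI)
    finally have 2: "ennreal \<kappa> * emeasure M (H n) + (\<integral>\<^sup>+\<omega>. ennreal (f n (Y n \<omega>)) * indicator (Q n) \<omega> \<partial>M)
      \<le> (\<integral>\<^sup>+\<omega>. ennreal (f n (Y n \<omega>)) * indicator (P n) \<omega> \<partial>M)" .
    have "ennreal \<kappa> * (\<Sum>j\<in>{n0..<Suc n}. emeasure M (H j)) + (\<integral>\<^sup>+\<omega>. ennreal (f (Suc n) (Y (Suc n) \<omega>)) * indicator (P (Suc n)) \<omega> \<partial>M)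
      \<le> ennreal \<kappa> * (\<Sum>j\<in>{n0..<n}. emeasure M (H j)) + (ennreal \<kappa> * emeasure M (H n) + (\<integral>\<^sup>+\<omega>. ennreal (f n (Y n \<omega>)) * indicator (Q n) \<omega> \<partial>M))"
      using step 1 by (simp add: distrib_left add.assoc add_left_mono)
    also have "\<dots> \<le> ennreal \<kappa> * (\<Sum>j\<in>{n0..<n}. emeasure M (H j)) + (\<integral>\<^sup>+\<omega>. ennreal (f n (Y n \<omega>)) * indicator (P n) \<omega> \<partial>M)"
      using 2 by (rule add_left_mono)
    also have "\<dots> \<le> (\<integral>\<^sup>+\<omega>. ennreal (f n0 (Y n0 \<omega>)) * indicator D \<omega> \<partial>M)" by (rule step.IH)
    finally show ?case .
  qed
  let ?E = "{\<omega>\<in>D. \<exists>k\<ge>n0. (\<forall>j. n0 \<le> j \<and> j < k \<longrightarrow> Y j \<omega> \<in> U j) \<and> \<kappa> \<le> f k (Y k \<omega>)}"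
  have sub: "?E \<subseteq> (\<Union>i. H (i + n0))"
  proof
    fix \<omega> assume "\<omega> \<in> ?E"
    then obtain k where \<omega>: "\<omega> \<in> D" and k: "n0 \<le> k" "\<And>j. n0 \<le> j \<Longrightarrow> j < k \<Longrightarrow> Y j \<omega> \<in> U j" "\<kappa> \<le> f k (Y k \<omega>)"
      by auto
    define l where "l = (LEAST l. n0 \<le> l \<and> \<kappa> \<le> f l (Y l \<omega>))"
    have l: "n0 \<le> l" "\<kappa> \<le> f l (Y l \<omega>)" "l \<le> k"
      using LeastI[of "\<lambda>l. n0 \<le> l \<and> \<kappa> \<le> f l (Y l \<omega>)" k] Least_le[of "\<lambda>l. n0 \<le> l \<and> \<kappa> \<le> f l (Y l \<omega>)" k] k
      by (auto simp: l_def)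
    have "Y j \<omega> \<in> U j \<and> f j (Y j \<omega>) < \<kappa>" if "n0 \<le> j" "j < l" for j
      using not_less_Least[of j "\<lambda>l. n0 \<le> l \<and> \<kappa> \<le> f l (Y l \<omega>)"] that k(2)[of j] l by (auto simp: l_def[symmetric] not_le)
    then have "\<omega> \<in> P l" using l \<omega> by (auto simp: P_def Q_def)
    then have "\<omega> \<in> H (l - n0 + n0)" using l by (simp add: H_def)
    then show "\<omega> \<in> (\<Union>i. H (i + n0))" by blast
  qed
  have "emeasure M ?E \<le> emeasure M (\<Union>i. H (i + n0))"
    using HM by (intro emeasure_mono sub) auto
  also have "\<dots> \<le> (\<Sum>i. emeasure M (H (i + n0)))"
    using HM by (intro emeasure_subadditive_countably) auto
  finally have "ennreal \<kappa> * emeasure M ?E \<le> (\<Sum>i. ennreal \<kappa> * emeasure M (H (i + n0)))"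
    by (simp add: mult_left_mono)
  also have "\<dots> \<le> (\<integral>\<^sup>+\<omega>. ennreal (f n0 (Y n0 \<omega>)) * indicator D \<omega> \<partial>M)"
  proof (rule suminf_le_const)
    fix n
    have "(\<Sum>i<n. ennreal \<kappa> * emeasure M (H (i + n0))) = ennreal \<kappa> * (\<Sum>j\<in>{n0..<n + n0}. emeasure M (H j))"
      using sum.shift_bounds_nat_ivl[of "\<lambda>j. emeasure M (H j)" 0 n0 n]
      by (simp add: sum_distrib_left atLeast0LessThan)
    also have "\<dots> \<le> (\<integral>\<^sup>+\<omega>. ennreal (f n0 (Y n0 \<omega>)) * indicator D \<omega> \<partial>M)"
      using main[of "n + n0"] by (auto intro: order_trans[OF _ main[of "n + n0"]])
    finally show "(\<Sum>i<n. ennreal \<kappa> * emeasure M (H (i + n0))) \<le> (\<integral>\<^sup>+\<omega>. ennreal (f n0 (Y n0 \<omega>)) * indicator D \<omega> \<partial>M)" .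
  qed simp
  finally show ?thesis .
qed

text \<open>The expectation of \<open>f n\<close> on the event of having stayed until time \<open>n\<close> is at most a constant times the product of the
  factors \<open>1 - c / (N + n + 1)\<close>, which tends to 0. The maximal inequality turns this into almost sure convergence.\<close>

lemma decay_while_staying:
  assumes U [measurable]: "\<And>n. U n \<in> sets borel"
    and f [measurable]: "\<And>n. f n \<in> borel_measurable borel" and nn: "\<And>n x. x \<in> states \<Longrightarrow> 0 \<le> f n x"
    and c: "0 < c" "c \<le> 1"
    and super: "\<And>n x. n \<ge> n0 \<Longrightarrow> x \<in> states \<Longrightarrow> x \<in> U n \<Longrightarrow>
      average n (f (Suc n)) x \<le> (1 - c / (N + real n + 1)) * f n x"
    and bnd: "\<And>x. x \<in> states \<Longrightarrow> x \<in> U n0 \<Longrightarrow> f n0 x \<le> b"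
  shows "AE \<omega> in M. (\<forall>n\<ge>n0. Y n \<omega> \<in> U n) \<longrightarrow> (\<lambda>n. f n (Y n \<omega>)) \<longlonglongrightarrow> 0"
proof -
  define D where "D n = {\<omega>\<in>space M. \<forall>j\<in>{n0..n}. Y j \<omega> \<in> U j}" for n
  have D: "D n \<in> sets (history M X n)" if "n0 \<le> n" for n
    unfolding D_def by (rule stay_event[OF space_in_history U that])
  have DM: "D n \<in> sets M" if "n0 \<le> n" for n using D[OF that] by (rule history_sets)
  define q where "q n = 1 - c / (N + real n + 1)" for n
  have q: "0 \<le> q n" "q n \<le> 1" for n
    using c N_ge_1 by (auto simp: q_def field_simps)
  define a where "a n = max b 0 * (\<Prod>j\<in>{n0..<n}. q j)" for n
  have a0: "0 \<le> a n" for n using q by (auto simp: a_def intro!: mult_nonneg_nonneg prod_nonneg)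
  have a: "a \<longlonglongrightarrow> 0"
  proof (rule tendsto_zero_of_harmonic_decay[of c N, OF c(1) _ a0])
    show "a (Suc n) \<le> (1 - c / (N + real n + 1)) * a n" if "n \<ge> n0" for n
      using that by (simp add: a_def q_def)
  qed (use N_ge_1 in simp)
  define I where "I n = (\<integral>\<^sup>+\<omega>. ennreal (f n (Y n \<omega>)) * indicator (D n) \<omega> \<partial>M)" for n
  have I: "I n \<le> ennreal (a n)" if "n0 \<le> n" for n
    using that
  proof (induction n rule: dec_induct)
    case base
    have "I n0 \<le> (\<integral>\<^sup>+\<omega>. ennreal (max b 0) \<partial>M)"
      unfolding I_def using AE_states
    proof (intro nn_integral_mono_AE, eventually_elim)
      case (elim \<omega>)
      then show ?case using bnd[of "Y n0 \<omega>"]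
        by (auto simp: D_def indicator_def intro!: ennreal_leI)
    qed
    then show ?case by (simp add: a_def emeasure_space_1)
  next
    case (step n)
    have "I (Suc n) \<le> (\<integral>\<^sup>+\<omega>. ennreal (f (Suc n) (Y (Suc n) \<omega>)) * indicator (D n) \<omega> \<partial>M)"
      unfolding I_def by (intro nn_integral_mono) (auto simp: D_def indicator_def)
    also have "\<dots> = (\<integral>\<^sup>+\<omega>. ennreal (average n (f (Suc n)) (Y n \<omega>)) * indicator (D n) \<omega> \<partial>M)"
      using step by (intro average_one_step D f nn) auto
    also have "\<dots> \<le> (\<integral>\<^sup>+\<omega>. ennreal (q n) * (ennreal (f n (Y n \<omega>)) * indicator (D n) \<omega>) \<partial>M)"
      using AE_states
    proof (intro nn_integral_mono_AE, eventually_elim)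
      case (elim \<omega>)
      show ?case
      proof (cases "\<omega> \<in> D n")
        case True
        then have "average n (f (Suc n)) (Y n \<omega>) \<le> q n * f n (Y n \<omega>)"
          using super[OF step(1), of "Y n \<omega>"] elim step(1) by (auto simp: D_def q_def)
        then show ?thesis using True q[of n] nn[of "Y n \<omega>" n] elim
          by (simp add: ennreal_mult[symmetric] ennreal_leI)
      qed simp
    qed
    also have "\<dots> = ennreal (q n) * I n"
      unfolding I_def using DM[OF step(1)]
      by (intro nn_integral_cmult borel_measurable_times_ennreal borel_measurable_indicator) measurable
    also have "\<dots> \<le> ennreal (q n) * ennreal (a n)" using step.IH by (rule mult_left_mono) simp
    also have "\<dots> = ennreal (a (Suc n))" using q a0 step(1) by (simp add: a_def ennreal_mult[symmetric] ac_simps)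
    finally show ?case .
  qed
  define Bad where "Bad \<kappa> = {\<omega>\<in>space M. (\<forall>n\<ge>n0. Y n \<omega> \<in> U n) \<and> (\<forall>n. \<exists>k\<ge>n. \<kappa> \<le> f k (Y k \<omega>))}" for \<kappa>
  have BadM: "Bad \<kappa> \<in> sets M" for \<kappa> unfolding Bad_def by measurable
  have "AE \<omega> in M. \<omega> \<notin> Bad \<kappa>" if l: "\<kappa> > 0" for \<kappa>
  proof -
    have le: "ennreal \<kappa> * emeasure M (Bad \<kappa>) \<le> ennreal (a n)" if n: "n0 \<le> n" for n
    proof -
      let ?E = "{\<omega>\<in>D n. \<exists>k\<ge>n. (\<forall>j. n \<le> j \<and> j < k \<longrightarrow> Y j \<omega> \<in> U j) \<and> \<kappa> \<le> f k (Y k \<omega>)}"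
      have EM: "?E \<in> sets M"
      proof -
        have "{\<omega>\<in>space M. \<exists>k\<ge>n. (\<forall>j. n \<le> j \<and> j < k \<longrightarrow> Y j \<omega> \<in> U j) \<and> \<kappa> \<le> f k (Y k \<omega>)} \<in> sets M"
          by measurable
        from sets.Int[OF DM[OF n] this] show ?thesis
          by (rule back_subst[of "\<lambda>A. A \<in> sets M"]) (auto simp: D_def)
      qed
      have "Bad \<kappa> \<subseteq> ?E"
      proof
        fix \<omega> assume w: "\<omega> \<in> Bad \<kappa>"
        then obtain k where "k \<ge> n" "\<kappa> \<le> f k (Y k \<omega>)" by (auto simp: Bad_def)
        then show "\<omega> \<in> ?E" using w n by (auto simp: Bad_def D_def intro!: exI[of _ k])
      qed
      then have "ennreal \<kappa> * emeasure M (Bad \<kappa>) \<le> ennreal \<kappa> * emeasure M ?E"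
        by (intro mult_left_mono emeasure_mono[OF _ EM]) simp_all
      also have "\<dots> \<le> I n" unfolding I_def
      proof (rule maximal_inequality[OF D[OF n] U f nn])
        fix m x assume m: "m \<ge> n" and x: "x \<in> states" "x \<in> U m"
        have "average m (f (Suc m)) x \<le> q m * f m x" using super[of m x] m n x by (simp add: q_def)
        also have "\<dots> \<le> f m x" using q[of m] nn[OF x(1), of m] by (simp add: mult_left_le_one_le)
        finally show "average m (f (Suc m)) x \<le> f m x" .
      qed
      also have "\<dots> \<le> ennreal (a n)" by (rule I[OF n])
      finally show ?thesis .
    qed
    have "ennreal \<kappa> * emeasure M (Bad \<kappa>) \<le> ennreal 0"
      by (rule LIMSEQ_le_const[OF tendsto_ennrealI[OF a]]) (use le in blast)
    then have "ennreal \<kappa> * emeasure M (Bad \<kappa>) = 0" by simp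
    moreover have "ennreal \<kappa> \<noteq> 0" using l by simp
    ultimately have "emeasure M (Bad \<kappa>) = 0" by simp
    from AE_not_in[OF null_setsI[OF this BadM]] show ?thesis .
  qed
  then have "AE \<omega> in M. \<forall>k. \<omega> \<notin> Bad (1 / real (Suc k))"
    by (simp add: AE_all_countable)
  then show ?thesis using AE_space AE_states
  proof eventually_elim
    case (elim \<omega>)
    show ?case
    proof
      assume stay: "\<forall>n\<ge>n0. Y n \<omega> \<in> U n"
      show "(\<lambda>n. f n (Y n \<omega>)) \<longlonglongrightarrow> 0"
      proof (rule LIMSEQ_I)
        fix e :: real assume "e > 0"
        then obtain k where k: "1 / real (Suc k) < e" using nat_approx_posE by blast
        have "\<omega> \<notin> Bad (1 / real (Suc k))" using elim(1) by blast
        then have "\<not> (\<forall>n. \<exists>j\<ge>n. 1 / real (Suc k) \<le> f j (Y j \<omega>))"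
          using stay elim(2) unfolding Bad_def by blast
        then obtain n where n: "\<And>j. j \<ge> n \<Longrightarrow> f j (Y j \<omega>) < 1 / real (Suc k)"
          by (meson not_le)
        show "\<exists>no. \<forall>n\<ge>no. norm (f n (Y n \<omega>) - 0) < e"
        proof (intro exI[of _ n] allI impI)
          fix j assume "n \<le> j"
          then have "f j (Y j \<omega>) < e" using n[of j] k by linarith
          moreover have "0 \<le> f j (Y j \<omega>)" using nn elim(3) by blast
          ultimately show "norm (f j (Y j \<omega>) - 0) < e" by simp
        qed
      qed
    qed
  qed
qed

end

section \<open>One-step averages\<close>

lemma exp_minus_le_quadratic:
  fixes t :: real
  assumes "\<bar>t\<bar> \<le> 1"
  shows "exp (- t) \<le> 1 - t + t\<^sup>2"
proof (cases "0 \<le> t")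
  case True
  have "exp (- t) = 1 / exp t" by (simp add: exp_minus inverse_eq_divide)
  also have "\<dots> \<le> 1 / (1 + t)" using True by (intro divide_left_mono) auto
  also have "\<dots> \<le> 1 - t + t\<^sup>2"
  proof -
    have "1 \<le> (1 - t + t\<^sup>2) * (1 + t)"
    proof -
      have "(1 - t + t\<^sup>2) * (1 + t) = 1 + t ^ 3" by (simp add: power2_eq_square power3_eq_cube algebra_simps)
      then show ?thesis using True by simp
    qed
    then show ?thesis using True by (simp add: divide_le_eq)
  qed
  finally show ?thesis .
next
  case False
  then show ?thesis using exp_bound[of "- t"] assms by simp
qed

lemma inverse_le_quadratic:
  fixes v h :: real
  assumes v: "v > 0" and h: "\<bar>h\<bar> \<le> v / 2"
  shows "1 / (v + h) \<le> 1 / v - h / v\<^sup>2 + 2 * h\<^sup>2 / v ^ 3"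
proof -
  have p: "v + h > 0" "v + h \<ge> v / 2" using v h by auto
  have "1 / (v + h) = 1 / v - h / v\<^sup>2 + h\<^sup>2 / (v\<^sup>2 * (v + h))"
  proof -
    define w where "w = v + h"
    have h: "h = w - v" and w: "w > 0" using p(1) by (auto simp: w_def)
    show ?thesis unfolding w_def[symmetric] h using v w
      by (simp add: field_simps power2_eq_square)
  qed
  also have "h\<^sup>2 / (v\<^sup>2 * (v + h)) \<le> h\<^sup>2 / (v\<^sup>2 * (v / 2))"
    using v p by (intro divide_left_mono mult_left_mono mult_pos_pos) auto
  also have "\<dots> = 2 * h\<^sup>2 / v ^ 3" using v by (simp add: field_simps power2_eq_square power3_eq_cube)
  finally show ?thesis by simp
qed

lemma norm_add_scaleR_square:
  fixes a b :: "'b::real_inner"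
  shows "(norm (a + c *\<^sub>R b))\<^sup>2 = (norm a)\<^sup>2 + (2 * c) * inner a b + c\<^sup>2 * (norm b)\<^sup>2"
  unfolding power2_norm_eq_inner
  by (simp add: inner_add_left inner_add_right inner_commute[of b a] power2_eq_square algebra_simps)

lemma square_le_of_abs_le_sum:
  fixes h a b :: real
  assumes "\<bar>h\<bar> \<le> a + b"
  shows "h\<^sup>2 \<le> 2 * a\<^sup>2 + 2 * b\<^sup>2"
proof -
  have "h\<^sup>2 \<le> (a + b)\<^sup>2" using assms by (intro power2_le_iff_abs_le[THEN iffD2]) auto
  also have "\<dots> \<le> 2 * a\<^sup>2 + 2 * b\<^sup>2"
    using sum_squares_bound[of a b] by (simp add: power2_sum)
  finally show ?thesis .
qed

context power_urn
begin

abbreviation mean_field :: "real ^ 'a \<Rightarrow> real ^ 'a" where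
  "mean_field x \<equiv> target x - x"

lemma mean_increment_simplex: "x \<in> prob_simplex \<Longrightarrow> target x \<in> prob_simplex"
  unfolding mean_increment_def using r \<gamma> \<beta>
  by (intro simplex_mix draw_prob_simplex weight_pos) auto

lemma average_increment:
  assumes "x \<in> states"
  shows "(\<Sum>i\<in>UNIV. draw x $ i *\<^sub>R (inc i - x)) = mean_field x"
proof -
  have p: "(\<Sum>i\<in>UNIV. draw x $ i) = 1" using draw_prob_states[OF assms] by (rule simplex_sum)
  show ?thesis
    unfolding vec_eq_iff
  proof
    fix j
    have "(\<Sum>i\<in>UNIV. draw x $ i *\<^sub>R (inc i - x)) $ j
      = (\<Sum>i\<in>UNIV. (1 - r) * (if i = j then draw x $ i else 0) + draw x $ i * (r * \<gamma> $ j - x $ j))"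
      unfolding sum_component
      by (intro sum.cong) (auto simp: urn_increment_def axis_def algebra_simps)
    also have "\<dots> = (1 - r) * draw x $ j + (r * \<gamma> $ j - x $ j)"
      by (simp add: sum.distrib p flip: sum_distrib_left sum_distrib_right)
    finally show "(\<Sum>i\<in>UNIV. draw x $ i *\<^sub>R (inc i - x)) $ j = mean_field x $ j"
      by (simp add: mean_increment_nth)
  qed
qed

lemma average_inner:
  assumes "x \<in> states"
  shows "(\<Sum>i\<in>UNIV. draw x $ i * inner v (inc i - x)) = inner v (mean_field x)"
  unfolding average_increment[OF assms, symmetric] inner_sum_right inner_scaleR_right ..

lemma average_inner_reflect:
  assumes "x \<in> states"
  shows "(\<Sum>i\<in>UNIV. draw x $ i * inner v (reflect S (inc i - x))) = inner v (reflect S (mean_field x))"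
  unfolding reflect_self_adjoint[of v] using average_inner[OF assms, of "reflect S v"] by (simp add: inner_commute)

lemma increment_norm_le_2: "x \<in> states \<Longrightarrow> norm (inc i - x) \<le> 2"
  by (intro norm_simplex_diff_le_2 increment_simplex states_simplex)

lemma draw_prob_sum: "x \<in> states \<Longrightarrow> (\<Sum>i\<in>UNIV. draw x $ i) = 1"
  using draw_prob_states simplex_sum by blast

lemma draw_prob_nonneg: "x \<in> states \<Longrightarrow> 0 \<le> draw x $ i"
  using draw_prob_states simplex_nonneg by blast

lemma average_affine:
  assumes "x \<in> states"
  shows "(\<Sum>i\<in>UNIV. draw x $ i * (a + b * g i + c * h i))
    = a + b * (\<Sum>i\<in>UNIV. draw x $ i * g i) + c * (\<Sum>i\<in>UNIV. draw x $ i * h i)"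
proof -
  have "(\<Sum>i\<in>UNIV. draw x $ i * (a + b * g i + c * h i))
    = (\<Sum>i\<in>UNIV. draw x $ i * a + b * (draw x $ i * g i) + c * (draw x $ i * h i))"
    by (intro sum.cong) (auto simp: algebra_simps)
  then show ?thesis
    by (simp add: sum.distrib draw_prob_sum[OF assms] flip: sum_distrib_left sum_distrib_right)
qed

lemma average_const_le:
  assumes "x \<in> states" "\<And>i. h i \<le> c"
  shows "(\<Sum>i\<in>UNIV. draw x $ i * h i) \<le> c"
proof -
  have "(\<Sum>i\<in>UNIV. draw x $ i * h i) \<le> (\<Sum>i\<in>UNIV. draw x $ i * c)"
    using assms by (intro sum_mono mult_left_mono draw_prob_nonneg) auto
  then show ?thesis by (simp add: draw_prob_sum[OF assms(1)] flip: sum_distrib_right)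
qed

section \<open>Attracting fixed points\<close>

text \<open>The second summand compensates the variance of a step: its decrease from time \<open>n\<close> to time \<open>n + 1\<close>
  exceeds the \<open>4 / (N + n + 1)\<^sup>2\<close> that the noise can add to the squared distance.\<close>

definition proximity :: "real ^ 'a \<Rightarrow> nat \<Rightarrow> real ^ 'a \<Rightarrow> real" where
  "proximity q n x = (norm (x - q))\<^sup>2 + 8 / (N + real n)"

lemma proximity_measurable [measurable]: "proximity q n \<in> borel_measurable borel"
  unfolding proximity_def by measurable

lemma proximity_nonneg: "0 \<le> proximity q n x"
  using time_pos[of n] by (simp add: proximity_def)

lemma proximity_contracts:
  assumes x: "x \<in> states" and con: "norm (target x - q) \<le> 1 / 2 * norm (x - q)"
  shows "average n (proximity q (Suc n)) x \<le> (1 - (1 / 2) / (N + real n + 1)) * proximity q n x"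
proof -
  define m where "m = N + real n + 1"
  have m: "m > 1" using time_pos[of n] by (simp add: m_def)
  let ?d = "x - q" and ?p = "\<lambda>i. draw x $ i" and ?v = "\<lambda>i. inc i - x"
  let ?D = "(norm ?d)\<^sup>2"
  have sq: "(norm (step n x i - q))\<^sup>2 = ?D + (2 / m) * inner ?d (?v i) + (1 / m\<^sup>2) * (norm (?v i))\<^sup>2" for i
  proof -
    have eq: "step n x i - q = ?d + (1 / m) *\<^sub>R ?v i" by (simp add: step_def m_def)
    show ?thesis
      unfolding eq norm_add_scaleR_square by (simp add: power_divide)
  qed
  have in_le: "inner ?d (mean_field x) \<le> - ?D / 2"
  proof -
    have "inner ?d (mean_field x) = inner ?d (target x - q) - inner ?d ?d"
      by (simp add: inner_diff_right)
    also have "inner ?d (target x - q) \<le> norm ?d * (1 / 2 * norm ?d)"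
      using norm_cauchy_schwarz[of ?d "target x - q"] mult_left_mono[OF con, of "norm ?d"] by simp
    finally show ?thesis by (simp add: power2_eq_square dot_square_norm)
  qed
  have "average n (proximity q (Suc n)) x
    = (\<Sum>i\<in>UNIV. ?p i * ((?D + 8 / m) + (2 / m) * inner ?d (?v i) + (1 / m\<^sup>2) * (norm (?v i))\<^sup>2))"
    unfolding average_def proximity_def sq by (intro sum.cong) (auto simp: m_def algebra_simps)
  also have "\<dots> = (?D + 8 / m) + (2 / m) * inner ?d (mean_field x) + (1 / m\<^sup>2) * (\<Sum>i\<in>UNIV. ?p i * (norm (?v i))\<^sup>2)"
    unfolding average_affine[OF x] average_inner[OF x] ..
  also have "\<dots> \<le> (?D + 8 / m) + (2 / m) * (- ?D / 2) + (1 / m\<^sup>2) * 4"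
  proof (intro add_mono mult_left_mono order_refl in_le average_const_le[OF x])
    show "(norm (?v i))\<^sup>2 \<le> 4" for i
      using power_mono[OF increment_norm_le_2[OF x, of i], of 2] by simp
  qed (use m in auto)
  also have "\<dots> \<le> (1 - (1 / 2) / m) * (?D + 8 / (m - 1))"
  proof -
    have 1: "8 / m + 4 / m\<^sup>2 \<le> (1 - (1 / 2) / m) * (8 / (m - 1))"
    proof -
      have "(1 - (1 / 2) / m) * (8 / (m - 1)) - 8 / m = 4 / (m * (m - 1))"
        using m by (simp add: field_simps)
      moreover have "4 / m\<^sup>2 \<le> 4 / (m * (m - 1))"
        using m by (intro divide_left_mono) (auto simp: power2_eq_square)
      ultimately show ?thesis by simp
    qed
    have "0 \<le> ?D * (1 / 2 / m)" using m by simp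
    then show ?thesis using 1 by (simp add: algebra_simps)
  qed
  finally show ?thesis by (simp add: m_def proximity_def)
qed

lemma converges_while_contracting:
  assumes U [measurable]: "U \<in> sets borel"
    and con: "\<And>x. x \<in> states \<Longrightarrow> x \<in> U \<Longrightarrow> norm (target x - q) \<le> 1 / 2 * norm (x - q)"
    and q: "q \<in> prob_simplex"
  shows "AE \<omega> in M. (\<forall>n\<ge>n0. Y n \<omega> \<in> U) \<longrightarrow> (\<lambda>n. Y n \<omega>) \<longlonglongrightarrow> q"
proof -
  have "AE \<omega> in M. (\<forall>n\<ge>n0. Y n \<omega> \<in> U) \<longrightarrow> (\<lambda>n. proximity q n (Y n \<omega>)) \<longlonglongrightarrow> 0"
  proof (rule decay_while_staying[where c = "1 / 2" and b = "4 + 8 / (N + real n0)"])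
    show "average n (proximity q (Suc n)) x \<le> (1 - (1 / 2) / (N + real n + 1)) * proximity q n x"
      if "x \<in> states" "x \<in> U" for n x
      by (rule proximity_contracts[OF that(1) con[OF that]])
    show "proximity q n0 x \<le> 4 + 8 / (N + real n0)" if "x \<in> states" for x
      using power_mono[OF norm_simplex_diff_le_2[OF states_simplex[OF that] q], of 2] by (simp add: proximity_def)
  qed (auto simp: proximity_nonneg)
  then show ?thesis
  proof eventually_elim
    case (elim \<omega>)
    show ?case
    proof
      assume "\<forall>n\<ge>n0. Y n \<omega> \<in> U"
      then have p: "(\<lambda>n. proximity q n (Y n \<omega>)) \<longlonglongrightarrow> 0" using elim by blast
      have "(\<lambda>n. (norm (Y n \<omega> - q))\<^sup>2) \<longlonglongrightarrow> 0"
      proof (rule tendsto_sandwich[OF _ _ tendsto_const p])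
        show "\<forall>\<^sub>F n in sequentially. (norm (Y n \<omega> - q))\<^sup>2 \<le> proximity q n (Y n \<omega>)"
          using time_pos by (intro always_eventually) (simp add: proximity_def less_imp_le)
      qed simp
      from tendsto_real_sqrt[OF this] have "(\<lambda>n. norm (Y n \<omega> - q)) \<longlonglongrightarrow> 0" by simp
      then show "(\<lambda>n. Y n \<omega>) \<longlonglongrightarrow> q" by (simp add: tendsto_norm_zero_iff LIM_zero_iff)
    qed
  qed
qed

section \<open>Repelling fixed points\<close>

text \<open>The quadratic form expands without remainder, so the change of \<open>m V\<close> is an identity.\<close>

lemma instability_step:
  fixes S :: "'a set"
  defines "V \<equiv> \<lambda>v. inner v (reflect S v)"
  assumes x: "x \<in> states"
  shows "(N + real n + 1) * V (step n x i - q) - (N + real n) * V (x - q)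
      = V (x - q) + 2 * inner (x - q) (reflect S (inc i - x))
        + (1 / (N + real n + 1)) * V (inc i - x)"
proof -
  define m where "m = N + real n + 1"
  have m: "m > 0" using time_pos[of n] by (simp add: m_def)
  let ?v = "inc i - x"
  have "step n x i - q = (x - q) + (1 / m) *\<^sub>R ?v" by (simp add: step_def m_def)
  then have "V (step n x i - q) = V (x - q) + (2 / m) * inner (x - q) (reflect S ?v) + (1 / m\<^sup>2) * V ?v"
    unfolding V_def by (simp only: reflect_quadratic) (simp add: reflect_scale power2_eq_square)
  then have "m * V (step n x i - q) = m * V (x - q) + 2 * inner (x - q) (reflect S ?v) + (1 / m) * V ?v"
    using m by (simp add: distrib_left power2_eq_square)
  then show ?thesis by (simp add: m_def algebra_simps)
qed

text \<open>The hypotheses say that the drift expands \<open>V\<close> and \<open>m V\<close> in proportion to the squared distance to \<open>q\<close>, and that the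
  noise contributes at least \<open>c0\<close> to the mean of \<open>V\<close> everywhere in \<open>U\<close>. This last contribution is indispensable: without it a path
  could follow the stable manifold into \<open>q\<close>.\<close>

lemma repelled:
  fixes S :: "'a set" and q :: "real ^ 'a"
  defines "V \<equiv> \<lambda>v. inner v (reflect S v)"
  assumes U [measurable]: "U \<in> sets borel" and q: "q \<in> prob_simplex"
    and \<rho>: "0 < \<rho>" "\<rho> \<le> 1"
    and h1: "\<And>x. x \<in> states \<Longrightarrow> x \<in> U \<Longrightarrow> \<rho> * (norm (x - q))\<^sup>2 \<le> 2 * inner (x - q) (reflect S (mean_field x))"
    and h2: "\<And>x. x \<in> states \<Longrightarrow> x \<in> U \<Longrightarrow> \<rho> * (norm (x - q))\<^sup>2 \<le> V (x - q) + 2 * inner (x - q) (reflect S (mean_field x))"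
    and c0: "0 < c0" "c0 \<le> 1"
    and h3: "\<And>x. x \<in> states \<Longrightarrow> x \<in> U \<Longrightarrow>
      c0 \<le> (\<Sum>i\<in>UNIV. draw x $ i * V (inc i - x))"
  shows "AE \<omega> in M. \<not> (\<forall>n\<ge>n0. Y n \<omega> \<in> U)"
proof -
  have V_le: "\<bar>V v\<bar> \<le> (norm v)\<^sup>2" for v
    unfolding V_def using abs_inner_reflect_le[of v S v] by (simp add: power2_eq_square)
  have [measurable]: "V \<in> borel_measurable borel"
    unfolding V_def inner_reflect by measurable
  have dist2: "norm (x - q) \<le> 2" if "x \<in> states" for x
    by (rule norm_simplex_diff_le_2[OF states_simplex[OF that] q])
  have V4: "\<bar>V (x - q)\<bar> \<le> 4" if "x \<in> states" for x
    using V_le[of "x - q"] power_mono[OF dist2[OF that], of 2] by simp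
  have cross: "\<bar>2 * inner (x - q) (reflect S (inc i - x))\<bar> \<le> 4 * norm (x - q)"
    if "x \<in> states" for x i
    using abs_inner_reflect_le[of "x - q" S "inc i - x"]
      mult_left_mono[OF increment_norm_le_2[OF that, of i], of "norm (x - q)"] by simp
  have V_inc: "\<bar>V (inc i - x)\<bar> \<le> 4" if "x \<in> states" for x i
    using V_le[of "inc i - x"] power_mono[OF increment_norm_le_2[OF that, of i], of 2] by simp
  \<comment> \<open>First, \<open>exp (- \<epsilon> m V)\<close> with \<open>m = N + n\<close> decays. The constant 72 is the one in the bound \<open>h2b\<close> for the
    squared change of \<open>m V\<close>, so that the second-order term cancels against the drift.\<close>
  define \<epsilon> where "\<epsilon> = \<rho> / 72"
  have \<epsilon>: "0 < \<epsilon>" "\<epsilon> \<le> 1 / 72" using \<rho> by (auto simp: \<epsilon>_def)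
  define f where "f n x = exp (- \<epsilon> * ((N + real n) * V (x - q)))" for n :: nat and x
  have [measurable]: "f n \<in> borel_measurable borel" for n unfolding f_def by measurable
  obtain n1 :: nat where n1: "real n1 \<ge> 1 / c0" using real_arch_simple by blast
  define n2 where "n2 = max n0 n1"
  have A: "AE \<omega> in M. (\<forall>n\<ge>n2. Y n \<omega> \<in> U) \<longrightarrow> (\<lambda>n. f n (Y n \<omega>)) \<longlonglongrightarrow> 0"
  proof (rule decay_while_staying[where c = "\<epsilon> * c0 / 2" and b = "exp (\<epsilon> * ((N + real n2) * 4))"])
    show "0 < \<epsilon> * c0 / 2" using \<epsilon> c0 by simp
    have "\<epsilon> * c0 \<le> 1 * 1" using \<epsilon> c0 by (intro mult_mono) auto
    then show "\<epsilon> * c0 / 2 \<le> 1" by simp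
    fix n x assume n: "n2 \<le> n" and x: "x \<in> states" "x \<in> U"
    define m where "m = N + real n + 1"
    have m: "m > 1" using time_pos[of n] by (simp add: m_def)
    let ?d = "norm (x - q)" and ?p = "\<lambda>i. draw x $ i" and ?v = "\<lambda>i. inc i - x"
    define h where "h i = m * V (step n x i - q) - (N + real n) * V (x - q)" for i
    have h: "h i = V (x - q) + 2 * inner (x - q) (reflect S (?v i)) + (1 / m) * V (?v i)" for i
      unfolding h_def m_def V_def by (rule instability_step[OF x(1)])
    have mc: "1 / m \<le> c0"
    proof -
      have "1 / c0 \<le> m" using n n1 time_pos[of 0] by (simp add: m_def n2_def)
      then show ?thesis using m c0 by (simp add: field_simps)
    qed
    have hb: "\<bar>h i\<bar> \<le> 6 * ?d + 4 / m" for i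
    proof -
      have "\<bar>V (x - q)\<bar> \<le> 2 * ?d"
        using V_le[of "x - q"] mult_right_mono[OF dist2[OF x(1)], of ?d] by (simp add: power2_eq_square)
      moreover have "\<bar>(1 / m) * V (?v i)\<bar> \<le> 4 / m"
        using V_inc[OF x(1), of i] m by (simp add: abs_mult divide_right_mono)
      ultimately show ?thesis unfolding h using cross[OF x(1), of i] by linarith
    qed
    have h2b: "(h i)\<^sup>2 \<le> 72 * ?d\<^sup>2 + 32 / m\<^sup>2" for i
      using square_le_of_abs_le_sum[OF hb[of i]] by (simp add: power_mult_distrib power_divide)
    have eb: "\<bar>\<epsilon> * h i\<bar> \<le> 1" for i
    proof -
      have "4 / m \<le> 4" using m by (simp add: divide_le_eq)
      then have "\<bar>h i\<bar> \<le> 16" using hb[of i] dist2[OF x(1)] by linarith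
      then have "\<epsilon> * \<bar>h i\<bar> \<le> 1 / 72 * 16" using \<epsilon> by (intro mult_mono) auto
      then show ?thesis using \<epsilon> by (simp add: abs_mult)
    qed
    have mean: "\<rho> * ?d\<^sup>2 + c0 / m \<le> (\<Sum>i\<in>UNIV. ?p i * h i)"
    proof -
      have "(\<Sum>i\<in>UNIV. ?p i * h i) = V (x - q) + 2 * inner (x - q) (reflect S (mean_field x))
          + (1 / m) * (\<Sum>i\<in>UNIV. ?p i * V (?v i))"
        unfolding h average_affine[OF x(1)] average_inner_reflect[OF x(1)] ..
      moreover have "(1 / m) * c0 \<le> (1 / m) * (\<Sum>i\<in>UNIV. ?p i * V (?v i))"
        using h3[OF x] m by (intro mult_left_mono) auto
      ultimately show ?thesis using h2[OF x] by simp
    qed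
    have "average n (f (Suc n)) x = f n x * (\<Sum>i\<in>UNIV. ?p i * exp (- (\<epsilon> * h i)))"
    proof -
      have "f (Suc n) (step n x i) = f n x * exp (- (\<epsilon> * h i))" for i
        unfolding f_def h_def exp_add[symmetric] by (simp add: m_def algebra_simps)
      then show ?thesis unfolding average_def by (simp add: sum_distrib_left mult.left_commute)
    qed
    also have "\<dots> \<le> f n x * (1 - (\<epsilon> * c0 / 2) / m)"
    proof (rule mult_left_mono)
      have "(\<Sum>i\<in>UNIV. ?p i * exp (- (\<epsilon> * h i))) \<le> (\<Sum>i\<in>UNIV. ?p i * (1 + (- \<epsilon>) * h i + \<epsilon>\<^sup>2 * (h i)\<^sup>2))"
        using exp_minus_le_quadratic[OF eb]
        by (intro sum_mono mult_left_mono draw_prob_nonneg x) (simp add: power_mult_distrib)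
      also have "\<dots> = 1 + (- \<epsilon>) * (\<Sum>i\<in>UNIV. ?p i * h i) + \<epsilon>\<^sup>2 * (\<Sum>i\<in>UNIV. ?p i * (h i)\<^sup>2)"
        by (rule average_affine[OF x(1)])
      also have "\<dots> \<le> 1 - \<epsilon> * (\<rho> * ?d\<^sup>2 + c0 / m) + \<epsilon>\<^sup>2 * (72 * ?d\<^sup>2 + 32 / m\<^sup>2)"
      proof -
        have "\<epsilon> * (\<rho> * ?d\<^sup>2 + c0 / m) \<le> \<epsilon> * (\<Sum>i\<in>UNIV. ?p i * h i)"
          using mean \<epsilon> by (intro mult_left_mono) auto
        moreover have "\<epsilon>\<^sup>2 * (\<Sum>i\<in>UNIV. ?p i * (h i)\<^sup>2) \<le> \<epsilon>\<^sup>2 * (72 * ?d\<^sup>2 + 32 / m\<^sup>2)"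
          by (intro mult_left_mono average_const_le[OF x(1)] h2b) simp
        ultimately show ?thesis by linarith
      qed
      also have "\<dots> = 1 - \<epsilon> * (c0 / m - \<epsilon> * 32 / m\<^sup>2)"
        by (simp add: \<epsilon>_def power2_eq_square algebra_simps)
      also have "\<dots> \<le> 1 - \<epsilon> * (c0 / m / 2)"
      proof -
        have "\<epsilon> * 32 / m\<^sup>2 \<le> (1 / 2) / m\<^sup>2" using \<epsilon> by (intro divide_right_mono) auto
        also have "\<dots> = (1 / m) / m / 2" using m by (simp add: power2_eq_square)
        also have "\<dots> \<le> c0 / m / 2" using mc m by (intro divide_right_mono) auto
        finally have "c0 / m / 2 \<le> c0 / m - \<epsilon> * 32 / m\<^sup>2" by simp
        then show ?thesis using \<epsilon> by (intro diff_left_mono mult_left_mono) auto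
      qed
      finally show "(\<Sum>i\<in>UNIV. ?p i * exp (- (\<epsilon> * h i))) \<le> 1 - (\<epsilon> * c0 / 2) / m" by simp
    qed (simp add: f_def)
    finally show "average n (f (Suc n)) x \<le> (1 - \<epsilon> * c0 / 2 / (N + real n + 1)) * f n x"
      by (simp add: m_def mult.commute)
  next
    fix x assume x: "x \<in> states"
    have "(N + real n2) * - V (x - q) \<le> (N + real n2) * 4"
      using V4[OF x] time_pos[of n2] by (intro mult_left_mono) auto
    then have "\<epsilon> * ((N + real n2) * - V (x - q)) \<le> \<epsilon> * ((N + real n2) * 4)"
      by (rule mult_left_mono) (use \<epsilon> in simp)
    then show "f n2 x \<le> exp (\<epsilon> * ((N + real n2) * 4))"
      by (simp add: f_def)
  qed (auto simp: f_def)
  \<comment> \<open>Once \<open>m V\<close> is large, the reciprocal of \<open>V\<close> decays: the steps are then small compared to \<open>V\<close>, so that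
    the second-order term of the reciprocal is dominated by the drift.\<close>
  \<comment> \<open>The first bound keeps a change of \<open>V\<close> below \<open>V / 2\<close>, the other two let the drift and the noise dominate
    the second-order term.\<close>
  define K where "K = max 24 (max (128 / \<rho>) (64 / c0))"
  have K: "24 \<le> K" "128 / \<rho> \<le> K" "64 / c0 \<le> K" by (auto simp: K_def)
  define g where "g x = (if 0 < V (x - q) then 1 / V (x - q) else 0)" for x
  have [measurable]: "g \<in> borel_measurable borel" unfolding g_def by measurable
  define U' where "U' n = {x \<in> U. K \<le> (N + real n) * V (x - q)}" for n :: nat
  have U'M [measurable]: "U' n \<in> sets borel" for n
  proof -
    have "{x. K \<le> (N + real n) * V (x - q)} \<in> sets borel" by measurable
    from sets.Int[OF U this] show ?thesis by (simp add: U'_def Int_def)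
  qed
  have Vpos: "0 < V (x - q)" if "x \<in> U' n" for x n
  proof -
    have "0 < (N + real n) * V (x - q)" using that K by (auto simp: U'_def)
    then show ?thesis using time_pos[of n] by (simp add: zero_less_mult_iff)
  qed
  have B: "AE \<omega> in M. (\<forall>n\<ge>n3. Y n \<omega> \<in> U' n) \<longrightarrow> (\<lambda>n. g (Y n \<omega>)) \<longlonglongrightarrow> 0" for n3
  proof (rule decay_while_staying[where c = "\<rho> / 2" and b = "(N + real n3) / K"])
    show "0 < \<rho> / 2" "\<rho> / 2 \<le> 1" using \<rho> by auto
    fix n x assume n: "n3 \<le> n" and x: "x \<in> states" and xU': "x \<in> U' n"
    have xU: "x \<in> U" using xU' by (simp add: U'_def)
    define m where "m = N + real n + 1"
    have m: "m > 1" using time_pos[of n] by (simp add: m_def)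
    define v where "v = V (x - q)"
    have v: "v > 0" using Vpos[OF xU'] by (simp add: v_def)
    have Kv: "K / m \<le> v"
    proof -
      have "K \<le> (N + real n) * v" using xU' by (simp add: U'_def v_def)
      also have "\<dots> \<le> m * v" using v by (simp add: m_def)
      finally show ?thesis using m by (simp add: divide_le_eq mult.commute)
    qed
    let ?d = "norm (x - q)" and ?p = "\<lambda>i. draw x $ i" and ?w = "\<lambda>i. inc i - x"
    define h where "h i = V (step n x i - q) - v" for i
    have h: "h i = 0 + (1 / m) * (2 * inner (x - q) (reflect S (?w i))) + (1 / m\<^sup>2) * V (?w i)" for i
    proof -
      have "m * V (step n x i - q) - (m - 1) * v = v + 2 * inner (x - q) (reflect S (?w i)) + (1 / m) * V (?w i)"
        using instability_step[OF x, where n = n and i = i and q = q and S = S] by (simp add: m_def V_def v_def)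
      then have "m * h i = 2 * inner (x - q) (reflect S (?w i)) + (1 / m) * V (?w i)"
        by (simp add: h_def algebra_simps)
      then have "(1 / m) * (m * h i) = (1 / m) * (2 * inner (x - q) (reflect S (?w i)) + (1 / m) * V (?w i))" by simp
      then show ?thesis using m by (simp add: distrib_left power2_eq_square)
    qed
    have hb: "\<bar>h i\<bar> \<le> 4 * ?d / m + 4 / m\<^sup>2" for i
    proof -
      have "\<bar>(1 / m) * (2 * inner (x - q) (reflect S (?w i)))\<bar> \<le> (1 / m) * (4 * ?d)"
        unfolding abs_mult[of "1 / m"] using cross[OF x, of i] m by (intro mult_mono) auto
      moreover have "\<bar>(1 / m\<^sup>2) * V (?w i)\<bar> \<le> (1 / m\<^sup>2) * 4"
        unfolding abs_mult[of "1 / m\<^sup>2"] using V_inc[OF x, of i] m by (intro mult_mono) auto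
      moreover have "4 * ?d / m = (1 / m) * (4 * ?d)" "4 / m\<^sup>2 = (1 / m\<^sup>2) * 4" by simp_all
      ultimately show ?thesis unfolding h by linarith
    qed
    have h2b: "(h i)\<^sup>2 \<le> (32 * ?d\<^sup>2 + 32 / m\<^sup>2) / m\<^sup>2" for i
      using square_le_of_abs_le_sum[OF hb[of i]]
      by (simp add: power_mult_distrib power_divide add_divide_distrib power_mult[symmetric] power2_eq_square[of "m\<^sup>2"])
    have half: "\<bar>h i\<bar> \<le> v / 2" for i
    proof -
      have "4 / m\<^sup>2 \<le> 4 / m" using m by (intro divide_left_mono) (auto simp: power2_eq_square)
      moreover have "4 * ?d / m \<le> 8 / m" using dist2[OF x] m by (intro divide_right_mono) auto
      moreover have "24 / m \<le> K / m" using K m by (intro divide_right_mono) auto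
      ultimately show ?thesis using hb[of i] Kv by simp
    qed
    have mean: "(\<rho> * ?d\<^sup>2 + c0 / m) / m \<le> (\<Sum>i\<in>UNIV. ?p i * h i)"
    proof -
      have "(\<Sum>i\<in>UNIV. ?p i * h i) = (1 / m) * (\<Sum>i\<in>UNIV. ?p i * (2 * inner (x - q) (reflect S (?w i))))
          + (1 / m\<^sup>2) * (\<Sum>i\<in>UNIV. ?p i * V (?w i))"
        unfolding h average_affine[OF x] by simp
      also have "(\<Sum>i\<in>UNIV. ?p i * (2 * inner (x - q) (reflect S (?w i)))) = 2 * inner (x - q) (reflect S (mean_field x))"
        unfolding average_inner_reflect[OF x, symmetric] by (simp add: sum_distrib_left mult.left_commute)
      finally have eq: "(\<Sum>i\<in>UNIV. ?p i * h i) = (1 / m) * (2 * inner (x - q) (reflect S (mean_field x)))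
          + (1 / m\<^sup>2) * (\<Sum>i\<in>UNIV. ?p i * V (?w i))" .
      have "(1 / m) * (\<rho> * ?d\<^sup>2) \<le> (1 / m) * (2 * inner (x - q) (reflect S (mean_field x)))"
        using h1[OF x xU] m by (intro mult_left_mono) auto
      moreover have "(1 / m\<^sup>2) * c0 \<le> (1 / m\<^sup>2) * (\<Sum>i\<in>UNIV. ?p i * V (?w i))"
        using h3[OF x xU] m by (intro mult_left_mono) auto
      ultimately show ?thesis unfolding eq by (simp add: add_divide_distrib power2_eq_square)
    qed
    have "average n g x = (\<Sum>i\<in>UNIV. ?p i * (1 / (v + h i)))"
    proof -
      have "g (step n x i) = 1 / (v + h i)" for i
      proof -
        have "v + h i > 0" using half[of i] v by (auto simp: abs_le_iff)
        moreover have "V (step n x i - q) = v + h i" by (simp add: h_def)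
        ultimately show ?thesis by (simp add: g_def)
      qed
      then show ?thesis by (simp add: average_def)
    qed
    also have "\<dots> \<le> (\<Sum>i\<in>UNIV. ?p i * (1 / v + (- 1 / v\<^sup>2) * h i + (2 / v ^ 3) * (h i)\<^sup>2))"
      using inverse_le_quadratic[OF v half]
      by (intro sum_mono mult_left_mono draw_prob_nonneg x) simp
    also have "\<dots> = 1 / v + (- 1 / v\<^sup>2) * (\<Sum>i\<in>UNIV. ?p i * h i) + (2 / v ^ 3) * (\<Sum>i\<in>UNIV. ?p i * (h i)\<^sup>2)"
      by (rule average_affine[OF x])
    also have "\<dots> \<le> 1 / v - (1 / v\<^sup>2) * ((\<rho> * ?d\<^sup>2 + c0 / m) / m) + (2 / v ^ 3) * ((32 * ?d\<^sup>2 + 32 / m\<^sup>2) / m\<^sup>2)"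
    proof -
      have "(1 / v\<^sup>2) * ((\<rho> * ?d\<^sup>2 + c0 / m) / m) \<le> (1 / v\<^sup>2) * (\<Sum>i\<in>UNIV. ?p i * h i)"
        using mean by (intro mult_left_mono) auto
      moreover have "(2 / v ^ 3) * (\<Sum>i\<in>UNIV. ?p i * (h i)\<^sup>2) \<le> (2 / v ^ 3) * ((32 * ?d\<^sup>2 + 32 / m\<^sup>2) / m\<^sup>2)"
        using v by (intro mult_left_mono average_const_le[OF x] h2b) simp
      ultimately show ?thesis by simp
    qed
    also have "(2 / v ^ 3) * ((32 * ?d\<^sup>2 + 32 / m\<^sup>2) / m\<^sup>2) \<le> (1 / v\<^sup>2) * ((\<rho> / 2 * ?d\<^sup>2 + c0 / m) / m)"
    proof -
      have i: "1 / (v * m) \<le> 1 / K"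
      proof -
        have "K \<le> v * m" using Kv m by (simp add: divide_le_eq)
        then show ?thesis using K v m by (intro divide_left_mono) auto
      qed
      have "(2 / v ^ 3) * ((32 * ?d\<^sup>2 + 32 / m\<^sup>2) / m\<^sup>2)
          = (1 / v\<^sup>2) * (((64 * ?d\<^sup>2 + 64 / m\<^sup>2) * (1 / (v * m))) / m)"
        by (simp add: power2_eq_square power3_eq_cube add_divide_distrib algebra_simps)
      also have "\<dots> \<le> (1 / v\<^sup>2) * (((64 * ?d\<^sup>2 + 64 / m\<^sup>2) * (1 / K)) / m)"
        using i v m by (intro mult_left_mono divide_right_mono) auto
      also have "\<dots> \<le> (1 / v\<^sup>2) * ((\<rho> / 2 * ?d\<^sup>2 + c0 / m) / m)"
      proof -
        have "64 / K \<le> \<rho> / 2" using K \<rho> by (simp add: field_simps)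
        from mult_right_mono[OF this, of "?d\<^sup>2"] have 1: "64 * ?d\<^sup>2 / K \<le> \<rho> / 2 * ?d\<^sup>2" by simp
        have "64 / K \<le> c0" using K c0 by (simp add: field_simps)
        moreover have "1 / m\<^sup>2 \<le> 1 / m" using m by (intro divide_left_mono) (auto simp: power2_eq_square)
        ultimately have 2: "64 / K * (1 / m\<^sup>2) \<le> c0 * (1 / m)" using c0 by (intro mult_mono) auto
        have 3: "(64 * ?d\<^sup>2 + 64 / m\<^sup>2) * (1 / K) = 64 * ?d\<^sup>2 / K + 64 / K * (1 / m\<^sup>2)" "c0 / m = c0 * (1 / m)"
          by (simp_all add: add_divide_distrib)
        have "(64 * ?d\<^sup>2 + 64 / m\<^sup>2) * (1 / K) \<le> \<rho> / 2 * ?d\<^sup>2 + c0 / m"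
          unfolding 3 using 1 2 by (rule add_mono)
        then show ?thesis using v m by (intro mult_left_mono divide_right_mono) auto
      qed
      finally show ?thesis .
    qed
    also have "1 / v - (1 / v\<^sup>2) * ((\<rho> * ?d\<^sup>2 + c0 / m) / m) + (1 / v\<^sup>2) * ((\<rho> / 2 * ?d\<^sup>2 + c0 / m) / m)
        = 1 / v - (\<rho> / 2 / m) * (?d\<^sup>2 / v\<^sup>2)"
      using v m by (simp add: field_simps)
    also have "\<dots> \<le> 1 / v - (\<rho> / 2 / m) * (1 / v)"
    proof -
      have "v \<le> ?d\<^sup>2" using V_le[of "x - q"] v by (simp add: v_def)
      then have "v / v\<^sup>2 \<le> ?d\<^sup>2 / v\<^sup>2" by (rule divide_right_mono) simp
      then have "1 / v \<le> ?d\<^sup>2 / v\<^sup>2" using v by (simp add: power2_eq_square)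
      then show ?thesis using \<rho> m by (intro diff_left_mono mult_left_mono) auto
    qed
    finally show "average n g x \<le> (1 - \<rho> / 2 / (N + real n + 1)) * g x"
      using v by (simp add: g_def v_def m_def algebra_simps)
  next
    fix x assume x: "x \<in> states" "x \<in> U' n3"
    have "K \<le> (N + real n3) * V (x - q)" using x by (simp add: U'_def)
    then show "g x \<le> (N + real n3) / K"
      using Vpos[OF x(2)] K by (simp add: g_def field_simps)
  qed (auto simp: g_def)
  have B': "AE \<omega> in M. \<forall>n3. \<not> (\<forall>n\<ge>n3. Y n \<omega> \<in> U' n)"
  proof -
    have "AE \<omega> in M. \<not> (\<forall>n\<ge>n3. Y n \<omega> \<in> U' n)" for n3
      using B[of n3] AE_states
    proof eventually_elim
      case (elim \<omega>)
      show ?case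
      proof
        assume stay: "\<forall>n\<ge>n3. Y n \<omega> \<in> U' n"
        then have "(\<lambda>n. g (Y n \<omega>)) \<longlonglongrightarrow> 0" using elim by blast
        from order_tendstoD(2)[OF this, of "1 / 4"] obtain k where k: "\<And>n. n \<ge> k \<Longrightarrow> g (Y n \<omega>) < 1 / 4"
          by (auto simp: eventually_sequentially)
        define n where "n = max k n3"
        have "Y n \<omega> \<in> U' n" using stay by (simp add: n_def)
        then have "0 < V (Y n \<omega> - q)" by (rule Vpos)
        moreover have "V (Y n \<omega> - q) \<le> 4" using V4[of "Y n \<omega>"] elim by simp
        ultimately have "1 / 4 \<le> g (Y n \<omega>)" by (simp add: g_def field_simps)
        then show False using k[of n] by (simp add: n_def)
      qed
    qed
    then show ?thesis by (simp add: AE_all_countable)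
  qed
  show ?thesis
    using A B'
  proof eventually_elim
    case (elim \<omega>)
    show ?case
    proof
      assume "\<forall>n\<ge>n0. Y n \<omega> \<in> U"
      then have stay: "\<And>n. n \<ge> n2 \<Longrightarrow> Y n \<omega> \<in> U" by (simp add: n2_def)
      then have "(\<lambda>n. f n (Y n \<omega>)) \<longlonglongrightarrow> 0" using elim(1) by blast
      from order_tendstoD(2)[OF this, of "exp (- \<epsilon> * K)"] obtain k where k: "\<And>n. n \<ge> k \<Longrightarrow> f n (Y n \<omega>) < exp (- \<epsilon> * K)"
        by (auto simp: eventually_sequentially)
      have "Y n \<omega> \<in> U' n" if "n \<ge> max k n2" for n
      proof -
        have "f n (Y n \<omega>) < exp (- \<epsilon> * K)" using k[of n] that by simp
        then have "\<epsilon> * K < \<epsilon> * ((N + real n) * V (Y n \<omega> - q))" by (simp add: f_def)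
        then have "K \<le> (N + real n) * V (Y n \<omega> - q)" using \<epsilon> by simp
        then show ?thesis using stay[of n] that by (simp add: U'_def)
      qed
      then show False using elim(2) by blast
    qed
  qed
qed

end

section \<open>The drift vanishes along almost every path\<close>

lemma powr_above_tangent:
  fixes x y :: real
  assumes x: "0 < x" and y: "0 < y" and \<beta>: "\<beta> > 1"
  shows "x powr \<beta> + \<beta> * x powr (\<beta> - 1) * (y - x) \<le> y powr \<beta>"
proof -
  obtain z where z: "min x y \<le> z" "z \<le> max x y" "y powr \<beta> - x powr \<beta> = \<beta> * z powr (\<beta> - 1) * (y - x)"
    using powr_mean_value[of x y \<beta>] assms by auto
  have "x powr (\<beta> - 1) * (y - x) \<le> z powr (\<beta> - 1) * (y - x)"
  proof (cases "x \<le> y")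
    case True
    then show ?thesis using z x \<beta> by (intro mult_right_mono powr_mono2) auto
  next
    case False
    then show ?thesis using z y \<beta> by (intro mult_right_mono_neg powr_mono2) auto
  qed
  then have "\<beta> * (x powr (\<beta> - 1) * (y - x)) \<le> \<beta> * (z powr (\<beta> - 1) * (y - x))"
    using \<beta> by (intro mult_left_mono) auto
  then show ?thesis using z(3) by (simp add: mult.assoc)
qed

lemma ln_one_plus_ge:
  fixes t :: real
  assumes "\<bar>t\<bar> \<le> 1 / 2"
  shows "t - 2 * t\<^sup>2 \<le> ln (1 + t)"
  using abs_ln_one_plus_x_minus_x_bound[OF assms] by linarith

context power_urn
begin

text \<open>On the simplex this is a potential of the mean field: its gradient is \<open>1 + G\<^sub>i / x\<^sub>i\<close> in the \<open>i\<close>-th coordinate, and the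
  constant 1 is orthogonal to all differences of shares.\<close>

definition lyapunov :: "real ^ 'a \<Rightarrow> real" where
  "lyapunov x = (1 - r) / \<beta> * ln (weight \<beta> x) + (\<Sum>i\<in>UNIV. r * \<gamma> $ i * ln (x $ i))"

lemma lyapunov_measurable [measurable]: "lyapunov \<in> borel_measurable borel"
  unfolding lyapunov_def by measurable

lemma feedback_coordinates_bounded_below:
  obtains c where "0 < c" "c \<le> 1" "\<And>x i. x \<in> states \<Longrightarrow> 0 < r * \<gamma> $ i \<Longrightarrow> c \<le> x $ i"
proof -
  define A where "A = insert 1 ((\<lambda>i. min (x0 $ i / N) (r * \<gamma> $ i)) ` {i. 0 < r * \<gamma> $ i})"
  have A: "finite A" "A \<noteq> {}" by (auto simp: A_def)
  have "0 < x0 $ i / N" for i using x0[of i] N_ge_1 by simp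
  then have "\<forall>a\<in>A. 0 < a" by (auto simp: A_def)
  then have 1: "0 < Min A" using A by simp
  have 2: "Min A \<le> 1" using A by (intro Min_le) (auto simp: A_def)
  show ?thesis
  proof (rule that[OF 1 2])
    fix x i assume x: "x \<in> states" and i: "0 < r * \<gamma> $ i"
    have "Min A \<le> min (x0 $ i / N) (r * \<gamma> $ i)" using A i by (intro Min_le) (auto simp: A_def)
    also have "\<dots> \<le> x $ i" using x by (simp add: states_def)
    finally show "Min A \<le> x $ i" .
  qed
qed

lemma feedback_nonneg: "0 \<le> r * \<gamma> $ i"
  using r simplex_nonneg[OF \<gamma>, of i] by simp

lemma lyapunov_bounded:
  obtains b where "\<And>x. x \<in> states \<Longrightarrow> \<bar>lyapunov x\<bar> \<le> b"
proof -
  obtain c where c: "0 < c" "c \<le> 1" "\<And>x i. x \<in> states \<Longrightarrow> 0 < r * \<gamma> $ i \<Longrightarrow> c \<le> x $ i"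
    using feedback_coordinates_bounded_below by blast
  define w where "w = (1 / CARD('a)) powr \<beta>"
  have w: "0 < w" by (simp add: w_def)
  define b where "b = (1 - r) / \<beta> * (\<bar>ln w\<bar> + ln CARD('a)) + (\<Sum>i\<in>UNIV. r * \<gamma> $ i * \<bar>ln c\<bar>)"
  have card: "1 \<le> real CARD('a)" by (simp add: Suc_le_eq)
  show ?thesis
  proof (rule that[of b])
    fix x assume x: "x \<in> states"
    note xs = states_simplex[OF x]
    have W: "w \<le> weight \<beta> x" using weight_lower[OF xs, of \<beta>] \<beta> by (simp add: w_def)
    have "weight \<beta> x \<le> (\<Sum>i\<in>(UNIV::'a set). 1)"
      unfolding weight_def using \<beta> simplex_nonneg[OF xs] simplex_le_1[OF xs]
      by (intro sum_mono powr_le1) auto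
    then have "weight \<beta> x \<le> CARD('a)" by simp
    then have "ln w \<le> ln (weight \<beta> x)" "ln (weight \<beta> x) \<le> ln CARD('a)"
      using W w by (auto simp: ln_le_cancel_iff)
    then have "\<bar>ln (weight \<beta> x)\<bar> \<le> \<bar>ln w\<bar> + ln CARD('a)" using ln_ge_zero[OF card] by linarith
    then have 1: "\<bar>(1 - r) / \<beta> * ln (weight \<beta> x)\<bar> \<le> (1 - r) / \<beta> * (\<bar>ln w\<bar> + ln CARD('a))"
      unfolding abs_mult using r \<beta> by (intro mult_mono) auto
    have "\<bar>\<Sum>i\<in>UNIV. r * \<gamma> $ i * ln (x $ i)\<bar> \<le> (\<Sum>i\<in>UNIV. r * \<gamma> $ i * \<bar>ln c\<bar>)"
    proof (rule order_trans[OF sum_abs sum_mono])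
      fix i
      show "\<bar>r * \<gamma> $ i * ln (x $ i)\<bar> \<le> r * \<gamma> $ i * \<bar>ln c\<bar>"
      proof (cases "r * \<gamma> $ i = 0")
        case False
        then have p: "0 < r * \<gamma> $ i" using feedback_nonneg[of i] by linarith
        have "ln c \<le> ln (x $ i)" "ln (x $ i) \<le> 0"
          using c(3)[OF x p] c(1) simplex_le_1[OF xs, of i] by (auto simp: ln_le_cancel_iff)
        then have "\<bar>ln (x $ i)\<bar> \<le> \<bar>ln c\<bar>" by linarith
        then show ?thesis unfolding abs_mult[of "r * \<gamma> $ i"] using p by (intro mult_mono) auto
      qed auto
    qed
    then show "\<bar>lyapunov x\<bar> \<le> b" unfolding lyapunov_def b_def using 1 by linarith
  qed
qed

text \<open>The sum on the right is the derivative of \<^const>\<open>lyapunov\<close> along the mean field, which equals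
  \<open>\<Sum>\<^sub>i G\<^sub>i\<^sup>2 / x\<^sub>i\<close>.\<close>

lemma gradient_drift:
  assumes x: "x \<in> states"
  shows "(norm (mean_field x))\<^sup>2 \<le> (\<Sum>i\<in>UNIV. target x $ i / x $ i * mean_field x $ i)"
proof -
  note xs = states_simplex[OF x]
  have xp: "0 < x $ i" for i using x by (simp add: states_def)
  have s: "(\<Sum>i\<in>UNIV. mean_field x $ i) = 0"
    using simplex_sum[OF xs] simplex_sum[OF mean_increment_simplex[OF xs]] by (simp add: sum_subtractf)
  have "(norm (mean_field x))\<^sup>2 = (\<Sum>i\<in>UNIV. (mean_field x $ i)\<^sup>2)"
    unfolding power2_norm_eq_inner inner_vec_def inner_real_def by (simp only: power2_eq_square)
  also have "\<dots> \<le> (\<Sum>i\<in>UNIV. (mean_field x $ i)\<^sup>2 / x $ i)"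
  proof (rule sum_mono)
    fix i
    have "(mean_field x $ i)\<^sup>2 / 1 \<le> (mean_field x $ i)\<^sup>2 / x $ i"
      using xp[of i] simplex_le_1[OF xs, of i] by (intro divide_left_mono) auto
    then show "(mean_field x $ i)\<^sup>2 \<le> (mean_field x $ i)\<^sup>2 / x $ i" by simp
  qed
  also have "\<dots> = (\<Sum>i\<in>UNIV. target x $ i / x $ i * mean_field x $ i - mean_field x $ i)"
  proof (intro sum.cong refl)
    fix i
    have "target x $ i = mean_field x $ i + x $ i" by simp
    then have "target x $ i / x $ i = mean_field x $ i / x $ i + 1"
      using xp[of i] by (simp add: add_divide_distrib del: vector_minus_component)
    then show "(mean_field x $ i)\<^sup>2 / x $ i = target x $ i / x $ i * mean_field x $ i - mean_field x $ i"
      by (simp add: power2_eq_square distrib_right del: vector_minus_component)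
  qed
  also have "\<dots> = (\<Sum>i\<in>UNIV. target x $ i / x $ i * mean_field x $ i)"
    unfolding sum_subtractf[of _ "\<lambda>i. mean_field x $ i"] s by simp
  finally show ?thesis .
qed

text \<open>A first-order lower bound with an error of order \<open>1 / m\<^sup>2\<close>. The power sum is bounded below by its tangent, by
  convexity, so the unbounded second derivative of \<open>t powr \<beta>\<close> at 0 for \<open>\<beta> < 2\<close> does no harm; the logarithms are
  expanded at points bounded away from 0.\<close>

lemma lyapunov_step:
  obtains C n1 where "0 \<le> C" "\<And>n x i. n \<ge> n1 \<Longrightarrow> x \<in> states \<Longrightarrow>
    lyapunov x + (1 / (N + real n + 1)) * inner (\<chi> j. target x $ j / x $ j) (inc i - x)
      - C / (N + real n + 1)\<^sup>2 \<le> lyapunov (step n x i)"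
proof -
  obtain c where c: "0 < c" "c \<le> 1" "\<And>x i. x \<in> states \<Longrightarrow> 0 < r * \<gamma> $ i \<Longrightarrow> c \<le> x $ i"
    using feedback_coordinates_bounded_below by blast
  define w where "w = (1 / CARD('a)) powr \<beta>"
  have w: "0 < w" by (simp add: w_def)
  \<comment> \<open>Up to the factor \<open>1 / m\<close>, the relative changes of the power sum and of a share with positive wage are
    at most \<open>C1\<close> and \<open>1 / c\<close>.\<close>
  define C1 where "C1 = \<beta> * CARD('a) / w"
  have C1: "0 \<le> C1" using w \<beta> by (simp add: C1_def)
  define C where "C = (1 - r) / \<beta> * (2 * C1\<^sup>2) + (\<Sum>i\<in>UNIV. r * \<gamma> $ i * (2 * (1 / c)\<^sup>2))"
  obtain n1 :: nat where n1: "2 * C1 + 2 * (1 / c) \<le> real n1" using real_arch_simple by blast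
  show ?thesis
  proof (rule that[of C n1])
    show "0 \<le> C" unfolding C_def using r \<beta> simplex_nonneg[OF \<gamma>]
      by (intro add_nonneg_nonneg sum_nonneg mult_nonneg_nonneg) auto
    fix n x k assume n: "n \<ge> n1" and x: "x \<in> states"
    define m where "m = N + real n + 1"
    have "0 \<le> 1 / c" "real n1 \<le> real n" using n c(1) by auto
    then have m: "0 < m" "2 * C1 \<le> m" "2 * (1 / c) \<le> m"
      using n1 time_pos[of n] N_ge_1 C1 unfolding m_def by linarith+
    note xs = states_simplex[OF x]
    let ?v = "inc k - x" and ?y = "step n x k"
    have y: "?y \<in> states" by (rule step_states[OF x])
    have xp: "0 < x $ i" for i using x by (simp add: states_def)
    have yp: "0 < ?y $ i" for i using y by (simp add: states_def)
    have v1: "\<bar>?v $ i\<bar> \<le> 1" for i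
      using simplex_nonneg[OF xs, of i] simplex_le_1[OF xs, of i]
        simplex_nonneg[OF increment_simplex[of k], of i] simplex_le_1[OF increment_simplex[of k], of i] by simp
    have yx: "?y $ i - x $ i = ?v $ i / m" for i by (simp add: step_def m_def)
    define W where "W = weight \<beta> x"
    have W: "w \<le> W" "0 < W"
      using weight_lower[OF xs, of \<beta>] weight_pos[OF xs, of \<beta>] \<beta> by (auto simp: w_def W_def)
    define t where "t = (\<Sum>i\<in>UNIV. \<beta> * x $ i powr (\<beta> - 1) * (?v $ i / m)) / W"
    have t: "\<bar>t\<bar> \<le> C1 / m"
    proof -
      have "\<bar>\<Sum>i\<in>UNIV. \<beta> * x $ i powr (\<beta> - 1) * (?v $ i / m)\<bar> \<le> (\<Sum>i\<in>(UNIV::'a set). \<beta> / m)"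
      proof (rule order_trans[OF sum_abs sum_mono])
        fix i
        have "\<beta> * x $ i powr (\<beta> - 1) * \<bar>?v $ i / m\<bar> \<le> \<beta> * 1 * (1 / m)"
          using \<beta> v1[of i] m simplex_nonneg[OF xs, of i] simplex_le_1[OF xs, of i]
          by (intro mult_mono powr_le1) (auto simp: abs_divide divide_right_mono)
        then show "\<bar>\<beta> * x $ i powr (\<beta> - 1) * (?v $ i / m)\<bar> \<le> \<beta> / m"
          using \<beta> by (simp add: abs_mult)
      qed
      moreover have "(\<Sum>i\<in>(UNIV::'a set). \<beta> / m) = \<beta> * CARD('a) / m" by simp
      ultimately have "\<bar>\<Sum>i\<in>UNIV. \<beta> * x $ i powr (\<beta> - 1) * (?v $ i / m)\<bar> / \<bar>W\<bar> \<le> (\<beta> * CARD('a) / m) / \<bar>W\<bar>"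
        by (intro divide_right_mono) (simp only:, simp)
      then have "\<bar>t\<bar> \<le> (\<beta> * CARD('a) / m) / W"
        unfolding t_def abs_divide using W by simp
      also have "\<dots> \<le> (\<beta> * CARD('a) / m) / w"
        using W w \<beta> m by (intro divide_left_mono) auto
      also have "\<dots> = C1 / m" by (simp add: C1_def mult.commute)
      finally show ?thesis .
    qed
    have t2: "\<bar>t\<bar> \<le> 1 / 2"
    proof -
      have "C1 / m \<le> 1 / 2" using m by (simp add: divide_le_eq)
      then show ?thesis using t by linarith
    qed
    have tsq: "t\<^sup>2 \<le> C1\<^sup>2 / m\<^sup>2" using power_mono[OF t, of 2] by (simp add: power_divide)
    have LW: "ln W + t - 2 * (C1\<^sup>2 / m\<^sup>2) \<le> ln (weight \<beta> ?y)"
    proof -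
      have "W * (1 + t) = (\<Sum>i\<in>UNIV. x $ i powr \<beta> + \<beta> * x $ i powr (\<beta> - 1) * (?y $ i - x $ i))"
        using W unfolding yx by (simp add: t_def W_def weight_def sum.distrib distrib_left)
      also have "\<dots> \<le> weight \<beta> ?y"
        unfolding weight_def by (intro sum_mono powr_above_tangent xp yp \<beta>)
      finally have "W * (1 + t) \<le> weight \<beta> ?y" .
      moreover have "0 < W * (1 + t)" using W t2 by (intro mult_pos_pos) auto
      ultimately have "ln (W * (1 + t)) \<le> ln (weight \<beta> ?y)" by (simp add: ln_le_cancel_iff)
      moreover have "ln (W * (1 + t)) = ln W + ln (1 + t)" using W t2 by (intro ln_mult_pos) auto
      moreover have "t - 2 * t\<^sup>2 \<le> ln (1 + t)" by (rule ln_one_plus_ge[OF t2])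
      ultimately show ?thesis using tsq by linarith
    qed
    have Lx: "r * \<gamma> $ i * ln (x $ i) + r * \<gamma> $ i * (?v $ i / m / x $ i) - r * \<gamma> $ i * (2 * ((1 / c)\<^sup>2 / m\<^sup>2))
        \<le> r * \<gamma> $ i * ln (?y $ i)" for i
    proof (cases "r * \<gamma> $ i = 0")
      case False
      then have p: "0 < r * \<gamma> $ i" using feedback_nonneg[of i] by linarith
      have cx: "c \<le> x $ i" by (rule c(3)[OF x p])
      define s where "s = ?v $ i / m / x $ i"
      have s: "\<bar>s\<bar> \<le> (1 / c) / m"
      proof -
        have "\<bar>s\<bar> = \<bar>?v $ i\<bar> / m / x $ i" using m xp[of i] by (simp add: s_def abs_divide del: vector_minus_component)
        also have "\<dots> \<le> 1 / m / x $ i" using v1[of i] m xp[of i] by (intro divide_right_mono) auto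
        also have "\<dots> \<le> 1 / m / c" using cx c(1) m by (intro divide_left_mono) auto
        finally show ?thesis by (simp add: mult.commute)
      qed
      have s2: "\<bar>s\<bar> \<le> 1 / 2"
      proof -
        have "(1 / c) / m \<le> 1 / 2" unfolding pos_divide_le_eq[OF m(1)] using m(3) by linarith
        then show ?thesis using s by linarith
      qed
      have "?y $ i = x $ i * (1 + s)" using yx[of i] xp[of i] by (simp add: s_def distrib_left)
      then have "ln (?y $ i) = ln (x $ i) + ln (1 + s)"
        using ln_mult_pos[of "x $ i" "1 + s"] xp[of i] s2 by simp
      moreover have "s - 2 * s\<^sup>2 \<le> ln (1 + s)" by (rule ln_one_plus_ge[OF s2])
      moreover have "s\<^sup>2 \<le> (1 / c)\<^sup>2 / m\<^sup>2" using power_mono[OF s, of 2] by (simp add: power_divide power_mult_distrib)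
      ultimately have "ln (x $ i) + s - 2 * ((1 / c)\<^sup>2 / m\<^sup>2) \<le> ln (?y $ i)" by linarith
      from mult_left_mono[OF this feedback_nonneg[of i]] show ?thesis
        by (simp only: s_def[symmetric] right_diff_distrib distrib_left)
    qed auto
    have lin: "(1 / m) * inner (\<chi> j. target x $ j / x $ j) ?v
        = (1 - r) / \<beta> * t + (\<Sum>i\<in>UNIV. r * \<gamma> $ i * (?v $ i / m / x $ i))"
    proof -
      have "(1 - r) / \<beta> * t = (\<Sum>i\<in>UNIV. (1 - r) * (x $ i powr (\<beta> - 1) / W) * (?v $ i / m))"
        unfolding t_def sum_divide_distrib sum_distrib_left using \<beta> by (intro sum.cong) (auto simp: mult.commute mult.left_commute)
      also have "\<dots> = (\<Sum>i\<in>UNIV. (1 - r) * (draw x $ i / x $ i) * (?v $ i / m))"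
      proof (intro sum.cong refl)
        fix i
        have "x $ i powr (\<beta> - 1) / W = draw x $ i / x $ i"
          using xp[of i] by (simp add: draw_prob_nth W_def powr_diff)
        then show "(1 - r) * (x $ i powr (\<beta> - 1) / W) * (?v $ i / m) = (1 - r) * (draw x $ i / x $ i) * (?v $ i / m)"
          by simp
      qed
      finally have "(1 - r) / \<beta> * t + (\<Sum>i\<in>UNIV. r * \<gamma> $ i * (?v $ i / m / x $ i))
        = (\<Sum>i\<in>UNIV. (1 - r) * (draw x $ i / x $ i) * (?v $ i / m) + r * \<gamma> $ i * (?v $ i / m / x $ i))"
        by (simp only: sum.distrib)
      also have "\<dots> = (\<Sum>i\<in>UNIV. (1 / m) * ((target x $ i / x $ i) * ?v $ i))"
        by (intro sum.cong refl) (simp add: mean_increment_nth add_divide_distrib distrib_right del: vector_minus_component)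
      finally show ?thesis by (simp add: inner_vec_def sum_distrib_left del: vector_minus_component)
    qed
    have 1: "(1 - r) / \<beta> * ln W + (1 - r) / \<beta> * t - (1 - r) / \<beta> * (2 * (C1\<^sup>2 / m\<^sup>2)) \<le> (1 - r) / \<beta> * ln (weight \<beta> ?y)"
    proof -
      have "0 \<le> (1 - r) / \<beta>" using r \<beta> by simp
      from mult_left_mono[OF LW this] show ?thesis by (simp only: right_diff_distrib distrib_left)
    qed
    have 2: "(\<Sum>i\<in>UNIV. r * \<gamma> $ i * ln (x $ i)) + (\<Sum>i\<in>UNIV. r * \<gamma> $ i * (?v $ i / m / x $ i))
        - (\<Sum>i\<in>UNIV. r * \<gamma> $ i * (2 * ((1 / c)\<^sup>2 / m\<^sup>2))) \<le> (\<Sum>i\<in>UNIV. r * \<gamma> $ i * ln (?y $ i))"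
      unfolding sum.distrib[symmetric] sum_subtractf[symmetric] by (intro sum_mono Lx)
    have 3: "C / m\<^sup>2 = (1 - r) / \<beta> * (2 * (C1\<^sup>2 / m\<^sup>2)) + (\<Sum>i\<in>UNIV. r * \<gamma> $ i * (2 * ((1 / c)\<^sup>2 / m\<^sup>2)))"
      by (simp add: C_def add_divide_distrib sum_divide_distrib)
    show "lyapunov x + (1 / (N + real n + 1)) * inner (\<chi> j. target x $ j / x $ j) ?v
      - C / (N + real n + 1)\<^sup>2 \<le> lyapunov ?y"
      unfolding m_def[symmetric] lyapunov_def lin 3 using 1 2 by (simp only: W_def)
  qed
qed

lemma lyapunov_average:
  obtains C n1 where "0 \<le> C" "\<And>n x b. n \<ge> n1 \<Longrightarrow> x \<in> states \<Longrightarrow>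
    average n (\<lambda>y. b - lyapunov y) x + (norm (mean_field x))\<^sup>2 / (N + real n + 1)
      \<le> (b - lyapunov x) + C / (N + real n + 1)\<^sup>2"
proof -
  obtain C n1 where C: "0 \<le> C" and le: "\<And>n x i. n \<ge> n1 \<Longrightarrow> x \<in> states \<Longrightarrow>
    lyapunov x + (1 / (N + real n + 1)) * inner (\<chi> j. target x $ j / x $ j) (inc i - x)
      - C / (N + real n + 1)\<^sup>2 \<le> lyapunov (step n x i)"
    using lyapunov_step by blast
  show ?thesis
  proof (rule that[OF C])
    fix n x and b :: real assume n: "n1 \<le> n" and x: "x \<in> states"
    define m where "m = N + real n + 1"
    have m: "0 < m" using time_pos[of n] by (simp add: m_def)
    let ?g = "\<chi> j. target x $ j / x $ j"
    have "average n (\<lambda>y. b - lyapunov y) x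
      \<le> (\<Sum>i\<in>UNIV. draw x $ i * ((b - lyapunov x + C / m\<^sup>2) + (- (1 / m)) * inner ?g (inc i - x) + 0 * 0))"
      unfolding average_def
    proof (intro sum_mono mult_left_mono draw_prob_nonneg[OF x])
      fix i
      show "b - lyapunov (step n x i) \<le> (b - lyapunov x + C / m\<^sup>2) + (- (1 / m)) * inner ?g (inc i - x) + 0 * 0"
        using le[OF n x, of i] unfolding m_def[symmetric] by simp
    qed
    also have "\<dots> = (b - lyapunov x + C / m\<^sup>2) - (1 / m) * inner ?g (mean_field x)"
      unfolding average_affine[OF x] average_inner[OF x] by simp
    finally have "average n (\<lambda>y. b - lyapunov y) x \<le> (b - lyapunov x + C / m\<^sup>2) - (1 / m) * inner ?g (mean_field x)" .
    moreover have "(1 / m) * (norm (mean_field x))\<^sup>2 \<le> (1 / m) * inner ?g (mean_field x)"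
      using gradient_drift[OF x] m by (intro mult_left_mono) (auto simp: inner_vec_def)
    ultimately show "average n (\<lambda>y. b - lyapunov y) x + (norm (mean_field x))\<^sup>2 / (N + real n + 1)
      \<le> (b - lyapunov x) + C / (N + real n + 1)\<^sup>2"
      unfolding m_def[symmetric] by simp
  qed
qed

lemma mean_field_measurable [measurable]: "(\<lambda>x. (norm (mean_field x))\<^sup>2) \<in> borel_measurable borel"
  unfolding power2_norm_eq_inner inner_vec_def inner_real_def
  by (simp add: mean_increment_nth)

lemma AE_drift_square_summable:
  "AE \<omega> in M. summable (\<lambda>n. (norm (mean_field (Y n \<omega>)))\<^sup>2 / (N + real n + 1))"
proof -
  obtain b where b: "\<And>x. x \<in> states \<Longrightarrow> \<bar>lyapunov x\<bar> \<le> b" using lyapunov_bounded by blast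
  obtain C n1 where C: "0 \<le> C" and av: "\<And>n x b. n \<ge> n1 \<Longrightarrow> x \<in> states \<Longrightarrow>
    average n (\<lambda>y. b - lyapunov y) x + (norm (mean_field x))\<^sup>2 / (N + real n + 1)
      \<le> (b - lyapunov x) + C / (N + real n + 1)\<^sup>2"
    using lyapunov_average by blast
  define m where "m n = N + real n + 1" for n :: nat
  have m: "0 < m n" for n using time_pos[of n] by (simp add: m_def)
  define p where "p x = b - lyapunov x" for x
  have p: "0 \<le> p x" "p x \<le> 2 * b" if "x \<in> states" for x
    using b[OF that] by (auto simp: p_def abs_le_iff)
  have [measurable]: "p \<in> borel_measurable borel" unfolding p_def by measurable
  define G where "G n \<omega> = ennreal ((norm (mean_field (Y n \<omega>)))\<^sup>2 / m n)" for n \<omega>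
  have GM [measurable]: "G n \<in> borel_measurable M" for n
    unfolding G_def using measurable_compose[OF Y_measurable mean_field_measurable] by measurable
  define I where "I n = (\<integral>\<^sup>+\<omega>. ennreal (p (Y n \<omega>)) \<partial>M)" for n
  have step: "I (Suc n) + (\<integral>\<^sup>+\<omega>. G n \<omega> \<partial>M) \<le> I n + ennreal (C / (m n)\<^sup>2)" if n: "n1 \<le> n" for n
  proof -
    have "(\<integral>\<^sup>+\<omega>. ennreal (p (Y (Suc n) \<omega>)) * indicator (space M) \<omega> \<partial>M)
      = (\<integral>\<^sup>+\<omega>. ennreal (average n p (Y n \<omega>)) * indicator (space M) \<omega> \<partial>M)"
      using p by (intro average_one_step[OF space_in_history]) auto
    moreover have "(\<integral>\<^sup>+\<omega>. h \<omega> * indicator (space M) \<omega> \<partial>M) = (\<integral>\<^sup>+\<omega>. h \<omega> \<partial>M)" for h :: "'w \<Rightarrow> ennreal"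
      by (intro nn_integral_cong) simp
    ultimately have e: "I (Suc n) = (\<integral>\<^sup>+\<omega>. ennreal (average n p (Y n \<omega>)) \<partial>M)"
      by (simp add: I_def)
    have "I (Suc n) + (\<integral>\<^sup>+\<omega>. G n \<omega> \<partial>M) = (\<integral>\<^sup>+\<omega>. ennreal (average n p (Y n \<omega>)) + G n \<omega> \<partial>M)"
      unfolding e by (rule nn_integral_add[symmetric]) measurable
    also have "\<dots> \<le> (\<integral>\<^sup>+\<omega>. ennreal (p (Y n \<omega>)) + ennreal (C / (m n)\<^sup>2) \<partial>M)"
      using AE_states
    proof (intro nn_integral_mono_AE, eventually_elim)
      case (elim \<omega>)
      then have x: "Y n \<omega> \<in> states" by simp
      have a: "0 \<le> average n p (Y n \<omega>)" unfolding average_def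
        using p(1) step_states[OF x] draw_prob_nonneg[OF x] by (intro sum_nonneg mult_nonneg_nonneg) auto
      have "average n p (Y n \<omega>) + (norm (mean_field (Y n \<omega>)))\<^sup>2 / m n \<le> p (Y n \<omega>) + C / (m n)\<^sup>2"
        using av[OF n x, of b] unfolding p_def m_def by simp
      then show ?case unfolding G_def
        using a p(1)[OF x] C m[of n] by (simp add: ennreal_leI flip: ennreal_plus)
    qed
    also have "\<dots> = I n + ennreal (C / (m n)\<^sup>2)"
      unfolding I_def by (subst nn_integral_add) (auto simp: emeasure_space_1)
    finally show ?thesis .
  qed
  have sumC: "summable (\<lambda>n. C / (m n)\<^sup>2)"
  proof (rule summable_comparison_test'[where N = 0])
    have "summable (\<lambda>n. inverse (real (Suc n) ^ 2))"
      using inverse_power_summable[of 2, where 'a = real] summable_Suc_iff[of "\<lambda>n. inverse (real n ^ 2)"] by simp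
    then show "summable (\<lambda>n. C * inverse (real (Suc n) ^ 2))" by (rule summable_mult)
    fix n
    have "(real (Suc n))\<^sup>2 \<le> (m n)\<^sup>2" using N_ge_1 by (intro power_mono) (auto simp: m_def)
    then have "C / (m n)\<^sup>2 \<le> C / (real (Suc n))\<^sup>2" using C m[of n] by (intro divide_left_mono) auto
    then show "norm (C / (m n)\<^sup>2) \<le> C * inverse (real (Suc n) ^ 2)" using C by (simp add: divide_inverse)
  qed
  define s where "s = (\<Sum>n. C / (m n)\<^sup>2)"
  have main: "(\<Sum>k\<in>{n1..<n}. \<integral>\<^sup>+\<omega>. G k \<omega> \<partial>M) + I n \<le> I n1 + (\<Sum>k\<in>{n1..<n}. ennreal (C / (m k)\<^sup>2))"
    if "n1 \<le> n" for n
    using that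
  proof (induction n rule: dec_induct)
    case base
    show ?case by simp
  next
    case (step n)
    have "(\<Sum>k\<in>{n1..<Suc n}. \<integral>\<^sup>+\<omega>. G k \<omega> \<partial>M) + I (Suc n)
      = (\<Sum>k\<in>{n1..<n}. \<integral>\<^sup>+\<omega>. G k \<omega> \<partial>M) + (I (Suc n) + (\<integral>\<^sup>+\<omega>. G n \<omega> \<partial>M))"
      using step(1) by (simp add: ac_simps)
    also have "\<dots> \<le> (\<Sum>k\<in>{n1..<n}. \<integral>\<^sup>+\<omega>. G k \<omega> \<partial>M) + (I n + ennreal (C / (m n)\<^sup>2))"
      using \<open>\<And>n. n1 \<le> n \<Longrightarrow> I (Suc n) + (\<integral>\<^sup>+\<omega>. G n \<omega> \<partial>M) \<le> I n + ennreal (C / (m n)\<^sup>2)\<close>[OF step(1)]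
      by (rule add_left_mono)
    also have "\<dots> = ((\<Sum>k\<in>{n1..<n}. \<integral>\<^sup>+\<omega>. G k \<omega> \<partial>M) + I n) + ennreal (C / (m n)\<^sup>2)" by (simp add: ac_simps)
    also have "\<dots> \<le> (I n1 + (\<Sum>k\<in>{n1..<n}. ennreal (C / (m k)\<^sup>2))) + ennreal (C / (m n)\<^sup>2)"
      using step.IH by (rule add_right_mono)
    finally show ?case using step(1) by (simp add: ac_simps)
  qed
  have I1: "I n1 \<le> ennreal (2 * b)"
  proof -
    have "I n1 \<le> (\<integral>\<^sup>+\<omega>. ennreal (2 * b) \<partial>M)" unfolding I_def using AE_states
    proof (intro nn_integral_mono_AE, eventually_elim)
      case (elim \<omega>)
      then show ?case using p(2) by (auto intro!: ennreal_leI)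
    qed
    then show ?thesis by (simp add: emeasure_space_1)
  qed
  have bound: "(\<Sum>k\<in>{n1..<n}. \<integral>\<^sup>+\<omega>. G k \<omega> \<partial>M) \<le> ennreal (2 * b) + ennreal s" if "n1 \<le> n" for n
  proof -
    have "(\<Sum>k\<in>{n1..<n}. \<integral>\<^sup>+\<omega>. G k \<omega> \<partial>M) \<le> (\<Sum>k\<in>{n1..<n}. \<integral>\<^sup>+\<omega>. G k \<omega> \<partial>M) + I n" by simp
    also have "\<dots> \<le> I n1 + (\<Sum>k\<in>{n1..<n}. ennreal (C / (m k)\<^sup>2))" by (rule main[OF that])
    also have "(\<Sum>k\<in>{n1..<n}. ennreal (C / (m k)\<^sup>2)) = ennreal (\<Sum>k\<in>{n1..<n}. C / (m k)\<^sup>2)"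
      using C by (intro sum_ennreal) auto
    also have "\<dots> \<le> ennreal s"
      unfolding s_def using C by (intro ennreal_leI sum_le_suminf[OF sumC]) auto
    finally show ?thesis using I1 by (meson add_mono order_refl order_trans)
  qed
  have "(\<integral>\<^sup>+\<omega>. (\<Sum>k. G (k + n1) \<omega>) \<partial>M) = (\<Sum>k. \<integral>\<^sup>+\<omega>. G (k + n1) \<omega> \<partial>M)"
    by (rule nn_integral_suminf) measurable
  also have "\<dots> \<le> ennreal (2 * b) + ennreal s"
  proof (rule suminf_le_const)
    fix n
    have "(\<Sum>k<n. \<integral>\<^sup>+\<omega>. G (k + n1) \<omega> \<partial>M) = (\<Sum>k\<in>{n1..<n + n1}. \<integral>\<^sup>+\<omega>. G k \<omega> \<partial>M)"
      using sum.shift_bounds_nat_ivl[of "\<lambda>k. \<integral>\<^sup>+\<omega>. G k \<omega> \<partial>M" 0 n1 n] by (simp add: atLeast0LessThan)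
    then show "(\<Sum>k<n. \<integral>\<^sup>+\<omega>. G (k + n1) \<omega> \<partial>M) \<le> ennreal (2 * b) + ennreal s"
      using bound[of "n + n1"] by simp
  qed simp
  also have "\<dots> < \<infinity>" by simp
  finally have "(\<integral>\<^sup>+\<omega>. (\<Sum>k. G (k + n1) \<omega>) \<partial>M) \<noteq> \<infinity>" by simp
  then have "AE \<omega> in M. (\<Sum>k. G (k + n1) \<omega>) \<noteq> \<infinity>"
    by (intro nn_integral_PInf_AE) measurable
  then show ?thesis
  proof eventually_elim
    case (elim \<omega>)
    have "summable (\<lambda>k. (norm (mean_field (Y (k + n1) \<omega>)))\<^sup>2 / m (k + n1))"
    proof (rule summable_suminf_not_top)
      show "0 \<le> (norm (mean_field (Y (k + n1) \<omega>)))\<^sup>2 / m (k + n1)" for k using m[of "k + n1"] by simp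
      show "(\<Sum>k. ennreal ((norm (mean_field (Y (k + n1) \<omega>)))\<^sup>2 / m (k + n1))) \<noteq> top"
        using elim by (simp add: G_def)
    qed
    then show ?case
      unfolding m_def by (subst (asm) summable_iff_shift)
  qed
qed

text \<open>The one-step formula involves \<open>Y (Suc n)\<close> only together with events of the past. The size of a step is recovered by
  locating \<open>Y n\<close> in small balls around the points of a countable dense set.\<close>

lemma AE_small_steps: "AE \<omega> in M. \<forall>n. dist (Y (Suc n) \<omega>) (Y n \<omega>) \<le> 2 / (N + real n + 1)"
proof -
  obtain Q :: "(real ^ 'a) set" where Q: "countable Q" "\<And>U. open U \<Longrightarrow> U \<noteq> {} \<Longrightarrow> \<exists>d\<in>Q. d \<in> U"
    using countable_dense_exists by blast
  have base: "AE \<omega> in M. Y n \<omega> \<in> ball z e \<longrightarrow> dist (Y (Suc n) \<omega>) z \<le> 2 / (N + real n + 1) + e" for n z e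
  proof -
    let ?m = "N + real n + 1"
    let ?B = "{y. \<not> dist y z \<le> 2 / ?m + e}"
    have B [measurable]: "?B \<in> sets borel" by measurable
    define D where "D = {\<omega>\<in>space M. \<forall>j\<in>{n..n}. Y j \<omega> \<in> ball z e}"
    have D: "D \<in> sets (history M X n)"
      unfolding D_def by (rule stay_event[OF space_in_history]) auto
    have [measurable]: "D \<in> sets M" using D by (rule history_sets)
    have "(\<integral>\<^sup>+\<omega>. indicator ?B (Y (Suc n) \<omega>) * indicator D \<omega> \<partial>M) = (\<integral>\<^sup>+\<omega>. 0 \<partial>M)"
    proof (subst share_one_step[OF D])
      show "(\<integral>\<^sup>+\<omega>. (\<Sum>i\<in>UNIV. ennreal (draw (Y n \<omega>) $ i) * indicator ?B (step n (Y n \<omega>) i)) * indicator D \<omega> \<partial>M)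
        = (\<integral>\<^sup>+\<omega>. 0 \<partial>M)"
        using AE_states
      proof (intro nn_integral_cong_AE, eventually_elim)
        case (elim \<omega>)
        have "step n (Y n \<omega>) i \<notin> ?B" if "\<omega> \<in> D" for i
        proof -
          have "dist (step n (Y n \<omega>) i) (Y n \<omega>) = (1 / ?m) * norm (inc i - Y n \<omega>)"
            using time_pos[of n] by (simp add: step_def dist_norm)
          also have "\<dots> \<le> (1 / ?m) * 2"
            using increment_norm_le_2[of "Y n \<omega>" i] elim time_pos[of n] by (intro mult_left_mono) auto
          finally have "dist (step n (Y n \<omega>) i) (Y n \<omega>) \<le> 2 / ?m" by simp
          moreover have "dist (Y n \<omega>) z < e" using that by (simp add: D_def dist_commute)
          ultimately show ?thesis using dist_triangle[of "step n (Y n \<omega>) i" z "Y n \<omega>"] by simp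
        qed
        then show ?case by (cases "\<omega> \<in> D") auto
      qed
    qed measurable
    also have "\<dots> = 0" by simp
    finally have "AE \<omega> in M. indicator ?B (Y (Suc n) \<omega>) * indicator D \<omega> = (0 :: ennreal)"
      by (subst (asm) nn_integral_0_iff_AE) auto
    then show ?thesis using AE_space
      by eventually_elim (auto simp: D_def indicator_def split: if_splits)
  qed
  have "AE \<omega> in M. \<forall>z\<in>Q. \<forall>k n. Y n \<omega> \<in> ball z (1 / real (Suc k)) \<longrightarrow>
      dist (Y (Suc n) \<omega>) z \<le> 2 / (N + real n + 1) + 1 / real (Suc k)"
    using base by (simp only: AE_ball_countable[OF Q(1)] AE_all_countable) blast
  then show ?thesis
  proof eventually_elim
    case (elim \<omega>)
    show ?case
    proof
      fix n
      show "dist (Y (Suc n) \<omega>) (Y n \<omega>) \<le> 2 / (N + real n + 1)"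
      proof (rule field_le_epsilon)
        fix e :: real assume "e > 0"
        then obtain k where k: "1 / real (Suc k) < e / 2" using nat_approx_posE[of "e / 2"] by auto
        have "ball (Y n \<omega>) (1 / real (Suc k)) \<noteq> {}" by simp
        then obtain z where z: "z \<in> Q" "z \<in> ball (Y n \<omega>) (1 / real (Suc k))" using Q(2) open_ball by blast
        then have "dist (Y (Suc n) \<omega>) z \<le> 2 / (N + real n + 1) + 1 / real (Suc k)"
          using elim by (simp add: dist_commute)
        then show "dist (Y (Suc n) \<omega>) (Y n \<omega>) \<le> 2 / (N + real n + 1) + e"
          using z(2) k dist_triangle[of "Y (Suc n) \<omega>" "Y n \<omega>" z] by (simp add: dist_commute)
      qed
    qed
  qed
qed

lemma AE_drift_vanishes: "AE \<omega> in M. (\<lambda>n. norm (mean_field (Y n \<omega>))) \<longlonglongrightarrow> 0"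
proof -
  obtain C where C: "C \<ge> 0" "\<And>x y :: real ^ 'a. x \<in> prob_simplex \<Longrightarrow> y \<in> prob_simplex \<Longrightarrow>
    norm (draw x - draw y) \<le> C * norm (x - y)"
    using draw_prob_lipschitz[OF \<beta>] by blast
  have lip: "norm (mean_field x - mean_field y) \<le> (C + 1) * norm (x - y)"
    if "x \<in> states" "y \<in> states" for x y
  proof -
    have "mean_field x - mean_field y = (1 - r) *\<^sub>R (draw x - draw y) - (x - y)"
      by (simp add: mean_increment_def scaleR_diff_right)
    then have "norm (mean_field x - mean_field y) \<le> norm ((1 - r) *\<^sub>R (draw x - draw y)) + norm (x - y)"
      by (metis norm_triangle_ineq4)
    also have "norm ((1 - r) *\<^sub>R (draw x - draw y)) \<le> 1 * norm (draw x - draw y)"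
      unfolding norm_scaleR using r by (intro mult_right_mono) auto
    also have "\<dots> \<le> C * norm (x - y)" using C(2)[OF that[THEN states_simplex]] by simp
    finally show ?thesis by (simp add: distrib_right)
  qed
  show ?thesis
    using AE_drift_square_summable AE_small_steps AE_states
  proof eventually_elim
    case (elim \<omega>)
    show ?case
    proof (rule tendsto_zero_of_harmonic_square_summable[of N _ "(C + 1) * 2"])
      fix n
      have "\<bar>norm (mean_field (Y (Suc n) \<omega>)) - norm (mean_field (Y n \<omega>))\<bar>
        \<le> norm (mean_field (Y (Suc n) \<omega>) - mean_field (Y n \<omega>))" by (rule norm_triangle_ineq3)
      also have "\<dots> \<le> (C + 1) * norm (Y (Suc n) \<omega> - Y n \<omega>)" using elim(3) by (intro lip) auto
      also have "\<dots> \<le> (C + 1) * (2 / (N + real n + 1))"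
        using elim(2) C(1) by (intro mult_left_mono) (auto simp: dist_norm)
      finally show "\<bar>norm (mean_field (Y (Suc n) \<omega>)) - norm (mean_field (Y n \<omega>))\<bar> \<le> (C + 1) * 2 / (N + real n + 1)"
        by simp
    qed (use elim(1) N_ge_1 in auto)
  qed
qed

end

section \<open>Fixed points of the mean field near the vertices\<close>

lemma uniform_on_singleton: "uniform_on {i} = axis i 1"
  by (auto simp: vec_eq_iff uniform_on_def axis_def)

lemma spread_singleton: "spread \<beta> {i} d = 0"
  by (auto simp: vec_eq_iff spread_def)

lemma inj_on_uniform_on: "inj_on (uniform_on :: 'a::finite set \<Rightarrow> real ^ 'a) {S. S \<noteq> {}}"
proof (rule inj_onI)
  fix S T :: "'a set"
  assume ST: "S \<in> {S. S \<noteq> {}}" "T \<in> {S. S \<noteq> {}}" and eq: "(uniform_on S :: real ^ 'a) = uniform_on T"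
  have "R = {i. uniform_on R $ i \<noteq> (0::real)}" if "R \<noteq> {}" for R :: "'a set"
    using that by (auto simp: uniform_on_def)
  then show "S = T" using ST eq by (metis mem_Collect_eq)
qed

text \<open>One radius for all sets \<open>S\<close>, as there are finitely many.\<close>

lemma common_radius:
  fixes \<beta> :: real
  assumes \<beta>: "\<beta> > 1"
  obtains \<delta> where "\<delta> > 0"
    "\<And>S :: 'a::finite set. S \<noteq> {} \<Longrightarrow> linear_near \<beta> \<delta> S"
    "\<And>(S :: 'a set) \<gamma> r. 2 \<le> card S \<Longrightarrow> \<gamma> \<in> prob_simplex \<Longrightarrow> 0 \<le> r \<Longrightarrow> r \<le> 1 / 256 \<Longrightarrow> excited_near \<beta> r \<gamma> \<delta> S"
    "\<And>S T :: 'a set. S \<noteq> {} \<Longrightarrow> T \<noteq> {} \<Longrightarrow> S \<noteq> T \<Longrightarrow> 4 * \<delta> \<le> dist (uniform_on S :: real ^ 'a) (uniform_on T)"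
proof -
  define \<eta> where "\<eta> = min ((\<beta> - 1) / 2) 1 / (4 * real (CARD('a) + 1))"
  have \<eta>: "0 < \<eta>" using \<beta> by (simp add: \<eta>_def)
  let ?P1 = "\<lambda>\<delta> (S :: 'a set). S \<noteq> {} \<longrightarrow> linear_near \<beta> \<delta> S"
  let ?P2 = "\<lambda>\<delta> (S :: 'a set). 2 \<le> card S \<longrightarrow> (\<forall>\<gamma>\<in>prob_simplex. \<forall>r. 0 \<le> r \<longrightarrow> r \<le> 1 / 256 \<longrightarrow> excited_near \<beta> r \<gamma> \<delta> S)"
  let ?P3 = "\<lambda>\<delta> (S :: 'a set) T. S \<noteq> {} \<longrightarrow> T \<noteq> {} \<longrightarrow> S \<noteq> T \<longrightarrow> 4 * \<delta> \<le> dist (uniform_on S :: real ^ 'a) (uniform_on T)"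
  have small: "eventually Q (at_right (0::real))" if "d > 0" "\<And>\<delta>. \<delta> \<le> d \<Longrightarrow> Q \<delta>" for d :: real and Q
    unfolding eventually_at_right_field using that by (intro exI[of _ d]) auto
  have 1: "\<forall>\<^sub>F \<delta> in at_right 0. ?P1 \<delta> S" for S
  proof (cases "S = {}")
    case False
    then obtain d where "d > 0" "\<And>x y. x \<in> prob_simplex \<Longrightarrow> y \<in> prob_simplex \<Longrightarrow>
       dist x (uniform_on S) < d \<Longrightarrow> dist y (uniform_on S) < d \<Longrightarrow>
       norm (draw_prob \<beta> x - draw_prob \<beta> y - spread \<beta> S (x - y)) \<le> \<eta> * norm (x - y)"
      using draw_prob_strict_derivative[of S \<beta> \<eta>] \<beta> \<eta> by blast
    then show ?thesis
      unfolding linear_near_def \<eta>_def[symmetric] by (intro small[of d]) auto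
  qed simp
  have 2: "\<forall>\<^sub>F \<delta> in at_right 0. ?P2 \<delta> S" for S
  proof (cases "2 \<le> card S")
    case True
    obtain d where "d > 0"
      "\<And>\<gamma> r. \<gamma> \<in> prob_simplex \<Longrightarrow> 0 \<le> r \<Longrightarrow> r \<le> 1 / 256 \<Longrightarrow> excited_near \<beta> r \<gamma> d S"
      using draws_excite_reflected_form[OF True \<beta>] by blast
    then show ?thesis by (intro small[of d]) (auto simp: excited_near_def)
  qed simp
  have 3: "\<forall>\<^sub>F \<delta> in at_right 0. ?P3 \<delta> S T" for S T
  proof (cases "S \<noteq> {} \<and> T \<noteq> {} \<and> S \<noteq> T")
    case True
    then have "(uniform_on S :: real ^ 'a) \<noteq> uniform_on T" using inj_on_uniform_on by (auto dest: inj_onD)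
    then show ?thesis by (intro small[of "dist (uniform_on S :: real ^ 'a) (uniform_on T) / 4"]) auto
  next
    case False
    then show ?thesis by (intro always_eventually) auto
  qed
  have "\<forall>\<^sub>F \<delta> in at_right 0. 0 < \<delta> \<and> (\<forall>S. ?P1 \<delta> S) \<and> (\<forall>S. ?P2 \<delta> S) \<and> (\<forall>S T. ?P3 \<delta> S T)"
    by (intro eventually_conj eventually_at_right_less eventually_all_finite 1 2 3)
  from eventually_happens'[OF trivial_limit_at_right_real this] obtain \<delta>
    where c: "0 < \<delta> \<and> (\<forall>S. ?P1 \<delta> S) \<and> (\<forall>S. ?P2 \<delta> S) \<and> (\<forall>S T. ?P3 \<delta> S T)" ..
  note c2 = c[THEN conjunct2]
  note c3 = c2[THEN conjunct2]
  show ?thesis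
    by (rule that[OF c[THEN conjunct1] c2[THEN conjunct1, rule_format] c3[THEN conjunct1, rule_format]
          c3[THEN conjunct2, rule_format]])
qed

lemma contraction_near_vertex:
  fixes x y :: "real ^ 'a::finite"
  assumes "linear_near \<beta> \<delta> {i}" and "x \<in> prob_simplex" "y \<in> prob_simplex"
    and "dist x (axis i 1) < \<delta>" "dist y (axis i 1) < \<delta>"
  shows "norm (draw_prob \<beta> x - draw_prob \<beta> y) \<le> 1 / 4 * norm (x - y)"
proof -
  have "norm (draw_prob \<beta> x - draw_prob \<beta> y)
      \<le> min ((\<beta> - 1) / 2) 1 / (4 * real (CARD('a) + 1)) * norm (x - y)"
    using assms by (simp add: linear_near_def uniform_on_singleton spread_singleton)
  also have "\<dots> \<le> 1 / 4 * norm (x - y)"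
    by (intro mult_right_mono frac_le) auto
  finally show ?thesis .
qed

text \<open>Banach's theorem gives \<open>q\<close>. As \<open>q\<close> is a mixture of \<open>p q\<close> and \<open>\<gamma>\<close>, an agent with \<open>q\<^sub>j > \<gamma>\<^sub>j\<close> has a drawing probability
  of at least \<open>q\<^sub>j\<close>. For \<open>j \<noteq> i\<close> this contradicts the contraction property, by which a small share is drawn with much
  smaller probability.\<close>

lemma vertex_fixed_point:
  fixes \<gamma> :: "real ^ 'a::finite" and i :: 'a
  assumes \<beta>: "\<beta> > 0" and \<gamma>: "\<gamma> \<in> prob_simplex" and r: "0 \<le> r" "r \<le> 1" "12 * r < \<delta>"
    and lin: "linear_near \<beta> \<delta> {i}"
    and gap: "4 * r < 1 - \<gamma> $ i"
  obtains q where "q \<in> prob_simplex" "dist q (axis i 1) \<le> 4 * r"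
    "\<And>x. x \<in> prob_simplex \<Longrightarrow> dist x (axis i 1) < \<delta> \<Longrightarrow> norm (mean_increment \<beta> r \<gamma> x - q) \<le> 1 / 2 * norm (x - q)"
    "\<And>j. \<gamma> $ j < q $ j \<longleftrightarrow> j = i"
proof -
  let ?e = "axis i 1 :: real ^ 'a" and ?T = "mean_increment \<beta> r \<gamma>"
  have e: "?e \<in> prob_simplex" by (rule axis_simplex)
  have pe: "draw_prob \<beta> ?e = ?e" using draw_prob_uniform_on[of "{i}" \<beta>] \<beta> by (simp add: uniform_on_singleton)
  have Tdiff: "norm (?T x - ?T y) \<le> 1 / 4 * norm (x - y)"
    if "x \<in> prob_simplex" "y \<in> prob_simplex" "dist x ?e < \<delta>" "dist y ?e < \<delta>" for x y
  proof -
    have "?T x - ?T y = (1 - r) *\<^sub>R (draw_prob \<beta> x - draw_prob \<beta> y)"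
      by (simp add: mean_increment_def scaleR_diff_right)
    then have "norm (?T x - ?T y) = (1 - r) * norm (draw_prob \<beta> x - draw_prob \<beta> y)" using r by simp
    also have "\<dots> \<le> 1 * norm (draw_prob \<beta> x - draw_prob \<beta> y)" using r by (intro mult_right_mono) auto
    also have "\<dots> \<le> 1 / 4 * norm (x - y)" using contraction_near_vertex[OF lin that] by simp
    finally show ?thesis .
  qed
  define K where "K = prob_simplex \<inter> cball ?e (4 * r)"
  have near: "dist x ?e < \<delta>" if "x \<in> K" for x using that r by (auto simp: K_def dist_commute)
  have "compact K" unfolding K_def by (intro compact_Int compact_prob_simplex compact_cball)
  then have "\<exists>!q\<in>K. ?T q = q"
  proof (rule Banach_fix[of K "1 / 4", OF compact_imp_complete])
    show "K \<noteq> {}" using e r by (auto simp: K_def)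
    show "?T ` K \<subseteq> K"
    proof
      fix z assume "z \<in> ?T ` K"
      then obtain x where x: "x \<in> K" "z = ?T x" by blast
      have xs: "x \<in> prob_simplex" "norm (x - ?e) \<le> 4 * r" using x by (auto simp: K_def dist_norm norm_minus_commute)
      have "?T x \<in> prob_simplex" unfolding mean_increment_def
        using weight_pos[OF xs(1) \<beta>] \<gamma> r by (intro simplex_mix draw_prob_simplex) auto
      moreover have "norm (?T x - ?e) \<le> 4 * r"
      proof -
        have "?T ?e - ?e = r *\<^sub>R (\<gamma> - ?e)" by (simp add: mean_increment_def pe algebra_simps)
        then have "norm (?T ?e - ?e) = r * norm (\<gamma> - ?e)" using r by simp
        also have "\<dots> \<le> r * 2" using norm_simplex_diff_le_2[OF \<gamma> e] r by (intro mult_left_mono) auto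
        finally have "norm (?T ?e - ?e) \<le> 2 * r" by simp
        moreover have "norm (?T x - ?T ?e) \<le> 1 / 4 * norm (x - ?e)"
          using Tdiff[OF xs(1) e near[OF x(1)]] r by simp
        moreover have "norm (?T x - ?e) \<le> norm (?T x - ?T ?e) + norm (?T ?e - ?e)"
          using norm_triangle_ineq[of "?T x - ?T ?e" "?T ?e - ?e"] by simp
        ultimately show ?thesis using xs(2) r by linarith
      qed
      ultimately show "z \<in> K" by (simp add: K_def x(2) dist_norm norm_minus_commute)
    qed
    show "dist (?T x) (?T y) \<le> 1 / 4 * dist x y" if "x \<in> K" "y \<in> K" for x y
      using Tdiff[of x y] that near by (simp add: K_def dist_norm)
  qed auto
  then obtain q where qK: "q \<in> K" and fp: "?T q = q" by blast
  have q: "q \<in> prob_simplex" and qe: "dist q ?e \<le> 4 * r" using qK by (auto simp: K_def dist_commute)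
  have qcomp: "\<bar>q $ j - ?e $ j\<bar> \<le> 4 * r" for j
    using component_le_norm_cart[of "q - ?e" j] qe by (simp add: dist_norm)
  have low: "q $ j \<le> \<gamma> $ j" if j: "j \<noteq> i" for j
  proof (rule ccontr)
    assume "\<not> ?thesis"
    then have qj: "\<gamma> $ j < q $ j" by simp
    then have qp: "0 < q $ j" using simplex_nonneg[OF \<gamma>, of j] by linarith
    \<comment> \<open>Compare with the point in which agent \<open>i\<close> has taken over the share of agent \<open>j\<close>.\<close>
    define y where "y = q + q $ j *\<^sub>R (?e - axis j 1)"
    have yj: "y $ j = 0" using j by (simp add: y_def axis_def)
    have "y \<in> prob_simplex"
    proof (rule simplexI)
      show "0 \<le> y $ k" for k
        using simplex_nonneg[OF q, of k] qp j by (auto simp: y_def axis_def)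
      have "(\<Sum>k\<in>UNIV. y $ k) = (\<Sum>k\<in>UNIV. q $ k) + q $ j * ((\<Sum>k\<in>UNIV. ?e $ k) - (\<Sum>k\<in>UNIV. axis j 1 $ k))"
        by (simp add: y_def sum.distrib sum_subtractf flip: sum_distrib_left)
      also have "\<dots> = 1" using simplex_sum[OF q] simplex_sum[OF axis_simplex[of i]] simplex_sum[OF axis_simplex[of j]] by simp
      finally show "(\<Sum>k\<in>UNIV. y $ k) = 1" .
    qed
    moreover have qy: "norm (q - y) \<le> 2 * q $ j"
    proof -
      have "norm (q - y) = q $ j * norm (?e - axis j 1)" using qp by (simp add: y_def)
      also have "\<dots> \<le> q $ j * 2"
        using norm_simplex_diff_le_2[OF axis_simplex[of i] axis_simplex[of j]] qp by (intro mult_left_mono) auto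
      finally show ?thesis by simp
    qed
    moreover have "dist y ?e < \<delta>"
    proof -
      have "q $ j \<le> 4 * r" using qcomp[of j] j qp by (simp add: axis_def)
      then have "norm (q - y) \<le> 8 * r" using qy by linarith
      then show ?thesis using dist_triangle[of y ?e q] qe r by (simp add: dist_norm norm_minus_commute)
    qed
    ultimately have "norm (draw_prob \<beta> q - draw_prob \<beta> y) \<le> 1 / 4 * norm (q - y)"
      by (intro contraction_near_vertex[OF lin] q near[OF qK])
    moreover have "draw_prob \<beta> y $ j = 0" using yj \<beta> by (simp add: draw_prob_nth)
    ultimately have "draw_prob \<beta> q $ j \<le> 1 / 4 * norm (q - y)"
      using component_le_norm_cart[of "draw_prob \<beta> q - draw_prob \<beta> y" j] by simp
    then have "draw_prob \<beta> q $ j < q $ j" using qy qp by linarith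
    then have "(1 - r) * draw_prob \<beta> q $ j \<le> (1 - r) * q $ j" using r by (intro mult_left_mono) auto
    moreover have eq: "q $ j = (1 - r) * draw_prob \<beta> q $ j + r * \<gamma> $ j"
      using fp by (metis mean_increment_nth)
    ultimately have "q $ j \<le> (1 - r) * q $ j + r * \<gamma> $ j" by linarith
    then have "r * q $ j \<le> r * \<gamma> $ j" by (simp add: left_diff_distrib)
    then have "r = 0" using qj r(1) by (metis mult_le_cancel_left_pos not_le order_le_less)
    then show False using eq \<open>draw_prob \<beta> q $ j < q $ j\<close> by simp
  qed
  show ?thesis
  proof (rule that[OF q qe])
    show "norm (?T x - q) \<le> 1 / 2 * norm (x - q)" if "x \<in> prob_simplex" "dist x ?e < \<delta>" for x
    proof -
      have "norm (?T x - ?T q) \<le> 1 / 4 * norm (x - q)" by (rule Tdiff[OF that(1) q that(2) near[OF qK]])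
      then have "norm (?T x - q) \<le> 1 / 4 * norm (x - q)" by (simp only: fp)
      then show ?thesis using norm_ge_zero[of "x - q"] by linarith
    qed
    show "\<gamma> $ j < q $ j \<longleftrightarrow> j = i" for j
    proof
      assume "j = i"
      then show "\<gamma> $ j < q $ j" using qcomp[of i] gap by simp
    next
      assume "\<gamma> $ j < q $ j"
      then show "j = i" using low[of j] by force
    qed
  qed
qed

section \<open>Selecting the limit\<close>

lemma eventually_in_one_ball:
  fixes y :: "nat \<Rightarrow> 'b::metric_space" and u :: "'c \<Rightarrow> 'b"
  assumes sep: "\<And>S T. S \<in> I \<Longrightarrow> T \<in> I \<Longrightarrow> S \<noteq> T \<Longrightarrow> 4 * \<delta> \<le> dist (u S) (u T)"
    and near: "\<forall>\<^sub>F n in sequentially. \<exists>S\<in>I. dist (y n) (u S) < \<delta>"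
    and steps: "\<forall>\<^sub>F n in sequentially. dist (y (Suc n)) (y n) < \<delta>"
  obtains S k where "S \<in> I" "\<And>n. n \<ge> k \<Longrightarrow> dist (y n) (u S) < \<delta>"
proof -
  obtain k where k: "\<And>n. n \<ge> k \<Longrightarrow> \<exists>S\<in>I. dist (y n) (u S) < \<delta>" "\<And>n. n \<ge> k \<Longrightarrow> dist (y (Suc n)) (y n) < \<delta>"
    using eventually_conj[OF near steps] by (auto simp: eventually_sequentially)
  obtain S where S: "S \<in> I" "dist (y k) (u S) < \<delta>" using k(1) by blast
  have "dist (y n) (u S) < \<delta>" if "n \<ge> k" for n
    using that
  proof (induction n rule: dec_induct)
    case base
    show ?case by (rule S(2))
  next
    case (step n)
    obtain T where T: "T \<in> I" "dist (y (Suc n)) (u T) < \<delta>" using k(1)[of "Suc n"] step by auto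
    have "dist (u S) (u T) \<le> dist (u S) (y n) + dist (y n) (y (Suc n)) + dist (y (Suc n)) (u T)"
      using dist_triangle[of "u S" "u T" "y (Suc n)"] dist_triangle[of "u S" "y (Suc n)" "y n"] by linarith
    also have "\<dots> < \<delta> + \<delta> + \<delta>"
      using step.IH T(2) k(2)[OF step(1)] by (intro add_strict_mono) (auto simp: dist_commute)
    finally have "dist (u S) (u T) < 4 * \<delta>" using le_less_trans[OF zero_le_dist T(2)] by simp
    then have "S = T" using sep[OF S(1) T(1)] by force
    then show ?case using T(2) by simp
  qed
  then show ?thesis using that[OF S(1)] by blast
qed

context power_urn
begin

text \<open>If the region contains a fixed point, this is the instability result. If not, no path can stay, because the drift
  would vanish at its limit points.\<close>

lemma leaves_mixed_region:
  fixes S :: "'a set"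
  assumes S: "2 \<le> card S" and r': "r \<le> 1 / 256" "r \<le> (\<beta> - 1) / (2 * \<beta>)" and \<delta>: "0 < \<delta>"
    and lin: "linear_near \<beta> \<delta> S" and exc: "excited_near \<beta> r \<gamma> \<delta> S"
  shows "AE \<omega> in M. \<not> (\<forall>n\<ge>n0. dist (Y n \<omega>) (uniform_on S) < \<delta> / 2)"
proof -
  let ?u = "uniform_on S :: real ^ 'a"
  let ?\<rho> = "min ((\<beta> - 1) / 2) 1 / (2 * real (CARD('a) + 1))"
  have ne: "S \<noteq> {}" using S by auto
  show ?thesis
  proof (cases "\<exists>q. q \<in> prob_simplex \<and> dist q ?u < \<delta> \<and> target q = q")
    case True
    then obtain q where q: "q \<in> prob_simplex" "dist q ?u < \<delta>" and fp: "target q = q" by blast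
    have "AE \<omega> in M. \<not> (\<forall>n\<ge>n0. Y n \<omega> \<in> ball ?u \<delta>)"
    proof (rule repelled[where q = q and S = S and \<rho> = ?\<rho> and ?c0.0 = "1 / 16"])
      show "0 < ?\<rho>" using \<beta> by simp
      have "min ((\<beta> - 1) / 2) 1 / (2 * real (CARD('a) + 1)) \<le> 1 / 1" by (intro frac_le) auto
      then show "?\<rho> \<le> 1" by simp
      fix x assume x: "x \<in> states" "x \<in> ball ?u \<delta>"
      have xs: "x \<in> prob_simplex" "dist x ?u < \<delta>" using x states_simplex by (auto simp: dist_commute)
      note b = reflected_drift_bounds[OF ne \<beta> r(1) r'(2) xs(1) q(1) fp lin[unfolded linear_near_def, rule_format, OF xs(1) q(1) xs(2) q(2)]]
      show "?\<rho> * (norm (x - q))\<^sup>2 \<le> 2 * inner (x - q) (reflect S (mean_field x))"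
        by (rule b(1))
      show "?\<rho> * (norm (x - q))\<^sup>2 \<le> inner (x - q) (reflect S (x - q)) + 2 * inner (x - q) (reflect S (mean_field x))"
        by (rule b(2))
      show "1 / 16 \<le> (\<Sum>i\<in>UNIV. draw x $ i * inner (inc i - x) (reflect S (inc i - x)))"
        by (rule exc[unfolded excited_near_def, rule_format, OF xs])
    qed (auto simp: q)
    then show ?thesis
    proof eventually_elim
      case (elim \<omega>)
      show ?case
      proof
        assume s: "\<forall>n\<ge>n0. dist (Y n \<omega>) ?u < \<delta> / 2"
        have "Y n \<omega> \<in> ball ?u \<delta>" if "n \<ge> n0" for n
          using s[rule_format, OF that] \<delta> by (simp add: dist_commute)
        then show False using elim by blast
      qed
    qed
  next
    case False
    \<comment> \<open>A path that stays has a limit point, at which the drift vanishes.\<close>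
    show ?thesis
      using AE_drift_vanishes AE_states
    proof eventually_elim
      case (elim \<omega>)
      show ?case
      proof
        assume stay: "\<forall>n\<ge>n0. dist (Y n \<omega>) ?u < \<delta> / 2"
        define K where "K = prob_simplex \<inter> cball ?u (\<delta> / 2)"
        have "compact K" unfolding K_def by (intro compact_Int compact_prob_simplex compact_cball)
        then have K: "seq_compact K" by (rule compact_imp_seq_compact)
        have "\<forall>n. Y (n + n0) \<omega> \<in> K"
          using stay elim(2) states_simplex by (auto simp: K_def dist_commute less_imp_le)
        then obtain q s where q: "q \<in> K" and s: "strict_mono s" "((\<lambda>n. Y (n + n0) \<omega>) \<circ> s) \<longlonglongrightarrow> q"
          by (rule seq_compactE[OF K])
        have lim: "(\<lambda>n. Y (s n + n0) \<omega>) \<longlonglongrightarrow> q" using s(2) by (simp add: o_def)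
        have qs: "q \<in> prob_simplex" "dist q ?u < \<delta>" using q \<delta> by (auto simp: K_def dist_commute)
        have "continuous_on prob_simplex (\<lambda>x :: real ^ 'a. norm (mean_field x))"
          unfolding mean_increment_def using \<beta>
          by (intro continuous_intros continuous_on_draw_prob) simp
        then have "(\<lambda>n. norm (mean_field (Y (s n + n0) \<omega>))) \<longlonglongrightarrow> norm (mean_field q)"
          by (rule continuous_on_tendsto_compose[OF _ lim qs(1)]) (use elim(2) states_simplex in auto)
        moreover have "(\<lambda>n. norm (mean_field (Y (s n + n0) \<omega>))) \<longlonglongrightarrow> 0"
        proof -
          have "filterlim (\<lambda>n. s n + n0) sequentially sequentially"
            by (rule filterlim_compose[OF filterlim_add_const_nat_at_top filterlim_subseq[OF s(1)]])
          from filterlim_compose[OF elim(1) this] show ?thesis .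
        qed
        ultimately have "norm (mean_field q) = 0" by (rule LIMSEQ_unique)
        then show False using False qs by auto
      qed
    qed
  qed
qed

text \<open>The shares \<open>z n\<close> after \<open>n\<close> draws of the same agent \<open>i\<close>.\<close>

lemma repeated_draws_possible:
  fixes i :: 'a
  defines "z \<equiv> \<lambda>n. inc i + (N / (N + real n)) *\<^sub>R ((1 / N) *\<^sub>R x0 - inc i)"
  shows "z n \<in> states \<and> emeasure M {\<omega>\<in>space M. Y n \<omega> = z n} > 0"
proof (induction n)
  case 0
  have z0: "z 0 = (1 / N) *\<^sub>R x0" using N_ge_1 by (simp add: z_def)
  have Y0: "AE \<omega> in M. Y 0 \<omega> = z 0" using init by eventually_elim (simp add: Y_def z0)
  have "AE \<omega> in M. z 0 \<in> states" using Y0 AE_states by eventually_elim metis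
  then have "z 0 \<in> states" by simp
  moreover have "{\<omega>\<in>space M. Y 0 \<omega> = z 0} \<in> sets M" by measurable
  then have "emeasure M {\<omega>\<in>space M. Y 0 \<omega> = z 0} = 1" using Y0 by (subst emeasure_eq_1_AE) auto
  ultimately show ?case by simp
next
  case (Suc n)
  then have zs: "z n \<in> states" and pos: "emeasure M {\<omega>\<in>space M. Y n \<omega> = z n} > 0" by auto
  have z_step: "step n (z n) i = z (Suc n)"
  proof -
    define a where "a = (1 / N) *\<^sub>R x0 - inc i"
    have m: "N + real n > 0" by (rule time_pos)
    have c: "(1 - 1 / (N + real n + 1)) * (N / (N + real n)) = N / (N + real n + 1)"
    proof -
      have "1 - 1 / (N + real n + 1) = (N + real n) / (N + real n + 1)" using m by (simp add: field_simps)
      then show ?thesis using m by simp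
    qed
    have "step n (z n) i = inc i + ((1 - 1 / (N + real n + 1)) * (N / (N + real n))) *\<^sub>R a"
      unfolding step_convex z_def a_def[symmetric] by (simp add: scaleR_add_right algebra_simps)
    then show ?thesis unfolding c by (simp add: z_def a_def algebra_simps)
  qed
  let ?D = "\<lambda>n. {\<omega>\<in>space M. Y n \<omega> = z n}"
  have DM [measurable]: "?D n \<in> sets M" for n by measurable
  have "z n $ i \<noteq> 0" using zs by (auto simp: states_def less_imp_neq[THEN not_sym])
  then have "draw (z n) $ i > 0"
    using weight_pos[OF states_simplex[OF zs], of \<beta>] \<beta> by (simp add: draw_prob_nth)
  then have "0 < ennreal (draw (z n) $ i) * emeasure M (?D n)"
    using pos by (simp add: ennreal_zero_less_mult_iff)
  also have "\<dots> = (\<integral>\<^sup>+\<omega>. ennreal (draw (z n) $ i) * indicator (?D n) \<omega> \<partial>M)"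
    by (rule nn_integral_cmult_indicator[symmetric]) (rule DM)
  also have "\<dots> \<le> (\<integral>\<^sup>+\<omega>. (\<Sum>k\<in>UNIV. ennreal (draw (Y n \<omega>) $ k) * indicator {z (Suc n)} (step n (Y n \<omega>) k)) * indicator (space M) \<omega> \<partial>M)"
  proof (rule nn_integral_mono)
    fix \<omega> assume w: "\<omega> \<in> space M"
    show "ennreal (draw (z n) $ i) * indicator (?D n) \<omega>
      \<le> (\<Sum>k\<in>UNIV. ennreal (draw (Y n \<omega>) $ k) * indicator {z (Suc n)} (step n (Y n \<omega>) k)) * indicator (space M) \<omega>"
    proof (cases "\<omega> \<in> ?D n")
      case True
      then have "ennreal (draw (z n) $ i) * indicator (?D n) \<omega>
        = ennreal (draw (Y n \<omega>) $ i) * indicator {z (Suc n)} (step n (Y n \<omega>) i)"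
        using z_step by simp
      also have "\<dots> \<le> (\<Sum>k\<in>UNIV. ennreal (draw (Y n \<omega>) $ k) * indicator {z (Suc n)} (step n (Y n \<omega>) k))"
        by (rule member_le_sum) auto
      finally show ?thesis using w by simp
    qed simp
  qed
  also have "\<dots> = (\<integral>\<^sup>+\<omega>. indicator {z (Suc n)} (Y (Suc n) \<omega>) * indicator (space M) \<omega> \<partial>M)"
    by (rule share_one_step[OF space_in_history, symmetric]) measurable
  also have "\<dots> = (\<integral>\<^sup>+\<omega>. indicator (?D (Suc n)) \<omega> \<partial>M)"
    by (intro nn_integral_cong) (auto simp: indicator_def)
  also have "\<dots> = emeasure M (?D (Suc n))" by (rule nn_integral_indicator) (rule DM)
  finally show ?case using step_states[OF zs, of n i] z_step by simp
qed

text \<open>After sufficiently many draws of agent \<open>i\<close> the function \<^const>\<open>proximity\<close> is at most half of the value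
  that it has to reach before the path can leave the ball of radius \<open>\<delta>\<close>.\<close>

lemma attracted_with_positive_probability:
  fixes i :: 'a
  assumes \<delta>: "0 < \<delta>" and r': "64 * r \<le> \<delta>"
    and q: "q \<in> prob_simplex" "dist q (axis i 1) \<le> 4 * r"
    and con: "\<And>x. x \<in> prob_simplex \<Longrightarrow> dist x (axis i 1) < \<delta> \<Longrightarrow>
      norm (target x - q) \<le> 1 / 2 * norm (x - q)"
  shows "\<not> (AE \<omega> in M. \<not> (\<lambda>n. Y n \<omega>) \<longlonglongrightarrow> q)"
proof
  assume never: "AE \<omega> in M. \<not> (\<lambda>n. Y n \<omega>) \<longlonglongrightarrow> q"
  let ?e = "axis i 1 :: real ^ 'a" and ?v = "inc i"
  define z where "z n = ?v + (N / (N + real n)) *\<^sub>R ((1 / N) *\<^sub>R x0 - ?v)" for n :: nat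
  have zpos: "z n \<in> states" "emeasure M {\<omega>\<in>space M. Y n \<omega> = z n} > 0" for n
    using repeated_draws_possible[of i n] by (auto simp: z_def)
  have z: "norm (z n - ?v) \<le> 2 * N / (N + real n)" for n
  proof -
    have "z 0 = (1 / N) *\<^sub>R x0" using N_ge_1 by (simp add: z_def)
    then have "norm ((1 / N) *\<^sub>R x0 - ?v) \<le> 2" using increment_norm_le_2[OF zpos(1)[of 0], of i] by (simp add: norm_minus_commute)
    then have "(N / (N + real n)) * norm ((1 / N) *\<^sub>R x0 - ?v) \<le> (N / (N + real n)) * 2"
      using N_ge_1 by (intro mult_left_mono) auto
    then show ?thesis using N_ge_1 by (simp add: z_def mult.commute)
  qed
  obtain n :: nat where n: "2 * N / (\<delta> / 32) + 8 / (\<delta>\<^sup>2 / 64) \<le> real n" using real_arch_simple by blast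
  have n1: "2 * N / (N + real n) \<le> \<delta> / 32"
  proof -
    have "2 * N / (\<delta> / 32) \<le> N + real n"
    proof -
      have "0 \<le> 8 / (\<delta>\<^sup>2 / 64)" by simp
      then show ?thesis using n N_ge_1 by linarith
    qed
    then show ?thesis using time_pos[of n] \<delta> by (simp add: divide_le_eq mult.commute)
  qed
  have n2: "8 / (N + real n) \<le> \<delta>\<^sup>2 / 64"
  proof -
    have "0 \<le> 2 * N / (\<delta> / 32)" using N_ge_1 \<delta> by simp
    then have "8 / (\<delta>\<^sup>2 / 64) \<le> N + real n" using n N_ge_1 by linarith
    then show ?thesis using time_pos[of n] \<delta> by (simp add: divide_le_eq mult.commute)
  qed
  have zq: "norm (z n - q) \<le> \<delta> / 8"
  proof -
    have "?v - ?e = r *\<^sub>R (\<gamma> - ?e)" by (simp add: urn_increment_def algebra_simps)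
    then have "norm (?v - ?e) = r * norm (\<gamma> - ?e)" using r by simp
    also have "\<dots> \<le> r * 2" using norm_simplex_diff_le_2[OF \<gamma> axis_simplex[of i]] r by (intro mult_left_mono) auto
    finally have "norm (?v - ?e) \<le> 2 * r" by simp
    moreover have "norm (z n - q) \<le> norm (z n - ?v) + norm (?v - ?e) + norm (?e - q)"
      using norm_triangle_ineq[of "z n - ?v" "?v - q"] norm_triangle_ineq[of "?v - ?e" "?e - q"] by simp
    moreover have "norm (?e - q) \<le> 4 * r" using q(2) by (simp add: dist_norm norm_minus_commute)
    ultimately show ?thesis using z[of n] n1 r' by linarith
  qed
  have start: "proximity q n (z n) \<le> \<delta>\<^sup>2 / 32"
    using power_mono[OF zq norm_ge_zero, of 2] n2 by (simp add: proximity_def power_divide)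
  define D where "D = {\<omega>\<in>space M. \<forall>j\<in>{n..n}. Y j \<omega> \<in> {z n}}"
  have D: "D \<in> sets (history M X n)" unfolding D_def by (rule stay_event[OF space_in_history]) auto
  have DM [measurable]: "D \<in> sets M" by (rule history_sets[OF D])
  have DD: "D = {\<omega>\<in>space M. Y n \<omega> = z n}" by (auto simp: D_def)
  have Dpos: "emeasure M D > 0" using zpos(2)[of n] by (simp add: DD)
  define U where "U = ball ?e \<delta>"
  let ?E = "{\<omega>\<in>D. \<exists>k\<ge>n. (\<forall>j. n \<le> j \<and> j < k \<longrightarrow> Y j \<omega> \<in> U) \<and> \<delta>\<^sup>2 / 16 \<le> proximity q k (Y k \<omega>)}"
  have max: "ennreal (\<delta>\<^sup>2 / 16) * emeasure M ?E \<le> (\<integral>\<^sup>+\<omega>. ennreal (proximity q n (Y n \<omega>)) * indicator D \<omega> \<partial>M)"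
  proof (rule maximal_inequality[OF D])
    fix k x assume x: "x \<in> states" "x \<in> U"
    define t where "t = (1 / 2) / (N + real k + 1)"
    have "average k (proximity q (Suc k)) x \<le> (1 - t) * proximity q k x"
      unfolding t_def using con[OF states_simplex[OF x(1)]] x(2)
      by (intro proximity_contracts[OF x(1)]) (auto simp: U_def dist_commute)
    also have "\<dots> \<le> 1 * proximity q k x"
      using time_pos[of k] by (intro mult_right_mono proximity_nonneg) (simp add: t_def)
    finally show "average k (proximity q (Suc k)) x \<le> proximity q k x" by simp
  qed (auto simp: U_def proximity_nonneg)
  have "(\<integral>\<^sup>+\<omega>. ennreal (proximity q n (Y n \<omega>)) * indicator D \<omega> \<partial>M) \<le> (\<integral>\<^sup>+\<omega>. ennreal (\<delta>\<^sup>2 / 32) * indicator D \<omega> \<partial>M)"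
    using start by (intro nn_integral_mono) (auto simp: DD indicator_def intro!: ennreal_leI)
  also have "\<dots> = ennreal (\<delta>\<^sup>2 / 32) * emeasure M D" by (rule nn_integral_cmult_indicator[OF DM])
  finally have bound: "ennreal (\<delta>\<^sup>2 / 16) * emeasure M ?E \<le> ennreal (\<delta>\<^sup>2 / 32) * emeasure M D"
    using max by (rule order_trans[rotated])
  have EM: "?E \<in> sets M"
  proof -
    have [measurable]: "U \<in> sets borel" by (simp add: U_def)
    have "{\<omega>\<in>space M. \<exists>k\<ge>n. (\<forall>j. n \<le> j \<and> j < k \<longrightarrow> Y j \<omega> \<in> U) \<and> \<delta>\<^sup>2 / 16 \<le> proximity q k (Y k \<omega>)} \<in> sets M"
      by measurable
    from sets.Int[OF DM this] show ?thesis
      by (rule back_subst[of "\<lambda>A. A \<in> sets M"]) (auto simp: D_def)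
  qed
  have "AE \<omega> in M. \<omega> \<in> D \<longrightarrow> \<omega> \<in> ?E"
  proof -
    have "AE \<omega> in M. (\<forall>k\<ge>n. Y k \<omega> \<in> U) \<longrightarrow> (\<lambda>n. Y n \<omega>) \<longlonglongrightarrow> q"
      using con by (intro converges_while_contracting q(1)) (auto simp: U_def dist_commute dest: states_simplex)
    then show ?thesis using never
    proof eventually_elim
      case (elim \<omega>)
      show ?case
      proof (rule impI, rule ccontr)
        assume w: "\<omega> \<in> D" "\<omega> \<notin> ?E"
        have "Y k \<omega> \<in> U" if "k \<ge> n" for k
          using that
        proof (induction k rule: less_induct)
          case (less k)
          then have "\<forall>j. n \<le> j \<and> j < k \<longrightarrow> Y j \<omega> \<in> U" by blast
          then have "\<not> \<delta>\<^sup>2 / 16 \<le> proximity q k (Y k \<omega>)" using w less.prems by blast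
          then have "proximity q k (Y k \<omega>) < \<delta>\<^sup>2 / 16" by simp
          moreover have "(norm (Y k \<omega> - q))\<^sup>2 \<le> proximity q k (Y k \<omega>)"
            using time_pos[of k] by (simp add: proximity_def)
          ultimately have "(norm (Y k \<omega> - q))\<^sup>2 \<le> (\<delta> / 4)\<^sup>2" by (simp add: power_divide)
          then have "norm (Y k \<omega> - q) \<le> \<delta> / 4"
            by (rule power2_le_imp_le) (use \<delta> in simp)
          then have "dist (Y k \<omega>) q \<le> \<delta> / 4" by (simp add: dist_norm)
          then have "dist (Y k \<omega>) ?e < \<delta>"
            using dist_triangle[of "Y k \<omega>" ?e q] q(2) r' r(1) \<delta> by linarith
          then show ?case by (simp add: U_def dist_commute)
        qed
        then show False using elim by blast
      qed
    qed
  qed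
  then have "emeasure M D \<le> emeasure M ?E" by (rule emeasure_mono_AE[OF _ EM])
  then have "ennreal (\<delta>\<^sup>2 / 16) * emeasure M D \<le> ennreal (\<delta>\<^sup>2 / 16) * emeasure M ?E"
    by (rule mult_left_mono) simp
  also note bound
  finally have "ennreal (\<delta>\<^sup>2 / 16) * emeasure M D \<le> ennreal (\<delta>\<^sup>2 / 32) * emeasure M D" .
  moreover have "ennreal a * emeasure M D = ennreal (a * measure M D)" if "0 \<le> a" for a
    using that by (simp add: emeasure_eq_measure ennreal_mult)
  ultimately have "ennreal (\<delta>\<^sup>2 / 16 * measure M D) \<le> ennreal (\<delta>\<^sup>2 / 32 * measure M D)" by simp
  then have "\<delta>\<^sup>2 / 16 * measure M D \<le> \<delta>\<^sup>2 / 32 * measure M D" by (simp add: ennreal_le_iff del: times_divide_eq_left)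
  moreover have "0 < measure M D" using Dpos by (simp add: emeasure_eq_measure)
  ultimately show False using \<delta> by (simp add: field_simps)
qed

lemma share_measurable: "share X n \<in> borel_measurable M"
proof -
  have "(\<lambda>\<omega>. X 0 \<omega> $ i) \<in> borel_measurable M" for i
    by (rule measurable_compose[OF X_measurable borel_measurable_nth])
  then have "(\<lambda>\<omega>. share X n \<omega>) \<in> borel_measurable M"
    unfolding share_def
    by (intro borel_measurable_scaleR borel_measurable_divide borel_measurable_add borel_measurable_sum
        borel_measurable_const X_measurable)
  then show ?thesis by simp
qed

lemma limit_share_measurable: "limit_share X \<in> borel_measurable M"
  unfolding limit_share_def using share_measurable by measurable

text \<open>The radius \<open>\<delta>\<close> and the bound \<open>\<eta>\<close> depend only on \<open>\<beta>\<close> and the number of agents, see \<open>common_radius\<close> and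
  \<open>almost_fixed_points_cluster\<close>.\<close>

lemma exactly_one_winner:
  assumes \<delta>: "0 < \<delta>"
    and lin: "\<And>S :: 'a set. S \<noteq> {} \<Longrightarrow> linear_near \<beta> \<delta> S"
    and exc: "\<And>S :: 'a set. 2 \<le> card S \<Longrightarrow> excited_near \<beta> r \<gamma> \<delta> S"
    and sep: "\<And>S T :: 'a set. S \<noteq> {} \<Longrightarrow> T \<noteq> {} \<Longrightarrow> S \<noteq> T \<Longrightarrow> 4 * \<delta> \<le> dist (uniform_on S :: real ^ 'a) (uniform_on T)"
    and clu: "\<And>x :: real ^ 'a. x \<in> prob_simplex \<Longrightarrow> norm (draw x - x) < \<eta> \<Longrightarrow>
      \<exists>S. S \<noteq> {} \<and> dist x (uniform_on S) < \<delta> / 2"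
    and r': "r \<le> 1 / 256" "r \<le> (\<beta> - 1) / (2 * \<beta>)" "64 * r < \<delta>" "4 * r < \<eta>" "\<And>i. 4 * r < 1 - \<gamma> $ i"
  shows "(AE \<omega> in M. convergent (\<lambda>n. share X n \<omega>)) \<and>
        measure M {\<omega> \<in> space M. \<exists>!i. limit_share X \<omega> $ i > \<gamma> $ i} = 1 \<and>
        (\<forall>i. measure M {\<omega> \<in> space M. limit_share X \<omega> $ i > \<gamma> $ i} > 0)"
proof -
  have "\<exists>q. q \<in> prob_simplex \<and> dist q (axis i 1) \<le> 4 * r \<and>
      (\<forall>x. x \<in> prob_simplex \<longrightarrow> dist x (axis i 1) < \<delta> \<longrightarrow> norm (target x - q) \<le> 1 / 2 * norm (x - q)) \<and>
      (\<forall>j. \<gamma> $ j < q $ j \<longleftrightarrow> j = i)" for i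
  proof -
    have "12 * r < \<delta>" using r'(3) r(1) by linarith
    then obtain q where "q \<in> prob_simplex" "dist q (axis i 1) \<le> 4 * r"
      "\<And>x. x \<in> prob_simplex \<Longrightarrow> dist x (axis i 1) < \<delta> \<Longrightarrow> norm (target x - q) \<le> 1 / 2 * norm (x - q)"
      "\<And>j. \<gamma> $ j < q $ j \<longleftrightarrow> j = i"
      using vertex_fixed_point[of \<beta> \<gamma> r \<delta> i] \<beta> \<gamma> r lin[of "{i}"] r'(5)[of i] by auto
    then show ?thesis by blast
  qed
  then obtain q where q: "\<And>i. q i \<in> prob_simplex" "\<And>i. dist (q i) (axis i 1) \<le> 4 * r"
    "\<And>i x. x \<in> prob_simplex \<Longrightarrow> dist x (axis i 1) < \<delta> \<Longrightarrow> norm (target x - q i) \<le> 1 / 2 * norm (x - q i)"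
    "\<And>i j. \<gamma> $ j < q i $ j \<longleftrightarrow> j = i"
    by metis
  have mixed: "AE \<omega> in M. \<forall>S\<in>{S. 2 \<le> card S}. \<forall>k. \<not> (\<forall>n\<ge>k. dist (Y n \<omega>) (uniform_on S) < \<delta> / 2)"
  proof -
    have "AE \<omega> in M. \<not> (\<forall>n\<ge>k. dist (Y n \<omega>) (uniform_on S) < \<delta> / 2)" if "2 \<le> card S" for S k
    proof (rule leaves_mixed_region[OF that r'(1,2) \<delta> _ exc[OF that]])
      show "linear_near \<beta> \<delta> S" using that by (intro lin) auto
    qed
    then show ?thesis by (subst AE_ball_countable) (auto simp: AE_all_countable countable_finite)
  qed
  have pure: "AE \<omega> in M. \<forall>i k. (\<forall>n\<ge>k. Y n \<omega> \<in> ball (axis i 1) \<delta>) \<longrightarrow> (\<lambda>n. Y n \<omega>) \<longlonglongrightarrow> q i"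
  proof -
    have "AE \<omega> in M. (\<forall>n\<ge>k. Y n \<omega> \<in> ball (axis i 1) \<delta>) \<longrightarrow> (\<lambda>n. Y n \<omega>) \<longlonglongrightarrow> q i" for i k
    proof (rule converges_while_contracting[OF _ _ q(1)])
      show "norm (target x - q i) \<le> 1 / 2 * norm (x - q i)"
        if "x \<in> states" "x \<in> ball (axis i 1) \<delta>" for x
        using that(2) by (intro q(3) states_simplex that(1)) (simp add: dist_commute)
    qed simp
    then have "AE \<omega> in M. \<forall>k. (\<forall>n\<ge>k. Y n \<omega> \<in> ball (axis i 1) \<delta>) \<longrightarrow> (\<lambda>n. Y n \<omega>) \<longlonglongrightarrow> q i" for i
      unfolding AE_all_countable by blast
    then show ?thesis by (rule eventually_all_finite)
  qed
  have limit: "AE \<omega> in M. \<exists>i. (\<lambda>n. Y n \<omega>) \<longlonglongrightarrow> q i"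
    using mixed pure AE_drift_vanishes AE_small_steps AE_states
  proof eventually_elim
    case (elim \<omega>)
    have near: "\<forall>\<^sub>F n in sequentially. \<exists>S\<in>{S. S \<noteq> {}}. dist (Y n \<omega>) (uniform_on S) < \<delta> / 2"
    proof -
      have "0 < \<eta> - 2 * r" using r'(4) r(1) by linarith
      from order_tendstoD(2)[OF elim(3) this] show ?thesis
      proof eventually_elim
        case (elim n)
        let ?x = "Y n \<omega>"
        have x: "?x \<in> states" using \<open>\<forall>n. Y n \<omega> \<in> states\<close> by blast
        have "draw ?x - ?x = mean_field ?x + r *\<^sub>R (draw ?x - \<gamma>)"
          by (simp add: mean_increment_def algebra_simps)
        then have "norm (draw ?x - ?x) \<le> norm (mean_field ?x) + norm (r *\<^sub>R (draw ?x - \<gamma>))"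
          by (metis norm_triangle_ineq)
        also have "norm (r *\<^sub>R (draw ?x - \<gamma>)) \<le> r * 2"
          using norm_simplex_diff_le_2[OF draw_prob_states[OF x] \<gamma>] r by (simp add: mult_left_mono)
        finally have "norm (draw ?x - ?x) < \<eta>" using elim by linarith
        from clu[OF states_simplex[OF x] this] show ?case by blast
      qed
    qed
    have steps: "\<forall>\<^sub>F n in sequentially. dist (Y (Suc n) \<omega>) (Y n \<omega>) < \<delta> / 2"
    proof -
      obtain k :: nat where k: "4 / \<delta> < real k" using reals_Archimedean2 by blast
      have "dist (Y (Suc n) \<omega>) (Y n \<omega>) < \<delta> / 2" if "n \<ge> k" for n
      proof -
        have "4 / \<delta> < N + real n + 1" using k that N_ge_1 by linarith
        then have "2 / (N + real n + 1) < \<delta> / 2" using \<delta> time_pos[of n] by (simp add: field_simps)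
        then show ?thesis using elim(4) by (meson le_less_trans)
      qed
      then show ?thesis by (auto simp: eventually_sequentially)
    qed
    have apart: "4 * (\<delta> / 2) \<le> dist (uniform_on S :: real ^ 'a) (uniform_on T)"
      if "S \<in> {S. S \<noteq> {}}" "T \<in> {S. S \<noteq> {}}" "S \<noteq> T" for S T
      using sep[of S T] that \<delta> by simp
    obtain S k where S: "S \<in> {S. S \<noteq> {}}" "\<And>n. n \<ge> k \<Longrightarrow> dist (Y n \<omega>) (uniform_on S) < \<delta> / 2"
    proof (rule eventually_in_one_ball[OF _ near steps])
      show "4 * (\<delta> / 2) \<le> dist (uniform_on S :: real ^ 'a) (uniform_on T)"
        if "S \<in> {S. S \<noteq> {}}" "T \<in> {S. S \<noteq> {}}" "S \<noteq> T" for S T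
        using that by (rule apart)
    qed (rule that)
    then have "\<not> 2 \<le> card S" using elim(1) by blast
    moreover have "card S \<noteq> 0" using S(1) by auto
    ultimately have "card S = 1" by linarith
    then obtain i where i: "S = {i}" using card_1_singletonE by blast
    have "Y n \<omega> \<in> ball (axis i 1) \<delta>" if "n \<ge> k" for n
      using S(2)[OF that] \<delta> by (simp add: i uniform_on_singleton dist_commute)
    then show ?case using elim(2) by blast
  qed
  have conv: "AE \<omega> in M. convergent (\<lambda>n. share X n \<omega>)"
    using limit AE_share_eq by eventually_elim (auto simp: convergent_def)
  have lim_eq: "AE \<omega> in M. \<forall>i. (\<lambda>n. Y n \<omega>) \<longlonglongrightarrow> q i \<longrightarrow> limit_share X \<omega> = q i"
    using AE_share_eq by eventually_elim (auto simp: limit_share_def intro: limI)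
  note [measurable] = limit_share_measurable
  have unique: "AE \<omega> in M. \<exists>!i. limit_share X \<omega> $ i > \<gamma> $ i"
    using limit lim_eq
  proof eventually_elim
    case (elim \<omega>)
    then obtain i where "limit_share X \<omega> = q i" by blast
    then show ?case using q(4) by auto
  qed
  have "{\<omega> \<in> space M. \<exists>!i. limit_share X \<omega> $ i > \<gamma> $ i} \<in> sets M"
    unfolding Ex1_def by measurable
  from prob_Collect_eq_1[OF this] have one: "measure M {\<omega> \<in> space M. \<exists>!i. limit_share X \<omega> $ i > \<gamma> $ i} = 1"
    using unique by simp
  have "measure M {\<omega> \<in> space M. limit_share X \<omega> $ i > \<gamma> $ i} > 0" for i
  proof (rule ccontr)
    assume "\<not> ?thesis"
    then have "measure M {\<omega> \<in> space M. limit_share X \<omega> $ i > \<gamma> $ i} = 0"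
      using measure_nonneg[of M] by (simp add: not_less order_antisym)
    moreover have "{\<omega> \<in> space M. limit_share X \<omega> $ i > \<gamma> $ i} \<in> sets M" by measurable
    from prob_Collect_eq_0[OF this]
    have "measure M {\<omega> \<in> space M. limit_share X \<omega> $ i > \<gamma> $ i} = 0
      \<longleftrightarrow> (AE \<omega> in M. \<not> limit_share X \<omega> $ i > \<gamma> $ i)" .
    ultimately have "AE \<omega> in M. \<not> limit_share X \<omega> $ i > \<gamma> $ i" by (simp only:)
    then have "AE \<omega> in M. \<not> (\<lambda>n. Y n \<omega>) \<longlonglongrightarrow> q i"
      using lim_eq by eventually_elim (use q(4) in auto)
    then show False
      using attracted_with_positive_probability[OF \<delta> less_imp_le[OF r'(3)] q(1) q(2) q(3), of i] by simp
  qed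
  then show ?thesis using conv one by blast
qed

end

theorem proposition2p3:
  fixes \<gamma> :: "real ^ 'a::finite" and \<beta> :: real
  assumes "CARD('a) \<ge> 2"
    and "\<gamma> \<in> prob_simplex"
    and "\<forall>i. \<gamma> $ i < 1"
    and "\<beta> > 1"
  shows "\<exists>rc>0. \<forall>r\<in>{0..1}. r < rc \<longrightarrow>
    (\<forall>x0 :: real ^ 'a. (\<forall>i. 1 \<le> x0 $ i) \<longrightarrow>
      (\<forall>(M :: 'w measure) X. polya_urn M r \<gamma> (\<lambda>i k. k powr \<beta>) x0 X \<longrightarrow>
        (AE \<omega> in M. convergent (\<lambda>n. share X n \<omega>)) \<and>
        measure M {\<omega> \<in> space M. \<exists>!i. limit_share X \<omega> $ i > \<gamma> $ i} = 1 \<and>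
        (\<forall>i. measure M {\<omega> \<in> space M. limit_share X \<omega> $ i > \<gamma> $ i} > 0)))"
proof -
  obtain \<delta> where \<delta>: "\<delta> > 0"
    "\<And>S :: 'a set. S \<noteq> {} \<Longrightarrow> linear_near \<beta> \<delta> S"
    "\<And>(S :: 'a set) \<gamma> r. 2 \<le> card S \<Longrightarrow> \<gamma> \<in> prob_simplex \<Longrightarrow> 0 \<le> r \<Longrightarrow> r \<le> 1 / 256 \<Longrightarrow> excited_near \<beta> r \<gamma> \<delta> S"
    "\<And>S T :: 'a set. S \<noteq> {} \<Longrightarrow> T \<noteq> {} \<Longrightarrow> S \<noteq> T \<Longrightarrow> 4 * \<delta> \<le> dist (uniform_on S :: real ^ 'a) (uniform_on T)"
    by (rule common_radius[OF \<open>\<beta> > 1\<close>, where ?'a = 'a]) (rule that)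
  obtain \<eta> where \<eta>: "\<eta> > 0" "\<And>x :: real ^ 'a. x \<in> prob_simplex \<Longrightarrow>
    norm (draw_prob \<beta> x - x) < \<eta> \<Longrightarrow> \<exists>S. S \<noteq> {} \<and> dist x (uniform_on S) < \<delta> / 2"
    using almost_fixed_points_cluster[OF \<open>\<beta> > 1\<close>, of "\<delta> / 2"] \<delta>(1) by auto
  define g where "g = Min (range (\<lambda>i. 1 - \<gamma> $ i))"
  have g: "g > 0" "\<And>i. g \<le> 1 - \<gamma> $ i" using assms(3) by (auto simp: g_def)
  define rc where "rc = Min {1 / 256, (\<beta> - 1) / (2 * \<beta>), \<delta> / 64, \<eta> / 4, g / 4}"
  have rc: "rc > 0" "rc \<le> 1 / 256" "rc \<le> (\<beta> - 1) / (2 * \<beta>)" "rc \<le> \<delta> / 64" "rc \<le> \<eta> / 4" "rc \<le> g / 4"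
    using \<delta>(1) \<eta>(1) g(1) \<open>\<beta> > 1\<close> by (auto simp: rc_def)
  have main: "(AE \<omega> in M. convergent (\<lambda>n. share X n \<omega>)) \<and>
        measure M {\<omega> \<in> space M. \<exists>!i. limit_share X \<omega> $ i > \<gamma> $ i} = 1 \<and>
        (\<forall>i. measure M {\<omega> \<in> space M. limit_share X \<omega> $ i > \<gamma> $ i} > 0)"
    if r_rc: "r \<in> {0..1}" "r < rc" and urn: "polya_urn M r \<gamma> (\<lambda>i k. k powr \<beta>) x0 X"
    for r and x0 :: "real ^ 'a" and M :: "'w measure" and X
  proof -
    interpret polya_urn M r \<gamma> "\<lambda>i k. k powr \<beta>" x0 X by (rule urn)
    interpret power_urn M r \<gamma> x0 X \<beta> by unfold_locales (rule \<open>\<beta> > 1\<close>)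
    have r_small: "r \<le> 1 / 256" "r \<le> (\<beta> - 1) / (2 * \<beta>)" "64 * r < \<delta>" "4 * r < \<eta>"
      using rc r_rc(2) by linarith+
    have r_gap: "4 * r < 1 - \<gamma> $ i" for i using g(2)[of i] rc(6) r_rc(2) by linarith
    have excite: "excited_near \<beta> r \<gamma> \<delta> S" if "2 \<le> card S" for S
      using r_rc(1) by (intro \<delta>(3) that assms(2) r_small) simp
    show ?thesis
      by (rule exactly_one_winner[OF \<delta>(1,2) excite \<delta>(4) \<eta>(2) r_small r_gap])
  qed
  show ?thesis
    by (intro exI[of _ rc] conjI[OF rc(1)] ballI impI allI main)
qed

end
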